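(* Let $\epsilon>0$ and $\delta\in(0,1)$. For $1\le i\le n$ let $A_i,B_i,C_i,D_i,L_i,\bar x_{i,0}$ be given public data as in the context, let $\mathcal K_i$ be the $i$-th steady-state Kalman filter, let $T_i$ be the diagonal $0/1$ selection matrix and let $\rho\in\mathbb R_+^n$. Let $\gamma_i$ be the $\mathcal H_\infty$ norm of the transfer function $L_i\mathcal K_iC_iT_i$ and let $\gamma=\max_{1\le i\le n}\{\gamma_i\rho_i\}$. Then the mechanism releasing the signal $$\Big(\sum_{i=1}^n L_i\mathcal K_i y_i\Big)+\gamma\,\kappa(\delta,\epsilon)\,\nu ,$$ where $\nu$ is a standard white Gaussian noise (the $\nu_t$ are i.i.d. $\mathcal N(0,I)$, of the dimension of the released signal) independent of $\{w_i\}_{1\le i\le n}$ and $\{x_{i,0}\}_{1\le i\le n}$, is $(\epsilon,\delta)$-differentially private for the adjacency relation $\mathrm{Adj}^\rho_{\mathcal S}$ on global state trajectories $x=(x_1,\dots,x_n)$.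
   Context: All signals are discrete-time, indexed by $t\ge 0$. **Systems.** For $1\le i\le n$, participant $i$ has state $x_{i,t+1}=A_ix_{i,t}+B_iw_{i,t}$ and sends the measurement $y_{i,t}=C_ix_{i,t}+D_iw_{i,t}$. Here the $w_i$ are mutually independent standard zero-mean Gaussian white noises (identity covariance), and $x_{i,0}$ is Gaussian with mean $\bar x_{i,0}$, independent of $w_i$. Each $D_i$ has full row rank, $B_iD_i^T=0$ (so process and measurement noises are uncorrelated), $(A_i,C_i)$ is detectable and $(A_i,B_i)$ is stabilizable. The quantity to be estimated is $z_t=\sum_i L_ix_{i,t}$. The data $\bar x_{i,0},A_i,B_i,C_i,D_i,L_i$ are public and fixed. **Kalman filter $\mathcal K_i$.** Let $P_i\succeq 0$ be the stabilizing solution of $$P_i=A_iP_iA_i^T-A_iP_iC_i^T(C_iP_iC_i^T+D_iD_i^T)^{-1}C_iP_iA_i^T+B_iB_i^T,$$ and let $M_i=P_iC_i^T(C_iP_iC_i^T+D_iD_i^T)^{-1}$. The filter maps $y_i$ to $\hat x_i$ by $$\hat x_{i,t}=\hat x^-_{i,t}+M_i(y_{i,t}-C_i\hat x^-_{i,t}),\qquad \hat x^-_{i,t+1}=A_i\hat x_{i,t},\qquad \hat x^-_{i,0}=\bar x_{i,0},$$ where the initial condition is fixed and public. Its transfer function is $\mathcal K_i(z)=(I-M_iC_i)(zI-A_i(I-M_iC_i))^{-1}A_iM_i+M_i$, which is stable. The symbol $L_i\mathcal K_iC_iT_i$ denotes the transfer function $L_i\mathcal K_i(z)C_iT_i$.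 **$\mathcal H_\infty$ norm.** For a stable transfer function $\mathcal G$, $\|\mathcal G\|_\infty=\operatorname{ess\,sup}_{\omega\in[-\pi,\pi)}\sigma_{\max}(\mathcal G(e^{i\omega}))$, where $\sigma_{\max}$ is the largest singular value. **Adjacency.** For each $i$ fix a subset $\mathcal S_i$ of the coordinates of $x_i$. Let $T_i$ be the diagonal matrix with $[T_i]_{jj}=1$ if $j\in\mathcal S_i$ and $0$ otherwise. For state trajectories $x=(x_1,\dots,x_n)$ and $x'=(x_1',\dots,x_n')$, $\mathrm{Adj}^\rho_{\mathcal S}(x,x')$ holds iff for some $i$: $\|T_ix_i-T_ix_i'\|_2\le\rho_i$ (the $\ell_2$ norm of the signal), $(I-T_i)x_i=(I-T_i)x_i'$, and $x_j=x_j'$ for all $j\ne i$. **Mechanism as a function of the dataset.** The dataset is the global state trajectory $x$. For dataset $x$ the measurements are $y_{i,t}=C_ix_{i,t}+v_{i,t}$. The measurement noise $v_{i,t}=D_iw_{i,t}$ has the same realization independently of the considered variation in the dataset. The output space is the space of vector-valued sequences indexed by $t\ge0$ with the product Borel $\sigma$-algebra. **Differential privacy.** A mechanism $M$ on a space $\mathsf D$ equipped with a binary relation $\mathrm{Adj}$ is a map assigning to each $d\in\mathsf D$ a random variable $M(d)$ in a measurable space $(\mathsf R,\mathcal M)$. A measure $\mu$ on $(\mathsf R,\mathcal M)$ is $\delta$-bounded if it is a finite positive measure with $\mu(\mathsf R)\le\delta$. The mechanism is $(\epsilon,\delta)$-differentially private if there exists a $\delta$-bounded measure $\mu$ on $(\mathsf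 R,\mathcal M)$ such that for all $d,d'\in\mathsf D$ with $\mathrm{Adj}(d,d')$ and for all $S\in\mathcal M$, $\mathbb P(M(d)\in S)\le e^\epsilon\,\mathbb P(M(d')\in S)+\mu(S)$. **Noise scale.** $\kappa(\delta,\epsilon)=\frac1{2\epsilon}\big(K+\sqrt{K^2+2\epsilon}\big)$ with $K=\mathcal Q^{-1}(\delta)$ and $\mathcal Q(x)=\frac1{\sqrt{2\pi}}\int_x^\infty e^{-u^2/2}\,du$.
   Formalization: The δ-bounded measure μ may depend on the adjacent pair (d,d'), i.e. the usual (ε,δ)-differential privacy; with a single μ for all adjacent pairs the claim is false whenever γ>0, since translated pairs force μ to be infinite. *)

theory Defs
  imports
    "HOL-Probability.Probability"
    "Jordan_Normal_Form.Spectral_Radius"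
    "Jordan_Normal_Form.Gauss_Jordan_Elimination"
    "Jordan_Normal_Form.Schur_Decomposition"
    "Jordan_Normal_Form.DL_Rank"
begin

text \<open>
  Matrices and vectors are those of \<^theory>\<open>Jordan_Normal_Form.Matrix\<close>, since the dimensions vary with
  the participant. Coordinates are numbered from 0, and signals are functions of the
  time \<open>t :: nat\<close>.
\<close>

hide_const (open) Finite_Cartesian_Product.vec Finite_Cartesian_Product.mat
  Finite_Cartesian_Product.row Determinants.det
hide_type (open) Finite_Cartesian_Product.vec
unbundle no vec_syntax
unbundle no inner_syntax

abbreviation matinv :: "'a :: field mat \<Rightarrow> 'a mat" where
  "matinv X \<equiv> the (mat_inverse X)"

abbreviation cmat :: "real mat \<Rightarrow> complex mat" where
  "cmat X \<equiv> map_mat complex_of_real X"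


subsection \<open>Linear systems and the steady-state Kalman filter\<close>

definition schur_stable :: "real mat \<Rightarrow> bool" where
  "schur_stable F \<longleftrightarrow> (\<forall>z. eigenvalue (cmat F) z \<longrightarrow> cmod z < 1)"

definition detectable :: "real mat \<Rightarrow> real mat \<Rightarrow> bool" where
  "detectable A C \<longleftrightarrow>
     (\<exists>K \<in> carrier_mat (dim_row A) (dim_row C). schur_stable (A - K * C))"

definition stabilizable :: "real mat \<Rightarrow> real mat \<Rightarrow> bool" where
  "stabilizable A B \<longleftrightarrow>
     (\<exists>K \<in> carrier_mat (dim_col B) (dim_row A). schur_stable (A - B * K))"

definition full_row_rank :: "real mat \<Rightarrow> bool" where
  "full_row_rank D \<longleftrightarrow> vec_space.rank (dim_row D) D = dim_row D"

definition pos_semidef :: "nat \<Rightarrow> real mat \<Rightarrow> bool" where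
  "pos_semidef m P \<longleftrightarrow> P \<in> carrier_mat m m \<and> transpose_mat P = P \<and>
     (\<forall>v \<in> carrier_vec m. 0 \<le> scalar_prod v (P *\<^sub>v v))"

definition kalman_gain :: "real mat \<Rightarrow> real mat \<Rightarrow> real mat \<Rightarrow> real mat" where
  "kalman_gain C D P =
     P * transpose_mat C * matinv (C * P * transpose_mat C + D * transpose_mat D)"

text \<open>
  The matrix \<open>A - A M C\<close> in the last conjunct is the closed-loop matrix of the
  one-step predictor; it is the usual meaning of ``stabilizing'' for a Riccati solution.
\<close>
definition stabilizing_riccati_solution ::
  "real mat \<Rightarrow> real mat \<Rightarrow> real mat \<Rightarrow> real mat \<Rightarrow> real mat \<Rightarrow> bool" where
  "stabilizing_riccati_solution A B C D P \<longleftrightarrow>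
     pos_semidef (dim_row A) P \<and>
     P = A * P * transpose_mat A
         - A * P * transpose_mat C * matinv (C * P * transpose_mat C + D * transpose_mat D)
           * C * P * transpose_mat A
         + B * transpose_mat B \<and>
     schur_stable (A - A * kalman_gain C D P * C)"

definition kf_update :: "real mat \<Rightarrow> real mat \<Rightarrow> real vec \<Rightarrow> real vec \<Rightarrow> real vec" where
  "kf_update C M xp y = xp + M *\<^sub>v (y - C *\<^sub>v xp)"

text \<open>The predictions \<open>\<hat>x\<^sup>-\<^sub>t\<close> and the estimates \<open>\<hat>x\<^sub>t\<close> for the measurement signal \<open>y\<close>.\<close>
primrec kf_pred ::
  "real mat \<Rightarrow> real mat \<Rightarrow> real mat \<Rightarrow> real vec \<Rightarrow> (nat \<Rightarrow> real vec) \<Rightarrow> nat \<Rightarrow> real vec" where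
  "kf_pred A C M x0 y 0 = x0"
| "kf_pred A C M x0 y (Suc t) = A *\<^sub>v kf_update C M (kf_pred A C M x0 y t) (y t)"

definition kf_est ::
  "real mat \<Rightarrow> real mat \<Rightarrow> real mat \<Rightarrow> real vec \<Rightarrow> (nat \<Rightarrow> real vec) \<Rightarrow> nat \<Rightarrow> real vec" where
  "kf_est A C M x0 y t = kf_update C M (kf_pred A C M x0 y t) (y t)"

definition kalman_tf :: "real mat \<Rightarrow> real mat \<Rightarrow> real mat \<Rightarrow> complex \<Rightarrow> complex mat" where
  "kalman_tf A C M z =
     cmat (1\<^sub>m (dim_row A) - M * C)
       * matinv (z \<cdot>\<^sub>m 1\<^sub>m (dim_row A) - cmat (A * (1\<^sub>m (dim_row A) - M * C)))
       * cmat (A * M)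
     + cmat M"


subsection \<open>The \<open>H\<close>-infinity norm\<close>

definition singular_values :: "complex mat \<Rightarrow> real set" where
  "singular_values G = (\<lambda>z. sqrt (Re z)) ` spectrum (mat_adjoint G * G)"

text \<open>Meaningful when \<open>G\<close> has at least one column; the spectrum is empty otherwise.\<close>
definition sigma_max :: "complex mat \<Rightarrow> real" where
  "sigma_max G = Max (singular_values G)"

text \<open>
  The essential supremum is taken in the extended reals. It is finite whenever \<open>G\<close> is stable
  (no poles on or outside the unit circle), and only that case is meant.
\<close>
definition hinf_norm :: "(complex \<Rightarrow> complex mat) \<Rightarrow> real" where
  "hinf_norm G = real_of_ereal
     (esssup (restrict_space lborel {-pi..<pi}) (\<lambda>\<omega>. ereal (sigma_max (G (cis \<omega>)))))"


subsection \<open>Adjacency of state trajectories\<close>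

definition selection_mat :: "nat \<Rightarrow> nat set \<Rightarrow> real mat" where
  "selection_mat m S = mat m m (\<lambda>(j, k). if j = k \<and> j \<in> S then 1 else 0)"

text \<open>
  The norm \<open>l2_norm\<close> is meaningful only for signals of finite energy, so finiteness is a
  separate conjunct wherever a bound on the norm is stated.
\<close>
definition l2_signal :: "(nat \<Rightarrow> real vec) \<Rightarrow> bool" where
  "l2_signal u \<longleftrightarrow> summable (\<lambda>t. scalar_prod (u t) (u t))"

definition l2_norm :: "(nat \<Rightarrow> real vec) \<Rightarrow> real" where
  "l2_norm u = sqrt (\<Sum>t. scalar_prod (u t) (u t))"

text \<open>A global trajectory \<open>x\<close> gives the state \<open>x i t\<close> of participant \<open>i\<close> at time \<open>t\<close>.\<close>
definition trajectories :: "nat \<Rightarrow> (nat \<Rightarrow> nat) \<Rightarrow> (nat \<Rightarrow> nat \<Rightarrow> real vec) set" where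
  "trajectories n m = {x. \<forall>i \<in> {1..n}. \<forall>t. x i t \<in> carrier_vec (m i)}"

definition adj ::
  "nat \<Rightarrow> (nat \<Rightarrow> nat) \<Rightarrow> (nat \<Rightarrow> nat set) \<Rightarrow> (nat \<Rightarrow> real) \<Rightarrow>
   (nat \<Rightarrow> nat \<Rightarrow> real vec) \<Rightarrow> (nat \<Rightarrow> nat \<Rightarrow> real vec) \<Rightarrow> bool" where
  "adj n m S \<rho> x x' \<longleftrightarrow> (\<exists>i \<in> {1..n}.
     (let T = selection_mat (m i) (S i);
          u = (\<lambda>t. T *\<^sub>v x i t - T *\<^sub>v x' i t)
      in l2_signal u \<and> l2_norm u \<le> \<rho> i \<and>
         (\<forall>t. (1\<^sub>m (m i) - T) *\<^sub>v x i t = (1\<^sub>m (m i) - T) *\<^sub>v x' i t)) \<and>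
     (\<forall>j \<in> {1..n} - {i}. \<forall>t. x j t = x' j t))"


subsection \<open>Random vectors and white noise\<close>

text \<open>
  The Borel \<open>\<sigma>\<close>-algebra of \<open>\<real>\<^sup>d\<close>, on the carrier \<open>carrier_vec d\<close>: it is pulled back along
  the coordinates, because the type of vectors itself carries no topology.
\<close>
definition vec_borel :: "nat \<Rightarrow> real vec measure" where
  "vec_borel d =
     vimage_algebra (carrier_vec d) (\<lambda>v. \<lambda>k \<in> {..<d}. v $ k) (\<Pi>\<^sub>M k \<in> {..<d}. borel)"

definition signal_space :: "nat \<Rightarrow> (nat \<Rightarrow> real vec) measure" where
  "signal_space d = (\<Pi>\<^sub>M t \<in> UNIV. vec_borel d)"

definition std_gaussian :: "nat \<Rightarrow> real vec measure" where
  "std_gaussian d =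
     distr (\<Pi>\<^sub>M k \<in> {..<d}. density lborel (\<lambda>u. ennreal (std_normal_density u))) (vec_borel d) (vec d)"

definition white_noise :: "'o measure \<Rightarrow> nat \<Rightarrow> (nat \<Rightarrow> 'o \<Rightarrow> real vec) \<Rightarrow> bool" where
  "white_noise \<Omega> d v \<longleftrightarrow>
     prob_space.indep_vars \<Omega> (\<lambda>t. vec_borel d) v UNIV \<and>
     (\<forall>t. distr \<Omega> (vec_borel d) (v t) = std_gaussian d)"

text \<open>The covariance may be singular, so a linear functional of \<open>X\<close> may be almost surely constant.\<close>
definition gaussian_vec :: "'o measure \<Rightarrow> nat \<Rightarrow> ('o \<Rightarrow> real vec) \<Rightarrow> real vec \<Rightarrow> bool" where
  "gaussian_vec \<Omega> d X c \<longleftrightarrow>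
     X \<in> \<Omega> \<rightarrow>\<^sub>M vec_borel d \<and>
     (\<forall>a \<in> carrier_vec d.
        (\<exists>s > 0. distributed \<Omega> lborel (\<lambda>\<omega>. scalar_prod a (X \<omega>))
                   (normal_density (scalar_prod a c) s)) \<or>
        (AE \<omega> in \<Omega>. scalar_prod a (X \<omega>) = scalar_prod a c))"

text \<open>The library's \<^const>\<open>prob_space.indep_var\<close> needs both variables to have the same type.\<close>
definition indep_rv ::
  "'o measure \<Rightarrow> 'a measure \<Rightarrow> ('o \<Rightarrow> 'a) \<Rightarrow> 'b measure \<Rightarrow> ('o \<Rightarrow> 'b) \<Rightarrow> bool" where
  "indep_rv \<Omega> MX X MY Y \<longleftrightarrow>
     X \<in> \<Omega> \<rightarrow>\<^sub>M MX \<and> Y \<in> \<Omega> \<rightarrow>\<^sub>M MY \<and>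
     prob_space.indep_set \<Omega>
       {X -` E \<inter> space \<Omega> | E. E \<in> sets MX} {Y -` E \<inter> space \<Omega> | E. E \<in> sets MY}"


subsection \<open>Differential privacy\<close>

definition delta_bounded :: "'r measure \<Rightarrow> real \<Rightarrow> 'r measure \<Rightarrow> bool" where
  "delta_bounded R \<delta> mu \<longleftrightarrow>
     sets mu = sets R \<and> finite_measure mu \<and> measure mu (space R) \<le> \<delta>"

text \<open>
  The measure \<open>mu\<close> may depend on the adjacent pair. One \<open>mu\<close> for all pairs would be a much
  stronger demand that additive noise cannot meet on an unbounded data space: moving the
  pair along widely separated translates moves the excess mass to disjoint sets, whose
  \<open>mu\<close>-measures all exceed the same positive constant.
\<close>
definition differentially_private ::
  "'o measure \<Rightarrow> 'r measure \<Rightarrow> 'd set \<Rightarrow> ('d \<Rightarrow> 'd \<Rightarrow> bool) \<Rightarrow> real \<Rightarrow> real \<Rightarrow>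
   ('d \<Rightarrow> 'o \<Rightarrow> 'r) \<Rightarrow> bool" where
  "differentially_private \<Omega> R DD Adj \<epsilon> \<delta> mech \<longleftrightarrow>
     (\<forall>d \<in> DD. mech d \<in> \<Omega> \<rightarrow>\<^sub>M R) \<and>
     (\<forall>d \<in> DD. \<forall>d' \<in> DD. Adj d d' \<longrightarrow>
        (\<exists>mu. delta_bounded R \<delta> mu \<and>
           (\<forall>S \<in> sets R. \<P>(\<omega> in \<Omega>. mech d \<omega> \<in> S)
              \<le> exp \<epsilon> * \<P>(\<omega> in \<Omega>. mech d' \<omega> \<in> S) + measure mu S)))"

definition qfun :: "real \<Rightarrow> real" where
  "qfun x = 1 / sqrt (2 * pi) * (LINT u:{x..}|lborel. exp (- u\<^sup>2 / 2))"

text \<open>\<^const>\<open>qfun\<close> is a strictly decreasing bijection from the reals onto the open unit interval.\<close>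
definition kappa :: "real \<Rightarrow> real \<Rightarrow> real" where
  "kappa \<delta> \<epsilon> = (let K = inv_into UNIV qfun \<delta> in 1 / (2 * \<epsilon>) * (K + sqrt (K\<^sup>2 + 2 * \<epsilon>)))"


subsection \<open>The output-perturbation mechanism\<close>

text \<open>
  The data set \<open>x\<close> is a global state trajectory; participant \<open>i\<close> sends
  \<open>y\<^sub>i\<^sub>,\<^sub>t = C\<^sub>i x\<^sub>i\<^sub>,\<^sub>t + D\<^sub>i w\<^sub>i\<^sub>,\<^sub>t\<close>, where the realization of \<open>w\<^sub>i\<close> does not depend on \<open>x\<close>.
\<close>
definition kalman_mechanism ::
  "nat \<Rightarrow> nat \<Rightarrow> (nat \<Rightarrow> real mat) \<Rightarrow> (nat \<Rightarrow> real mat) \<Rightarrow> (nat \<Rightarrow> real mat) \<Rightarrow>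
   (nat \<Rightarrow> real mat) \<Rightarrow> (nat \<Rightarrow> real mat) \<Rightarrow> (nat \<Rightarrow> real vec) \<Rightarrow>
   (nat \<Rightarrow> nat \<Rightarrow> 'o \<Rightarrow> real vec) \<Rightarrow> real \<Rightarrow> (nat \<Rightarrow> 'o \<Rightarrow> real vec) \<Rightarrow>
   (nat \<Rightarrow> nat \<Rightarrow> real vec) \<Rightarrow> 'o \<Rightarrow> nat \<Rightarrow> real vec" where
  "kalman_mechanism n l A C D L M xbar w c nu x \<omega> =
     (let y = (\<lambda>i t. C i *\<^sub>v x i t + D i *\<^sub>v w i t \<omega>)
      in (\<lambda>t. finsum_vec TYPE(real) l
                (\<lambda>i. L i *\<^sub>v kf_est (A i) (C i) (M i) (xbar i) (y i) t) {1..n}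
              + c \<cdot>\<^sub>v nu t \<omega>))"

end

theory Submission
  imports Defs
begin

text \<open>
  Changing the state of participant \<open>i\<close> changes the released signal by the response \<open>h\<close> of the stable
  system \<open>L\<^sub>i K\<^sub>i C\<^sub>i T\<^sub>i\<close> to an input of energy at most \<open>\<rho>\<^sub>i\<^sup>2\<close>, whatever the measurement noise is.
  Parseval's identity on the unit circle bounds the energy of \<open>h\<close> by \<open>(\<gamma>\<^sub>i \<rho>\<^sub>i)\<^sup>2 \<le> \<gamma>\<^sup>2\<close>. Conditionally on
  the measurement noise the mechanism therefore translates white Gaussian noise of standard deviation
  \<open>\<gamma> \<kappa>\<close> by a signal of norm at most \<open>\<gamma>\<close>. For finitely many coordinates the logarithm of the likelihood
  ratio of such a translation is Gaussian, and \<open>\<kappa>\<close> is chosen so that it exceeds \<open>\<epsilon>\<close> with probability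
  at most \<open>\<delta>\<close>; approximation by cylinder sets extends the estimate to all events on signals. The
  measure \<open>\<mu>\<close> is the positive part of \<open>P - exp \<epsilon> P'\<close>, from the Hahn decomposition.
\<close>

subsection \<open>Translations of Gaussian product measures\<close>

text \<open>The gain enters only as an essential supremum of \<open>sigma_max\<close>, which is the
  root of an eigenvalue of a Gram matrix. So \<open>sigma_max\<close> must be identified with the
  operator norm, and the essential supremum, taken in the extended reals, must be shown finite,
  which follows from continuity on the circle. It bounds the transfer function for almost every
  frequency only, so energies have to be compared by integration. Parseval's identity is used for
  finite sums alone; but the transform of an output cut off at time n is not the transfer function
  times the transform of the input, because the state at time n leaves a boundary term. Stability
  serves twice: the resolvent exists on the circle, and the boundary term vanishes as n grows. On
  the probability side only finite products are given an explicit density. For sequences it is the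
  inequality that passes to the limit, which works because the energy bound is uniform over all
  finite sets of coordinates.\<close>

lemma prob_space_std_normal: "prob_space std_normal_distribution"
  using prob_space_normal_density[of 1 0] by simp

lemma std_normal_density_shift:
  "std_normal_density (x - a) = std_normal_density x * exp (a * x - a\<^sup>2 / 2)"
  by (simp add: std_normal_density_def power2_eq_square field_simps flip: exp_add)

text \<open>One-dimensional Cameron-Martin formula: substitution moves the shift from the event to
  the density, and the quotient of the two normal densities is the exponential.\<close>

lemma emeasure_std_normal_shift:
  assumes "X \<in> sets borel"
  shows "emeasure std_normal_distribution ((\<lambda>x. x + a) -` X) =
    (\<integral>\<^sup>+ x. ennreal (exp (a * x - a\<^sup>2 / 2)) * indicator X x \<partial>std_normal_distribution)"
proof -
  have "emeasure std_normal_distribution ((\<lambda>x. x + a) -` X) =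
      (\<integral>\<^sup>+ x. ennreal (std_normal_density x) * indicator X (x + a) \<partial>lborel)"
    using assms measurable_sets[of "\<lambda>x. x + a" borel borel X]
    by (subst emeasure_density) (auto simp: indicator_def intro!: nn_integral_cong)
  also have "\<dots> = (\<integral>\<^sup>+ x. ennreal (std_normal_density (x - a)) * indicator X x \<partial>lborel)"
    using assms by (subst nn_integral_real_affine[of _ 1 a]) (auto simp: add.commute)
  also have "\<dots> = (\<integral>\<^sup>+ x. ennreal (exp (a * x - a\<^sup>2 / 2)) * indicator X x \<partial>std_normal_distribution)"
    using assms
    by (subst nn_integral_density)
       (auto simp: std_normal_density_shift ennreal_mult' mult.assoc intro!: nn_integral_cong)
  finally show ?thesis .
qed

text \<open>Both sides are the product of the one-dimensional shifted laws: the shift acts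
  coordinatewise, and the exponential of a sum is a product. A product law is determined by its
  values on boxes, so each side is tested there.\<close>

lemma distr_PiM_std_normal_shift:
  fixes u :: "'i \<Rightarrow> real"
  assumes J: "finite J"
  defines "G \<equiv> PiM J (\<lambda>_. std_normal_distribution)"
  shows "distr G (PiM J (\<lambda>_. borel)) (\<lambda>x. \<lambda>j\<in>J. x j + u j) =
    density G (\<lambda>x. ennreal (exp (\<Sum>j\<in>J. u j * x j - (u j)\<^sup>2 / 2)))"
proof -
  interpret N: prob_space "std_normal_distribution :: real measure" by (rule prob_space_std_normal)
  interpret P: product_sigma_finite "\<lambda>_::'i. std_normal_distribution :: real measure" ..
  \<comment> \<open>The factor is the law of a shifted normal variable, so its total mass is 1; in
    particular it is sigma-finite, as product measures require.\<close>
  have sf: "sigma_finite_measure (density std_normal_distribution (\<lambda>x. ennreal (exp (u i * x - (u i)\<^sup>2 / 2))))" for i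
  proof -
    let ?D = "density std_normal_distribution (\<lambda>x. ennreal (exp (u i * x - (u i)\<^sup>2 / 2)))"
    have "emeasure ?D (space ?D) = emeasure std_normal_distribution ((\<lambda>x. x + u i) -` UNIV)"
      by (subst emeasure_std_normal_shift) (simp_all add: emeasure_density)
    also have "\<dots> = 1" using N.emeasure_space_1 by simp
    finally have "prob_space ?D" by (rule prob_spaceI)
    then show ?thesis by (simp add: prob_space_imp_sigma_finite)
  qed
  interpret B: product_sigma_finite "\<lambda>i::'i. density std_normal_distribution
      (\<lambda>x. ennreal (exp (u i * x - (u i)\<^sup>2 / 2)))"
    by (rule product_sigma_finite.intro) (rule sf)
  have sG[measurable_cong]: "sets G = sets (PiM J (\<lambda>_. borel))"
    unfolding G_def by (rule sets_PiM_cong) auto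
  have spG: "space G = (\<Pi>\<^sub>E j\<in>J. UNIV)" by (simp add: G_def space_PiM)
  have 1: "distr G (PiM J (\<lambda>_. borel)) (\<lambda>x. \<lambda>j\<in>J. x j + u j) = PiM J (\<lambda>i. density std_normal_distribution
      (\<lambda>x. ennreal (exp (u i * x - (u i)\<^sup>2 / 2))))"
  proof (rule B.PiM_eqI[OF J])
    fix A :: "'i \<Rightarrow> real set"
    assume "\<And>i. i \<in> J \<Longrightarrow> A i \<in> sets (density std_normal_distribution (\<lambda>x. ennreal (exp (u i * x - (u i)\<^sup>2 / 2))))"
    then have A[measurable]: "i \<in> J \<Longrightarrow> A i \<in> sets borel" for i by simp
    have "emeasure (distr G (PiM J (\<lambda>_. borel)) (\<lambda>x. \<lambda>j\<in>J. x j + u j)) (Pi\<^sub>E J A) =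
        emeasure G ((\<lambda>x. \<lambda>j\<in>J. x j + u j) -` (Pi\<^sub>E J A) \<inter> space G)"
      using A J by (intro emeasure_distr) (auto intro!: sets_PiM_I_finite)
    also have "(\<lambda>x. \<lambda>j\<in>J. x j + u j) -` (Pi\<^sub>E J A) \<inter> space G = Pi\<^sub>E J (\<lambda>j. (\<lambda>x. x + u j) -` A j)"
      by (auto simp: spG PiE_iff)
    also have "emeasure G \<dots> = (\<Prod>j\<in>J. emeasure std_normal_distribution ((\<lambda>x. x + u j) -` A j))"
      unfolding G_def
    proof (rule P.emeasure_PiM[OF J])
      show "(\<lambda>x. x + u j) -` A j \<in> sets std_normal_distribution" if "j \<in> J" for j
        using measurable_sets[OF _ A[OF that], of "\<lambda>x. x + u j" borel] by simp
    qed
    also have "\<dots> = (\<Prod>i\<in>J. emeasure (density std_normal_distribution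
        (\<lambda>x. ennreal (exp (u i * x - (u i)\<^sup>2 / 2)))) (A i))"
      using A by (intro prod.cong) (simp_all add: emeasure_std_normal_shift emeasure_density)
    finally show "emeasure (distr G (PiM J (\<lambda>_. borel)) (\<lambda>x. \<lambda>j\<in>J. x j + u j)) (Pi\<^sub>E J A) = \<dots>" .
  qed (auto intro!: sets_PiM_cong)
  have 2: "density G (\<lambda>x. ennreal (exp (\<Sum>j\<in>J. u j * x j - (u j)\<^sup>2 / 2))) =
      PiM J (\<lambda>i. density std_normal_distribution (\<lambda>x. ennreal (exp (u i * x - (u i)\<^sup>2 / 2))))"
  proof (rule B.PiM_eqI[OF J])
    fix A :: "'i \<Rightarrow> real set"
    assume "\<And>i. i \<in> J \<Longrightarrow> A i \<in> sets (density std_normal_distribution (\<lambda>x. ennreal (exp (u i * x - (u i)\<^sup>2 / 2))))"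
    then have A[measurable]: "i \<in> J \<Longrightarrow> A i \<in> sets borel" for i by simp
    have "emeasure (density G (\<lambda>x. ennreal (exp (\<Sum>j\<in>J. u j * x j - (u j)\<^sup>2 / 2)))) (Pi\<^sub>E J A) =
      (\<integral>\<^sup>+ x. ennreal (exp (\<Sum>j\<in>J. u j * x j - (u j)\<^sup>2 / 2)) * indicator (Pi\<^sub>E J A) x \<partial>G)"
      using A J by (intro emeasure_density) (auto simp: sG intro!: sets_PiM_I_finite)
    also have "\<dots> = (\<integral>\<^sup>+ x. (\<Prod>j\<in>J. ennreal (exp (u j * x j - (u j)\<^sup>2 / 2)) * indicator (A j) (x j)) \<partial>G)"
    proof (intro nn_integral_cong)
      fix x assume "x \<in> space G"
      then have "indicator (Pi\<^sub>E J A) x = (\<Prod>j\<in>J. indicator (A j) (x j) :: ennreal)"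
        using J by (auto simp: spG indicator_def PiE_iff prod_zero_iff intro!: prod.neutral)
      then show "ennreal (exp (\<Sum>j\<in>J. u j * x j - (u j)\<^sup>2 / 2)) * indicator (Pi\<^sub>E J A) x =
          (\<Prod>j\<in>J. ennreal (exp (u j * x j - (u j)\<^sup>2 / 2)) * indicator (A j) (x j))"
        using J by (simp add: exp_sum prod.distrib prod_ennreal)
    qed
    also have "\<dots> = (\<Prod>j\<in>J. \<integral>\<^sup>+ x. ennreal (exp (u j * x - (u j)\<^sup>2 / 2)) * indicator (A j) x \<partial>std_normal_distribution)"
      unfolding G_def using A J by (intro P.product_nn_integral_prod) auto
    also have "\<dots> = (\<Prod>i\<in>J. emeasure (density std_normal_distribution
        (\<lambda>x. ennreal (exp (u i * x - (u i)\<^sup>2 / 2)))) (A i))"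
      using A by (intro prod.cong) (simp_all add: emeasure_density)
    finally show "emeasure (density G (\<lambda>x. ennreal (exp (\<Sum>j\<in>J. u j * x j - (u j)\<^sup>2 / 2)))) (Pi\<^sub>E J A) = \<dots>" .
  qed (auto simp: sG intro!: sets_PiM_cong)
  show ?thesis unfolding 1 2 ..
qed

section \<open>Gaussian tails and the noise scale\<close>

lemma qfun_eq_measure: "qfun x = measure std_normal_distribution {x..}"
proof -
  have "measure std_normal_distribution {x..} = (\<integral>u. indicator {x..} u \<partial>std_normal_distribution)"
    by simp
  also have "\<dots> = (LINT u:{x..}|lborel. std_normal_density u)"
    by (subst integral_density) (auto simp: set_lebesgue_integral_def mult.commute)
  also have "\<dots> = qfun x"
    by (simp add: qfun_def std_normal_density_def flip: set_integral_mult_right)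
  finally show ?thesis by simp
qed

lemma qfun_antimono: "x \<le> y \<Longrightarrow> qfun y \<le> qfun x"
proof -
  interpret N: prob_space "std_normal_distribution :: real measure" by (rule prob_space_std_normal)
  show "x \<le> y \<Longrightarrow> qfun y \<le> qfun x"
    unfolding qfun_eq_measure by (intro N.finite_measure_mono) auto
qed

text \<open>A normal law has no atoms, so its distribution function is continuous and takes every
  value strictly between its limits 0 and 1. Hence \<open>inv_into UNIV qfun \<delta>\<close> is a
  genuine preimage of \<delta>.\<close>

lemma qfun_surj:
  assumes "0 < \<delta>" "\<delta> < 1"
  shows "\<exists>x. qfun x = \<delta>"
proof -
  interpret N: prob_space "std_normal_distribution :: real measure" by (rule prob_space_std_normal)
  interpret N: real_distribution "std_normal_distribution :: real measure"
    by unfold_locales simp_all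
  have z: "measure std_normal_distribution {x} = 0" for x :: real
  proof -
    have "emeasure std_normal_distribution {x} = 0"
      by (subst emeasure_density) (auto simp: nn_integral_0_iff_AE intro!: AE_mp[OF AE_lborel_singleton[of x]] AE_I2)
    then show ?thesis by (simp add: measure_def)
  qed
  have q: "qfun x = 1 - cdf std_normal_distribution x" for x
  proof -
    have "qfun x = measure std_normal_distribution {x<..} + measure std_normal_distribution {x}"
      unfolding qfun_eq_measure by (subst N.finite_measure_Union[symmetric]) (auto intro!: arg_cong[where f="measure _"])
    moreover have "measure std_normal_distribution {x<..} = 1 - cdf std_normal_distribution x"
      unfolding cdf_def by (subst N.prob_compl[symmetric]) (auto intro!: arg_cong[where f="measure _"])
    ultimately show ?thesis using z by simp
  qed
  have c: "isCont (cdf std_normal_distribution) x" for x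
    using z N.isCont_cdf by simp
  have "eventually (\<lambda>x. cdf std_normal_distribution x < 1 - \<delta>) at_bot"
    using N.cdf_lim_at_bot assms by (auto simp: order_tendsto_iff)
  then obtain a where a: "cdf std_normal_distribution a < 1 - \<delta>" by (auto dest!: eventually_happens)
  have "eventually (\<lambda>x. cdf std_normal_distribution x > 1 - \<delta>) at_top"
    using N.cdf_lim_at_top_prob assms by (auto simp: order_tendsto_iff)
  then obtain b where b: "cdf std_normal_distribution b > 1 - \<delta>" by (auto dest!: eventually_happens)
  have "a \<le> b" using a b N.cdf_nondecreasing[of b a] by linarith
  then obtain x where "cdf std_normal_distribution x = 1 - \<delta>"
    using IVT[of "cdf std_normal_distribution" a "1 - \<delta>" b] a b c by auto
  then show ?thesis using q by (intro exI[of _ x]) simp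
qed

lemma kappa_pos:
  assumes "0 < \<epsilon>"
  shows "0 < kappa \<delta> \<epsilon>"
proof -
  let ?K = "inv_into UNIV qfun \<delta>"
  have "- ?K \<le> sqrt (?K\<^sup>2)" by simp
  also have "sqrt (?K\<^sup>2) < sqrt (?K\<^sup>2 + 2 * \<epsilon>)" using assms by (subst real_sqrt_less_iff) simp
  finally show ?thesis using assms by (simp add: kappa_def Let_def)
qed

text \<open>\<^term>\<open>kappa \<delta> \<epsilon>\<close> is the positive root of \<open>\<epsilon> k - 1 / (2 k) = qfun\<^sup>-\<^sup>1 \<delta>\<close>.\<close>
lemma qfun_kappa_le:
  assumes e: "0 < \<epsilon>" and d: "0 < \<delta>" "\<delta> < 1" and s: "0 < s" "s * kappa \<delta> \<epsilon> \<le> 1"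
  shows "qfun (\<epsilon> / s - s / 2) \<le> \<delta>"
proof -
  define K where "K = inv_into UNIV qfun \<delta>"
  define k where "k = kappa \<delta> \<epsilon>"
  have K: "qfun K = \<delta>" unfolding K_def using qfun_surj[OF d] by (intro f_inv_into_f) auto
  have k: "0 < k" unfolding k_def by (rule kappa_pos[OF e])
  have "2 * \<epsilon> * k - K = sqrt (K\<^sup>2 + 2 * \<epsilon>)"
    using e by (simp add: k_def kappa_def K_def Let_def)
  then have "(2 * \<epsilon> * k - K)\<^sup>2 = K\<^sup>2 + 2 * \<epsilon>" using e by (simp add: add_nonneg_nonneg)
  then have "\<epsilon> * (2 * \<epsilon> * k\<^sup>2 - 2 * K * k - 1) = 0"
    by (simp add: power2_eq_square algebra_simps)
  then have "2 * \<epsilon> * k\<^sup>2 - 2 * K * k - 1 = 0" using e by simp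
  then have "K = \<epsilon> * k - 1 / (2 * k)" using k by (simp add: power2_eq_square field_simps)
  \<comment> \<open>The expression \<open>\<epsilon> / s - s / 2\<close> decreases in
    \<open>s\<close>, and \<open>s\<close> is at most \<open>1 / k\<close>; at
    \<open>s = 1 / k\<close> it equals the left-hand side.\<close>
  also have "\<dots> \<le> \<epsilon> / s - s / 2"
  proof -
    have sk: "s * k \<le> 1" using s by (simp add: k_def)
    have "k \<le> 1 / s" using sk s(1) by (subst pos_le_divide_eq) (auto simp: mult.commute)
    moreover have "s \<le> 1 / k" using sk k by (intro mult_imp_le_div_pos)
    moreover have "\<epsilon> * k \<le> \<epsilon> * (1 / s)" using calculation e by (intro mult_left_mono) auto
    moreover have "1 / (2 * k) = (1 / k) / 2" by simp
    moreover have "\<epsilon> * (1 / s) = \<epsilon> / s" by simp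
    ultimately show ?thesis by linarith
  qed
  finally have "qfun (\<epsilon> / s - s / 2) \<le> qfun K" by (rule qfun_antimono)
  then show ?thesis using K by simp
qed

section \<open>Linear forms and shifts of Gaussian products\<close>

lemma indep_vars_PiM_std_normal:
  "prob_space.indep_vars (PiM I (\<lambda>_. std_normal_distribution)) (\<lambda>_. borel) (\<lambda>j x. x j) I"
proof -
  let ?G = "PiM I (\<lambda>_::'a. std_normal_distribution :: real measure)"
  interpret N: prob_space "std_normal_distribution :: real measure" by (rule prob_space_std_normal)
  interpret product_prob_space "\<lambda>_::'a. std_normal_distribution :: real measure" I ..
  show ?thesis
  proof (cases "I = {}")
    case False
    have "distr ?G ?G (\<lambda>x. restrict x I) = ?G"
      by (subst distr_cong[of ?G ?G ?G ?G _ "\<lambda>x. x"])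
         (auto simp: space_PiM PiE_iff extensional_restrict distr_id)
    moreover have "distr ?G std_normal_distribution (\<lambda>x. x j) = std_normal_distribution" if "j \<in> I" for j
      using that by (rule PiM_component)
    ultimately have "P.indep_vars (\<lambda>_. std_normal_distribution) (\<lambda>j x. x j) I"
      using False by (subst P.indep_vars_iff_distr_eq_PiM') (auto cong: PiM_cong)
    then show ?thesis by (simp add: P.indep_vars_def)
  next
    case True
    show ?thesis unfolding P.indep_vars_def P.indep_sets_def using True by auto
  qed
qed

text \<open>The linear form is centred normal with standard deviation \<open>s\<close>, so its tail
  at \<open>t\<close> is that of a standard normal variable at \<open>t / s\<close>.\<close>

lemma std_normal_linear_tail:
  fixes u :: "'i \<Rightarrow> real"
  assumes J: "finite J" and s: "s = sqrt (\<Sum>j\<in>J. (u j)\<^sup>2)" "0 < s"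
  shows "measure (PiM J (\<lambda>_. std_normal_distribution)) {x \<in> space (PiM J (\<lambda>_. std_normal_distribution)).
     t < (\<Sum>j\<in>J. u j * x j)} \<le> qfun (t / s)"
proof -
  let ?G = "PiM J (\<lambda>_::'i. std_normal_distribution :: real measure)"
  interpret N: prob_space "std_normal_distribution :: real measure" by (rule prob_space_std_normal)
  interpret product_prob_space "\<lambda>_::'i. std_normal_distribution :: real measure" J ..
  \<comment> \<open>Coordinates with \<open>u j = 0\<close> are dropped: their multiples are
    constant and have no normal density. What remains is nonempty because \<open>s\<close> is
    positive.\<close>
  define J' where "J' = {j \<in> J. u j \<noteq> 0}"
  have J': "finite J'" "J' \<noteq> {}" "J' \<subseteq> J"
  proof -
    show "J' \<noteq> {}"
    proof
      assume "J' = {}"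
      then have "(\<Sum>j\<in>J. (u j)\<^sup>2) = 0" unfolding J'_def by (intro sum.neutral) auto
      then show False using s by simp
    qed
  qed (auto simp: J'_def J)
  have "P.indep_vars (\<lambda>_. borel) (\<lambda>j x. x j) J" by (rule indep_vars_PiM_std_normal)
  then have "P.indep_vars (\<lambda>_. borel) (\<lambda>j x. x j) J'"
    by (rule P.indep_vars_subset) (rule J')
  then have ind: "P.indep_vars (\<lambda>_. borel) (\<lambda>j x. u j * x j) J'"
    by (rule P.indep_vars_compose2) simp
  have d: "distributed ?G lborel (\<lambda>x. u j * x j) (normal_density 0 \<bar>u j\<bar>)" if j: "j \<in> J'" for j
  proof -
    have "distr ?G lborel (\<lambda>x. x j) = distr ?G std_normal_distribution (\<lambda>x. x j)"
      by (rule distr_cong) auto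
    also have "\<dots> = std_normal_distribution"
      using j J' by (intro PiM_component) auto
    finally have "distributed ?G lborel (\<lambda>x. x j) std_normal_density"
      using j J' by (auto simp: distributed_def)
    from P.normal_density_affine[OF this, of "u j" 0] j show ?thesis by (simp add: J'_def)
  qed
  have "distributed ?G lborel (\<lambda>x. \<Sum>j\<in>J'. u j * x j)
     (normal_density (\<Sum>j\<in>J'. 0) (sqrt (\<Sum>j\<in>J'. \<bar>u j\<bar>\<^sup>2)))"
    using J' d by (intro P.sum_indep_normal ind) (auto simp: J'_def)
  moreover have "(\<Sum>j\<in>J'. \<bar>u j\<bar>\<^sup>2) = (\<Sum>j\<in>J. (u j)\<^sup>2)"
    unfolding J'_def using J by (intro sum.mono_neutral_cong_left) auto
  moreover have "(\<Sum>j\<in>J'. u j * x j) = (\<Sum>j\<in>J. u j * x j)" for x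
    unfolding J'_def using J by (intro sum.mono_neutral_cong_left) auto
  ultimately have "distributed ?G lborel (\<lambda>x. \<Sum>j\<in>J. u j * x j) (normal_density 0 s)"
    using s by simp
  from P.normal_density_affine[OF this, of "1 / s" 0] s
  have D: "distributed ?G lborel (\<lambda>x. (\<Sum>j\<in>J. u j * x j) / s) std_normal_density"
    by (simp add: mult.commute)
  have "measure ?G {x \<in> space ?G. t < (\<Sum>j\<in>J. u j * x j)} \<le>
      measure ?G ((\<lambda>x. (\<Sum>j\<in>J. u j * x j) / s) -` {t / s..} \<inter> space ?G)"
    using s by (intro P.finite_measure_mono)
      (auto simp: divide_right_mono)
  also have "\<dots> = measure (distr ?G lborel (\<lambda>x. (\<Sum>j\<in>J. u j * x j) / s)) {t / s..}"
    using distributed_measurable[OF D] by (subst measure_distr) auto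
  also have "\<dots> = qfun (t / s)"
    using D by (simp add: distributed_def qfun_eq_measure)
  finally show ?thesis .
qed

text \<open>Split \<open>X\<close> along the event \<open>B\<close> on which the likelihood ratio
  exceeds \<open>exp \<epsilon>\<close>: off \<open>B\<close> the ratio bounds the shifted law
  directly, and \<open>B\<close> itself has mass at most \<delta> under the shifted law by the
  choice of \<open>kappa\<close>.\<close>

lemma std_normal_finite_shift_privacy:
  fixes u :: "'i \<Rightarrow> real"
  assumes e: "0 < \<epsilon>" and d: "0 < \<delta>" "\<delta> < 1" and J: "finite J"
    and u: "sqrt (\<Sum>j\<in>J. (u j)\<^sup>2) * kappa \<delta> \<epsilon> \<le> 1"
    and X: "X \<in> sets (PiM J (\<lambda>_. borel))"
  defines "G \<equiv> PiM J (\<lambda>_. std_normal_distribution)"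
  shows "measure G {x \<in> space G. (\<lambda>j\<in>J. x j + u j) \<in> X} \<le> exp \<epsilon> * measure G X + \<delta>"
proof -
  interpret N: prob_space "std_normal_distribution :: real measure" by (rule prob_space_std_normal)
  interpret product_prob_space "\<lambda>_::'i. std_normal_distribution :: real measure" J ..
  interpret G: prob_space G unfolding G_def by unfold_locales
  define s where "s = sqrt (\<Sum>j\<in>J. (u j)\<^sup>2)"
  have ssq: "s\<^sup>2 = (\<Sum>j\<in>J. (u j)\<^sup>2)" by (simp add: s_def sum_nonneg)
  have sG[measurable_cong]: "sets G = sets (PiM J (\<lambda>_. borel))"
    unfolding G_def by (rule sets_PiM_cong) auto
  have spG: "space G = (\<Pi>\<^sub>E j\<in>J. UNIV)" by (simp add: G_def space_PiM)
  note X[measurable]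
  define Q where "Q = distr G (PiM J (\<lambda>_. borel)) (\<lambda>x. \<lambda>j\<in>J. x j + u j)"
  define r where "r x = exp (\<Sum>j\<in>J. u j * x j - (u j)\<^sup>2 / 2)" for x
  interpret Q: prob_space Q unfolding Q_def by (rule G.prob_space_distr) simp
  have sQ: "sets Q = sets (PiM J (\<lambda>_. borel))" by (simp add: Q_def)
  have QE: "measure Q E = measure G {x \<in> space G. (\<lambda>j\<in>J. x j + u j) \<in> E}" if "E \<in> sets (PiM J (\<lambda>_. borel))" for E
    using that unfolding Q_def by (subst measure_distr) (auto intro!: arg_cong[where f="measure G"])
  have Qd: "Q = density G (\<lambda>x. ennreal (r x))"
    unfolding Q_def r_def G_def by (rule distr_PiM_std_normal_shift[OF J])
  have rm[measurable]: "r \<in> borel_measurable (PiM J (\<lambda>_. borel))" unfolding r_def by measurable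
  define B where "B = {x \<in> space (PiM J (\<lambda>_. borel)). exp \<epsilon> < r x}"
  have B[measurable]: "B \<in> sets (PiM J (\<lambda>_. borel))" unfolding B_def by measurable
  have "measure Q (X - B) \<le> exp \<epsilon> * measure G X"
  proof -
    have "emeasure Q (X - B) = (\<integral>\<^sup>+ x. ennreal (r x) * indicator (X - B) x \<partial>G)"
      unfolding Qd by (intro emeasure_density) (auto simp: sG)
    also have "\<dots> \<le> (\<integral>\<^sup>+ x. ennreal (exp \<epsilon>) * indicator X x \<partial>G)"
      by (intro nn_integral_mono)
         (auto simp: indicator_def B_def space_PiM spG not_less intro!: ennreal_leI)
    also have "\<dots> = ennreal (exp \<epsilon>) * emeasure G X"
      by (subst nn_integral_cmult_indicator) (auto simp: sG)
    finally show ?thesis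
      by (simp add: Q.emeasure_eq_measure G.emeasure_eq_measure flip: ennreal_mult')
  qed
  moreover have "measure Q B \<le> \<delta>"
  proof (cases "s = 0")
    case True
    then have "u j = 0" if "j \<in> J" for j
      using that J ssq by (simp add: sum_nonneg_eq_0_iff)
    then have "r x = 1" for x unfolding r_def by simp
    then have "B = {}" using e by (auto simp: B_def)
    then show ?thesis using d by simp
  next
    case False
    then have s: "0 < s" unfolding s_def by (simp add: sum_nonneg order_less_le)
    have "measure Q B = measure G {x \<in> space G. (\<lambda>j\<in>J. x j + u j) \<in> B}" using B by (rule QE)
    also have "{x \<in> space G. (\<lambda>j\<in>J. x j + u j) \<in> B} = {x \<in> space G. \<epsilon> - s\<^sup>2 / 2 < (\<Sum>j\<in>J. u j * x j)}"
    proof -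
      \<comment> \<open>At the shifted point the constant in the log ratio changes from minus to
        plus half of \<open>s\<^sup>2\<close>; this is the origin of the term \<open>s / 2\<close>
        in the tail argument.\<close>
      have "(\<Sum>j\<in>J. u j * (x j + u j) - (u j)\<^sup>2 / 2) = (\<Sum>j\<in>J. u j * x j) + s\<^sup>2 / 2" for x
        unfolding ssq sum_divide_distrib sum.distrib[symmetric]
        by (intro sum.cong) (simp_all add: power2_eq_square field_simps)
      then show ?thesis by (auto simp: B_def r_def space_PiM)
    qed
    also have "measure G \<dots> \<le> qfun ((\<epsilon> - s\<^sup>2 / 2) / s)"
      unfolding G_def by (rule std_normal_linear_tail[OF J s_def s])
    also have "(\<epsilon> - s\<^sup>2 / 2) / s = \<epsilon> / s - s / 2" using s by (simp add: power2_eq_square field_simps)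
    also have "qfun \<dots> \<le> \<delta>" using qfun_kappa_le[OF e d s] u by (simp add: s_def)
    finally show ?thesis .
  qed
  moreover have "measure Q X \<le> measure Q (X - B) + measure Q B"
    by (rule order_trans[OF Q.finite_measure_mono measure_Un_le]) (auto simp: sQ)
  ultimately show ?thesis using QE[OF X] by linarith
qed

text \<open>The sets that elements of the algebra approximate simultaneously in all the measures
  form a sigma-algebra. One approximant for several measures is essential, since the inequality to
  be transferred compares two laws on the same event.\<close>

lemma finite_measures_approx_by_algebra:
  assumes K: "finite K" and N: "\<And>k. k \<in> K \<Longrightarrow> finite_measure (N k)" "\<And>k. k \<in> K \<Longrightarrow> sets (N k) = sets M"
    and alg: "Sigma_Algebra.algebra (space M) \<A>" and gen: "sets M = sigma_sets (space M) \<A>"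
    and S: "S \<in> sets M" and e: "0 < (e :: real)"
  shows "\<exists>T\<in>\<A>. \<forall>k\<in>K. measure (N k) (sym_diff S T) < e"
proof -
  interpret Sigma_Algebra.algebra "space M" \<A> by (rule alg)
  have AM: "T \<in> sets M" if "T \<in> \<A>" for T using that unfolding gen by auto
  from S have "S \<in> sigma_sets (space M) \<A>" by (simp add: gen)
  then show ?thesis using e
  proof (induction arbitrary: e)
    case (Basic a)
    then show ?case by (intro bexI[of _ a]) auto
  next
    case Empty
    then show ?case by (intro bexI[of _ "{}"]) auto
  next
    case (Compl a)
    then obtain T where T: "T \<in> \<A>" "\<forall>k\<in>K. measure (N k) (sym_diff a T) < e" by blast
    have "sym_diff (space M - a) (space M - T) = sym_diff a T"
      using Compl(1) AM[OF T(1)] sets.sets_into_space[of _ M] unfolding gen[symmetric] by blast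
    then show ?case using T by (intro bexI[of _ "space M - T"]) auto
  next
    case (Union a)
    have aM: "a i \<in> sets M" for i using Union(1) by (simp add: gen)
    \<comment> \<open>Continuity from below makes a finite partial union good enough up to
      \<open>e / 2\<close>; the other half is spread over the sets of that union.\<close>
    have "eventually (\<lambda>n. measure (N k) (\<Union>i. a i) - e / 2 < measure (N k) (\<Union>i<n. a i)) sequentially"
      if k: "k \<in> K" for k
    proof -
      interpret finite_measure "N k" using N k by simp
      have "(\<lambda>n. measure (N k) (\<Union>i<n. a i)) \<longlonglongrightarrow> measure (N k) (\<Union>n. \<Union>i<n. a i)"
        using aM N k by (intro finite_Lim_measure_incseq) (auto simp: incseq_def intro: less_le_trans)
      also have "(\<Union>n. \<Union>i<n. a i) = (\<Union>i. a i)" by auto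
      finally show ?thesis using Union(3) by (auto simp: order_tendsto_iff)
    qed
    then have "eventually (\<lambda>n. \<forall>k\<in>K. measure (N k) (\<Union>i. a i) - e / 2 < measure (N k) (\<Union>i<n. a i)) sequentially"
      using K by (intro eventually_ball_finite) auto
    then obtain n where n: "\<forall>k\<in>K. measure (N k) (\<Union>i. a i) - e / 2 < measure (N k) (\<Union>i<n. a i)"
      by (auto dest!: eventually_happens)
    \<comment> \<open>\<open>n + 1\<close> in place of \<open>n\<close> keeps the tolerance positive
      when the partial union is empty.\<close>
    have "\<exists>T\<in>\<A>. \<forall>k\<in>K. measure (N k) (sym_diff (a i) T) < e / (2 * (real n + 1))" for i
      using Union(2,3) by simp
    then obtain T where T: "T i \<in> \<A>" "\<forall>k\<in>K. measure (N k) (sym_diff (a i) (T i)) < e / (2 * (real n + 1))" for i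
      by metis
    let ?U = "\<Union>i<n. T i"
    have "measure (N k) (sym_diff (\<Union>i. a i) ?U) < e" if k: "k \<in> K" for k
    proof -
      interpret finite_measure "N k" using N k by simp
      have [measurable]: "a i \<in> sets (N k)" "T i \<in> sets (N k)" for i
        using T AM aM N k by auto
      have "measure (N k) (sym_diff (\<Union>i. a i) ?U) \<le>
          measure (N k) (((\<Union>i. a i) - (\<Union>i<n. a i)) \<union> (\<Union>i<n. sym_diff (a i) (T i)))"
        by (rule finite_measure_mono) auto
      also have "\<dots> \<le> measure (N k) ((\<Union>i. a i) - (\<Union>i<n. a i)) + measure (N k) (\<Union>i<n. sym_diff (a i) (T i))"
        by (rule measure_Un_le) auto
      also have "measure (N k) ((\<Union>i. a i) - (\<Union>i<n. a i)) = measure (N k) (\<Union>i. a i) - measure (N k) (\<Union>i<n. a i)"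
        by (rule finite_measure_Diff) auto
      also have "measure (N k) (\<Union>i<n. sym_diff (a i) (T i)) \<le> (\<Sum>i<n. measure (N k) (sym_diff (a i) (T i)))"
        by (rule measure_UNION_le) auto
      also have "\<dots> \<le> (\<Sum>i<n. e / (2 * (real n + 1)))"
        using T k by (intro sum_mono) (auto intro: less_imp_le)
      also have "\<dots> \<le> e / 2" using Union(3) by (simp add: field_simps)
      finally show ?thesis using n k by fastforce
    qed
    moreover have "?U \<in> \<A>" using T by auto
    ultimately show ?case by blast
  qed
qed

text \<open>Both sides are continuous in the event, so it suffices to treat cylinder sets.\<close>
lemma std_normal_shift_privacy:
  fixes u :: "'i \<Rightarrow> real"
  assumes e: "0 < \<epsilon>" and d: "0 < \<delta>" "\<delta> < 1"
    and u: "\<And>J. finite J \<Longrightarrow> J \<subseteq> I \<Longrightarrow> sqrt (\<Sum>j\<in>J. (u j)\<^sup>2) * kappa \<delta> \<epsilon> \<le> 1"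
    and X: "X \<in> sets (PiM I (\<lambda>_. borel))"
  defines "G \<equiv> PiM I (\<lambda>_. std_normal_distribution)"
  shows "measure G {x \<in> space G. (\<lambda>j\<in>I. x j + u j) \<in> X} \<le> exp \<epsilon> * measure G X + \<delta>"
proof (rule field_le_epsilon)
  fix \<eta> :: real assume \<eta>: "0 < \<eta>"
  interpret N: prob_space "std_normal_distribution :: real measure" by (rule prob_space_std_normal)
  interpret PP: product_prob_space "\<lambda>_::'i. std_normal_distribution :: real measure" I ..
  interpret G: prob_space G unfolding G_def by unfold_locales
  let ?M = "\<lambda>_::'i. std_normal_distribution :: real measure"
  have sG[measurable_cong]: "sets G = sets (PiM I (\<lambda>_. borel))"
    unfolding G_def by (rule sets_PiM_cong) auto
  have spG: "space G = (\<Pi>\<^sub>E j\<in>I. UNIV)" by (simp add: G_def space_PiM)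
  define sh where "sh x = (\<lambda>j\<in>I. x j + u j)" for x
  have shm[measurable]: "sh \<in> G \<rightarrow>\<^sub>M G" unfolding sh_def by measurable
  define Q where "Q = distr G G sh"
  interpret Q: prob_space Q unfolding Q_def by (rule G.prob_space_distr) simp
  have QE: "measure Q E = measure G {x \<in> space G. sh x \<in> E}" if "E \<in> sets G" for E
    using that unfolding Q_def by (subst measure_distr) (auto intro!: arg_cong[where f="measure G"])
  \<comment> \<open>The approximation costs \<open>c\<close> on the left and
    \<open>exp \<epsilon> * c\<close> on the right; the two add up to \<eta>.\<close>
  define c where "c = \<eta> / (exp \<epsilon> + 1)"
  have c: "0 < c" unfolding c_def using \<eta> by (intro divide_pos_pos add_pos_pos) auto
  have XG: "X \<in> sets G" using X by (simp add: sG)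
  have "\<exists>T\<in>PP.generator. \<forall>k\<in>UNIV. measure (if k then G else Q) (sym_diff X T) < c"
  proof (rule finite_measures_approx_by_algebra[where M=G])
    show "Sigma_Algebra.algebra (space G) PP.generator" "sets G = sigma_sets (space G) PP.generator"
      unfolding G_def by (rule PP.algebra_generator PP.sets_PiM_generator)+
  qed (use G.finite_measure_axioms Q.finite_measure_axioms in \<open>auto simp: c XG Q_def\<close>)
  then obtain T where T: "T \<in> PP.generator" "measure G (sym_diff X T) < c" "measure Q (sym_diff X T) < c"
    by (auto simp: all_bool_eq)
  have TG: "T \<in> sets G" using T(1) unfolding G_def PP.sets_PiM_generator by auto
  have TX: "measure Q T \<le> exp \<epsilon> * measure G T + \<delta>"
    using T(1)
  proof cases
    case (1 J Y)
    interpret PJ: product_prob_space "\<lambda>_::'i. std_normal_distribution :: real measure" J ..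
    have YJ: "Y \<in> sets (PiM J (\<lambda>_. borel))"
      using 1 by (simp cong: sets_PiM_cong)
    have emb: "measure G (prod_emb I ?M J Z) = measure (PiM J ?M) Z" if "Z \<in> sets (PiM J ?M)" for Z
      using PP.emeasure_PiM_emb'[of J Z] 1 that by (simp add: measure_def G_def)
    have Z: "{x \<in> space (PiM J ?M). (\<lambda>j\<in>J. x j + u j) \<in> Y} \<in> sets (PiM J ?M)"
    proof -
      have "(\<lambda>x. \<lambda>j\<in>J. x j + u j) \<in> PiM J ?M \<rightarrow>\<^sub>M PiM J (\<lambda>_. borel)" by measurable
      from measurable_sets[OF this YJ] show ?thesis by (simp add: vimage_def Int_def conj_commute)
    qed
    have "measure Q T = measure G {x \<in> space G. sh x \<in> T}" by (rule QE[OF TG])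
    \<comment> \<open>Shifting commutes with restriction to \<open>J\<close>, so a cylinder pulls
      back to a cylinder over the same coordinates and the finite case applies.\<close>
    also have "{x \<in> space G. sh x \<in> T} = prod_emb I ?M J {x \<in> space (PiM J ?M). (\<lambda>j\<in>J. x j + u j) \<in> Y}"
    proof -
      have "restrict (sh x) J = (\<lambda>j\<in>J. restrict x J j + u j)" for x
        using 1 by (auto simp: sh_def restrict_def fun_eq_iff)
      then show ?thesis
        unfolding 1(1) by (auto simp: prod_emb_def spG space_PiM sh_def)
    qed
    also have "measure G \<dots> = measure (PiM J ?M) {x \<in> space (PiM J ?M). (\<lambda>j\<in>J. x j + u j) \<in> Y}"
      by (rule emb[OF Z])
    also have "\<dots> \<le> exp \<epsilon> * measure (PiM J ?M) Y + \<delta>"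
      using 1 u by (intro std_normal_finite_shift_privacy e d YJ) auto
    also have "measure (PiM J ?M) Y = measure G T" unfolding 1(1) using 1 by (intro emb[symmetric])
    finally show ?thesis .
  qed
  have "measure Q X \<le> measure Q (T \<union> sym_diff X T)"
    using TG XG by (intro Q.finite_measure_mono) (auto simp: Q_def)
  also have "\<dots> \<le> measure Q T + measure Q (sym_diff X T)"
    using TG XG by (intro measure_Un_le) (auto simp: Q_def)
  finally have 1: "measure Q X \<le> measure Q T + c" using T by simp
  have "measure G T \<le> measure G (X \<union> sym_diff X T)"
    using TG XG by (intro G.finite_measure_mono) auto
  also have "\<dots> \<le> measure G X + measure G (sym_diff X T)"
    using TG XG by (intro measure_Un_le) auto
  finally have "measure G T \<le> measure G X + c" using T by simp
  then have "exp \<epsilon> * measure G T \<le> exp \<epsilon> * (measure G X + c)" by simp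
  moreover have "exp \<epsilon> * c + c = \<eta>"
  proof -
    have "exp \<epsilon> + 1 \<noteq> 0" using exp_gt_zero[of \<epsilon>] by linarith
    then have "(exp \<epsilon> + 1) * c = \<eta>" by (simp add: c_def)
    then show ?thesis by (simp add: algebra_simps)
  qed
  ultimately have "measure Q X \<le> exp \<epsilon> * measure G X + \<delta> + \<eta>"
    using 1 TX by (simp add: algebra_simps)
  then show "measure G {x \<in> space G. (\<lambda>j\<in>I. x j + u j) \<in> X} \<le> exp \<epsilon> * measure G X + \<delta> + \<eta>"
    using QE[OF XG] by (simp add: sh_def)
qed

subsection \<open>Translations of white noise\<close>

lemma space_vec_borel [simp]: "space (vec_borel d) = carrier_vec d"
  by (simp add: vec_borel_def)

lemma measurable_vec_borel_nth [measurable]: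
  assumes "k < d"
  shows "(\<lambda>v. v $ k) \<in> borel_measurable (vec_borel d)"
proof -
  have "(\<lambda>v. \<lambda>k\<in>{..<d}. v $ k) \<in> vec_borel d \<rightarrow>\<^sub>M (\<Pi>\<^sub>M k\<in>{..<d}. borel :: real measure)"
    unfolding vec_borel_def by (rule measurable_vimage_algebra1) (auto simp: space_PiM)
  from measurable_compose[OF this measurable_component_singleton[of k]] assms
  show ?thesis by simp
qed

text \<open>The coordinates are given by a separate formula \<open>g\<close> that has to agree with
  them on the space of \<open>N\<close> only: expanding a matrix product or a finite sum into
  scalars is justified only for vectors of the right dimension.\<close>

lemma measurable_vec_borelI:
  assumes "\<And>\<omega>. \<omega> \<in> space N \<Longrightarrow> f \<omega> \<in> carrier_vec d"
    and g: "\<And>k. k < d \<Longrightarrow> g k \<in> borel_measurable N"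
    and eq: "\<And>k \<omega>. k < d \<Longrightarrow> \<omega> \<in> space N \<Longrightarrow> f \<omega> $ k = g k \<omega>"
  shows "f \<in> N \<rightarrow>\<^sub>M vec_borel d"
proof -
  have "(\<lambda>\<omega>. f \<omega> $ k) \<in> borel_measurable N" if "k < d" for k
    using g[OF that] eq[OF that] by (simp cong: measurable_cong)
  then show ?thesis
    unfolding vec_borel_def
    using assms(1) by (intro measurable_vimage_algebra2) (auto intro!: measurable_restrict)
qed

lemma measurable_vec_borelD:
  assumes "f \<in> N \<rightarrow>\<^sub>M vec_borel d"
  shows "\<omega> \<in> space N \<Longrightarrow> f \<omega> \<in> carrier_vec d"
    and "k < d \<Longrightarrow> (\<lambda>\<omega>. f \<omega> $ k) \<in> borel_measurable N"
  using measurable_space[OF assms] measurable_compose[OF assms measurable_vec_borel_nth] by auto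

lemma measurable_vec:
  assumes "\<And>k. k < d \<Longrightarrow> (\<lambda>x. f x k) \<in> borel_measurable N"
  shows "(\<lambda>x. vec d (f x)) \<in> N \<rightarrow>\<^sub>M vec_borel d"
  by (rule measurable_vec_borelI[OF _ assms]) auto

lemma measurable_vec_add:
  assumes f: "f \<in> N \<rightarrow>\<^sub>M vec_borel d" and g: "g \<in> N \<rightarrow>\<^sub>M vec_borel d"
  shows "(\<lambda>\<omega>. f \<omega> + g \<omega>) \<in> N \<rightarrow>\<^sub>M vec_borel d"
proof (rule measurable_vec_borelI)
  show "(\<lambda>\<omega>. f \<omega> $ k + g \<omega> $ k) \<in> borel_measurable N" if "k < d" for k
    by (intro borel_measurable_add measurable_vec_borelD(2)[OF f that] measurable_vec_borelD(2)[OF g that])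
qed (use measurable_vec_borelD(1)[OF f] measurable_vec_borelD(1)[OF g] in \<open>force dest: carrier_vecD\<close>)+

lemma measurable_vec_diff:
  assumes f: "f \<in> N \<rightarrow>\<^sub>M vec_borel d" and g: "g \<in> N \<rightarrow>\<^sub>M vec_borel d"
  shows "(\<lambda>\<omega>. f \<omega> - g \<omega>) \<in> N \<rightarrow>\<^sub>M vec_borel d"
proof (rule measurable_vec_borelI)
  show "(\<lambda>\<omega>. f \<omega> $ k - g \<omega> $ k) \<in> borel_measurable N" if "k < d" for k
    by (intro borel_measurable_diff measurable_vec_borelD(2)[OF f that] measurable_vec_borelD(2)[OF g that])
qed (use measurable_vec_borelD(1)[OF f] measurable_vec_borelD(1)[OF g] in \<open>force dest: carrier_vecD\<close>)+

lemma measurable_mult_mat_vec: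
  assumes X: "X \<in> carrier_mat r d" and f: "f \<in> N \<rightarrow>\<^sub>M vec_borel d"
  shows "(\<lambda>\<omega>. X *\<^sub>v f \<omega>) \<in> N \<rightarrow>\<^sub>M vec_borel r"
proof (rule measurable_vec_borelI)
  show "(\<lambda>\<omega>. \<Sum>j<d. X $$ (k, j) * f \<omega> $ j) \<in> borel_measurable N" for k
    by (intro borel_measurable_sum borel_measurable_times measurable_vec_borelD(2)[OF f]) auto
  show "(X *\<^sub>v f \<omega>) $ k = (\<Sum>j<d. X $$ (k, j) * f \<omega> $ j)" if "\<omega> \<in> space N" "k < r" for k \<omega>
    using that(2) X carrier_vecD[OF measurable_vec_borelD(1)[OF f that(1)]]
    by (auto simp: scalar_prod_def atLeast0LessThan intro!: sum.cong)
qed (use X in \<open>auto intro!: carrier_vecI\<close>)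

lemma measurable_vec_smult:
  assumes f: "f \<in> N \<rightarrow>\<^sub>M vec_borel d"
  shows "(\<lambda>\<omega>. c \<cdot>\<^sub>v f \<omega>) \<in> N \<rightarrow>\<^sub>M vec_borel d"
proof (rule measurable_vec_borelI)
  show "(\<lambda>\<omega>. c * f \<omega> $ k) \<in> borel_measurable N" if "k < d" for k
    by (intro borel_measurable_times measurable_vec_borelD(2)[OF f that]) auto
qed (use measurable_vec_borelD(1)[OF f] in \<open>force dest: carrier_vecD\<close>)+

lemma measurable_finsum_vec:
  assumes I: "finite I" and f: "\<And>i. i \<in> I \<Longrightarrow> f i \<in> N \<rightarrow>\<^sub>M vec_borel d"
  shows "(\<lambda>\<omega>. finsum_vec TYPE(real) d (\<lambda>i. f i \<omega>) I) \<in> N \<rightarrow>\<^sub>M vec_borel d"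
proof (rule measurable_vec_borelI)
  show "(\<lambda>\<omega>. \<Sum>i\<in>I. f i \<omega> $ k) \<in> borel_measurable N" if "k < d" for k
    using that by (intro borel_measurable_sum measurable_vec_borelD(2)[OF f])
  show "finsum_vec TYPE(real) d (\<lambda>i. f i \<omega>) I $ k = (\<Sum>i\<in>I. f i \<omega> $ k)"
    if "\<omega> \<in> space N" "k < d" for k \<omega>
    using that I measurable_vec_borelD(1)[OF f] by (intro index_finsum_vec) auto
qed (use measurable_vec_borelD(1)[OF f] in \<open>auto intro!: finsum_vec_closed\<close>)

lemma space_signal_space: "space (signal_space d) = {v. \<forall>t. v t \<in> carrier_vec d}"
  by (auto simp: signal_space_def space_PiM PiE_def)

lemma measurable_signal_spaceI:
  assumes "\<And>t. (\<lambda>\<omega>. f \<omega> t) \<in> N \<rightarrow>\<^sub>M vec_borel d"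
  shows "f \<in> N \<rightarrow>\<^sub>M signal_space d"
  unfolding signal_space_def
  by (rule measurable_PiM_single') (use assms measurable_space[OF assms] in \<open>auto simp: PiE_def\<close>)

lemma measurable_signal_nth: "(\<lambda>x. x t) \<in> signal_space d \<rightarrow>\<^sub>M vec_borel d"
  unfolding signal_space_def by (rule measurable_component_singleton) simp

text \<open>Both laws are the product over time of \<open>std_gaussian d\<close>. This identifies
  the noise with independent scalar normals indexed by pairs of a time and a coordinate, to which
  the scalar translation estimate applies.\<close>

lemma distr_white_noise:
  assumes \<Omega>: "prob_space \<Omega>" and w: "white_noise \<Omega> d v"
  shows "distr \<Omega> (signal_space d) (\<lambda>\<omega> t. v t \<omega>) =
    distr (PiM (UNIV \<times> {..<d}) (\<lambda>_. std_normal_distribution)) (signal_space d) (\<lambda>x t. vec d (\<lambda>k. x (t, k)))"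
    (is "_ = distr ?G _ _")
proof -
  interpret \<Omega>: prob_space \<Omega> by (rule \<Omega>)
  interpret N: prob_space "std_normal_distribution :: real measure" by (rule prob_space_std_normal)
  interpret product_prob_space "\<lambda>_::nat\<times>nat. std_normal_distribution :: real measure" "UNIV \<times> {..<d}" ..
  have rv: "v t \<in> \<Omega> \<rightarrow>\<^sub>M vec_borel d" for t
    using w unfolding white_noise_def by (auto simp: \<Omega>.indep_vars_def)
  have "distr \<Omega> (signal_space d) (\<lambda>\<omega>. \<lambda>t\<in>UNIV. v t \<omega>) = (\<Pi>\<^sub>M t\<in>UNIV. distr \<Omega> (vec_borel d) (v t))"
    using w rv unfolding white_noise_def signal_space_def
    by (subst \<Omega>.indep_vars_iff_distr_eq_PiM[symmetric]) auto
  then have 1: "distr \<Omega> (signal_space d) (\<lambda>\<omega> t. v t \<omega>) = (\<Pi>\<^sub>M t\<in>UNIV. std_gaussian d)"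
    using w by (simp add: white_noise_def restrict_UNIV)
  let ?V = "\<lambda>t x. vec d (\<lambda>k. x (t, k))"
  \<comment> \<open>Disjoint blocks of an independent family are independent; block \<open>t\<close>
    collects the coordinates at time \<open>t\<close>.\<close>
  have "P.indep_vars (\<lambda>t. PiM ({t} \<times> {..<d}) (\<lambda>_. borel)) (\<lambda>t x. restrict (\<lambda>i. x i) ({t} \<times> {..<d})) (UNIV :: nat set)"
    by (rule P.indep_vars_restrict[OF indep_vars_PiM_std_normal]) (auto simp: disjoint_family_on_def)
  then have "P.indep_vars (\<lambda>_. vec_borel d) (\<lambda>t x. ?V t (restrict (\<lambda>i. x i) ({t} \<times> {..<d}))) (UNIV :: nat set)"
  proof (rule P.indep_vars_compose2)
    fix t
    show "(\<lambda>x. vec d (\<lambda>k. x (t, k))) \<in> PiM ({t} \<times> {..<d}) (\<lambda>_. borel) \<rightarrow>\<^sub>M vec_borel d"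
      by (rule measurable_vec) auto
  qed
  also have "(\<lambda>t x. ?V t (restrict (\<lambda>i. x i) ({t} \<times> {..<d}))) = ?V"
    by (intro ext eq_vecI) auto
  finally have ind: "P.indep_vars (\<lambda>_. vec_borel d) ?V (UNIV :: nat set)" .
  have Vm: "?V t \<in> ?G \<rightarrow>\<^sub>M vec_borel d" for t
    by (rule measurable_vec) auto
  have "distr ?G (signal_space d) (\<lambda>x. \<lambda>t\<in>UNIV. ?V t x) = (\<Pi>\<^sub>M t\<in>UNIV. distr ?G (vec_borel d) (?V t))"
    using ind Vm unfolding signal_space_def
    by (subst P.indep_vars_iff_distr_eq_PiM[symmetric]) auto
  moreover have "distr ?G (vec_borel d) (?V t) = std_gaussian d" for t
  proof -
    let ?N = "PiM {..<d} (\<lambda>_. std_normal_distribution)"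
    have "distr ?G ?N (\<lambda>x. \<lambda>k\<in>{..<d}. x (t, k)) = ?N"
      by (rule distr_PiM_reindex[of "UNIV \<times> {..<d}" "\<lambda>_. std_normal_distribution" "\<lambda>k. (t, k)" "{..<d}"])
         (auto simp: inj_on_def N.prob_space_axioms)
    then have "std_gaussian d = distr (distr ?G ?N (\<lambda>x. \<lambda>k\<in>{..<d}. x (t, k))) (vec_borel d) (vec d)"
      by (simp add: std_gaussian_def)
    also have "\<dots> = distr ?G (vec_borel d) (vec d \<circ> (\<lambda>x. \<lambda>k\<in>{..<d}. x (t, k)))"
      by (intro distr_distr measurable_vec) auto
    also have "vec d \<circ> (\<lambda>x. \<lambda>k\<in>{..<d}. x (t, k)) = ?V t"
      by (auto simp: fun_eq_iff intro!: eq_vecI)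
    finally show ?thesis by simp
  qed
  ultimately have "distr ?G (signal_space d) (\<lambda>x t. ?V t x) = (\<Pi>\<^sub>M t\<in>UNIV. std_gaussian d)"
    by (simp add: restrict_UNIV)
  with 1 show ?thesis by simp
qed

text \<open>A finite set of pairs of a time and a coordinate lies below some time \<open>T\<close>,
  so the bound on partial energies yields the uniform bound over finite index sets that the scalar
  estimate asks for.\<close>

lemma white_noise_shift_privacy:
  assumes e: "0 < \<epsilon>" and d: "0 < \<delta>" "\<delta> < 1" and \<Omega>: "prob_space \<Omega>" and w: "white_noise \<Omega> l v"
    and h: "\<And>t. h t \<in> carrier_vec l"
    and hb: "\<And>T. sqrt (\<Sum>t<T. scalar_prod (h t) (h t)) * kappa \<delta> \<epsilon> \<le> 1"
    and S: "S \<in> sets (signal_space l)"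
  defines "N \<equiv> distr \<Omega> (signal_space l) (\<lambda>\<omega> t. v t \<omega>)"
  shows "measure N {x \<in> space N. (\<lambda>t. x t + h t) \<in> S} \<le> exp \<epsilon> * measure N S + \<delta>"
proof -
  let ?I = "(UNIV :: nat set) \<times> {..<l}"
  let ?G = "PiM ?I (\<lambda>_. std_normal_distribution)"
  define V :: "(nat \<times> nat \<Rightarrow> real) \<Rightarrow> nat \<Rightarrow> real vec" where "V x t = vec l (\<lambda>k. x (t, k))" for x t
  have Vb: "V \<in> PiM ?I (\<lambda>_. borel) \<rightarrow>\<^sub>M signal_space l"
    unfolding V_def by (intro measurable_signal_spaceI measurable_vec) auto
  have Vm[measurable]: "V \<in> ?G \<rightarrow>\<^sub>M signal_space l"
    unfolding V_def by (intro measurable_signal_spaceI measurable_vec) auto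
  have N: "N = distr ?G (signal_space l) V"
    unfolding N_def V_def[abs_def] by (rule distr_white_noise[OF \<Omega> w])
  have sh: "(\<lambda>x t. x t + h t) \<in> signal_space l \<rightarrow>\<^sub>M signal_space l"
    by (intro measurable_signal_spaceI measurable_vec_add measurable_signal_nth measurable_const) (simp add: h)
  define u where "u = (\<lambda>(t, k). h t $ k)"
  have Vu: "V (\<lambda>i\<in>?I. x i + u i) = (\<lambda>t. V x t + h t)" for x
    by (intro ext eq_vecI) (use carrier_vecD[OF h] in \<open>auto simp: V_def u_def\<close>)
  have ub: "sqrt (\<Sum>j\<in>J. (u j)\<^sup>2) * kappa \<delta> \<epsilon> \<le> 1" if J: "finite J" "J \<subseteq> ?I" for J
  proof -
    obtain T where T: "fst ` J \<subseteq> {..<T}" using J finite_nat_bounded[of "fst ` J"] by auto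
    have "(\<Sum>j\<in>J. (u j)\<^sup>2) \<le> (\<Sum>j\<in>{..<T}\<times>{..<l}. (u j)\<^sup>2)"
      using J T by (intro sum_mono2) force+
    also have "\<dots> = (\<Sum>t<T. scalar_prod (h t) (h t))"
      unfolding sum.cartesian_product'[symmetric]
      using carrier_vecD[OF h]
      by (simp add: u_def scalar_prod_def atLeast0LessThan power2_eq_square
          sum.cartesian_product split_beta)
    finally have "sqrt (\<Sum>j\<in>J. (u j)\<^sup>2) \<le> sqrt (\<Sum>t<T. scalar_prod (h t) (h t))" by simp
    then show ?thesis using hb[of T] kappa_pos[OF e, of \<delta>]
      by (meson mult_right_mono order_trans less_imp_le)
  qed
  have sp: "V x \<in> space (signal_space l)" for x by (simp add: space_signal_space V_def)
  have A: "{x \<in> space N. (\<lambda>t. x t + h t) \<in> S} \<in> sets N"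
    using measurable_sets[OF sh S] by (simp add: N_def vimage_def Int_def conj_commute)
  have "measure N {x \<in> space N. (\<lambda>t. x t + h t) \<in> S} =
      measure ?G {x \<in> space ?G. (\<lambda>i\<in>?I. x i + u i) \<in> V -` S \<inter> space (PiM ?I (\<lambda>_. borel))}"
    unfolding N using A sp by (subst measure_distr)
      (auto simp: N Vu space_PiM intro!: arg_cong[where f="measure ?G"])
  also have "\<dots> \<le> exp \<epsilon> * measure ?G (V -` S \<inter> space (PiM ?I (\<lambda>_. borel))) + \<delta>"
    by (intro std_normal_shift_privacy e d ub measurable_sets[OF Vb S])
  also have "measure ?G (V -` S \<inter> space (PiM ?I (\<lambda>_. borel))) = measure N S"
    unfolding N using S by (subst measure_distr) (auto simp: space_PiM)
  finally show ?thesis by simp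
qed

text \<open>On a Hahn set \<open>Y\<close> the law \<open>P1\<close> dominates \<open>c\<close>
  times \<open>P2\<close>, and off \<open>Y\<close> it is dominated. The excess on \<open>Y\<close>
  is thus a measure that repairs the inequality on every event, and its total mass is bounded by the
  hypothesis read at \<open>Y\<close>.\<close>

lemma delta_bounded_excess:
  assumes P: "prob_space P1" "prob_space P2" "sets P1 = sets R" "sets P2 = sets R" and c: "0 \<le> c" and d: "0 \<le> \<delta>"
    and le: "\<And>S. S \<in> sets R \<Longrightarrow> measure P1 S \<le> c * measure P2 S + \<delta>"
  shows "\<exists>mu. delta_bounded R \<delta> mu \<and> (\<forall>S\<in>sets R. measure P1 S \<le> c * measure P2 S + measure mu S)"
proof -
  interpret P1: prob_space P1 by fact
  interpret P2: prob_space P2 by fact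
  define Q where "Q = scale_measure (ennreal c) P2"
  have sQ: "sets Q = sets P1" by (simp add: Q_def P)
  have Q: "emeasure Q S = ennreal (c * measure P2 S)" for S
    using c by (simp add: Q_def P2.emeasure_eq_measure ennreal_mult')
  have fQ: "finite_measure Q" by (rule finite_measureI) (simp add: Q)
  have mQ: "measure Q S = c * measure P2 S" for S using c by (simp add: measure_def Q)
  interpret Q: finite_measure Q by fact
  obtain Y where Y: "Y \<in> sets P1" "\<And>X. X \<in> sets P1 \<Longrightarrow> X \<subseteq> Y \<Longrightarrow> Q X \<le> P1 X"
      "\<And>X. X \<in> sets P1 \<Longrightarrow> X \<inter> Y = {} \<Longrightarrow> P1 X \<le> Q X"
    using finite_unsigned_Hahn_decomposition[OF P1.finite_measure_axioms fQ sQ] by metis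
  \<comment> \<open>Both measures are cut down to \<open>Y\<close> before subtracting, so that the
    second lies below the first on every set.\<close>
  define D where "D M = density M (indicator Y :: _ \<Rightarrow> ennreal)" for M :: "'a measure"
  have sD: "sets (D M) = sets M" for M by (simp add: D_def)
  have D: "emeasure (D M) X = emeasure M (X \<inter> Y)" if "sets M = sets P1" "X \<in> sets M" for M X
    unfolding D_def using that Y(1) by (subst emeasure_density) (auto simp: indicator_inter_arith[symmetric] Int_commute)
  have fin: "finite_measure (D M)" if "finite_measure M" "sets M = sets P1" for M
  proof (rule finite_measureI)
    have "space (D M) = space M" by (simp add: D_def)
    then have "emeasure (D M) (space (D M)) = emeasure M (space M \<inter> Y)"
      using D[OF that(2), of "space M"] by simp
    then show "emeasure (D M) (space (D M)) \<noteq> \<infinity>"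
      using finite_measure.emeasure_finite[OF that(1)] by simp
  qed
  let ?mu = "diff_measure (D P1) (D Q)"
  have mu: "emeasure ?mu S = ennreal (measure P1 (S \<inter> Y) - c * measure P2 (S \<inter> Y))" if "S \<in> sets R" for S
  proof -
    have "emeasure ?mu S = emeasure (D P1) S - emeasure (D Q) S"
      using that Y(1) by (intro emeasure_diff_measure fin P1.finite_measure_axioms fQ)
        (auto simp: sD sQ D P(3) intro!: Y(2))
    also have "\<dots> = ennreal (measure P1 (S \<inter> Y)) - ennreal (c * measure P2 (S \<inter> Y))"
      using that by (simp add: D sQ P P1.emeasure_eq_measure Q)
    finally show ?thesis using c by (simp add: ennreal_minus)
  qed
  have ge: "0 \<le> measure P1 (S \<inter> Y) - c * measure P2 (S \<inter> Y)" if "S \<in> sets R" for S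
    using Y(2)[of "S \<inter> Y"] that Y(1) c by (simp add: P Q P1.emeasure_eq_measure)
  have mm: "measure ?mu S = measure P1 (S \<inter> Y) - c * measure P2 (S \<inter> Y)" if "S \<in> sets R" for S
    using mu[OF that] ge[OF that] by (simp add: measure_def)
  have smu: "sets ?mu = sets R" by (simp add: sD P)
  have "delta_bounded R \<delta> ?mu"
    unfolding delta_bounded_def
  proof (intro conjI smu)
    show "finite_measure ?mu"
      using mu[of "space R"] sets_eq_imp_space_eq[OF smu] by (intro finite_measureI) simp
    show "measure ?mu (space R) \<le> \<delta>"
      using le[of "space R \<inter> Y"] Y(1) by (simp add: mm P)
  qed
  moreover have "measure P1 S \<le> c * measure P2 S + measure ?mu S" if S: "S \<in> sets R" for S
  proof -
    have "measure P1 S = measure P1 (S \<inter> Y) + measure P1 (S - Y)"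
      using S Y(1) by (subst P1.finite_measure_Union[symmetric]) (auto simp: P Int_Diff_Un)
    moreover have "measure P2 S = measure P2 (S \<inter> Y) + measure P2 (S - Y)"
      using S Y(1) by (subst P2.finite_measure_Union[symmetric]) (auto simp: P Int_Diff_Un)
    moreover have "measure P1 (S - Y) \<le> c * measure P2 (S - Y)"
      using Y(3)[of "S - Y"] S Y(1) c by (auto simp: P P1.emeasure_eq_measure Q)
    ultimately show ?thesis using mm[OF S] by (simp add: algebra_simps)
  qed
  ultimately show ?thesis by blast
qed

section \<open>Conditioning on the measurement noise\<close>

lemma indep_rv_distr_pair:
  assumes \<Omega>: "prob_space \<Omega>" and i: "indep_rv \<Omega> MX X MY Y"
  shows "distr \<Omega> (MX \<Otimes>\<^sub>M MY) (\<lambda>\<omega>. (X \<omega>, Y \<omega>)) = distr \<Omega> MX X \<Otimes>\<^sub>M distr \<Omega> MY Y"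
proof -
  interpret prob_space \<Omega> by fact
  have X[measurable]: "X \<in> \<Omega> \<rightarrow>\<^sub>M MX" and Y[measurable]: "Y \<in> \<Omega> \<rightarrow>\<^sub>M MY"
    and ind: "indep_set {X -` E \<inter> space \<Omega> | E. E \<in> sets MX} {Y -` E \<inter> space \<Omega> | E. E \<in> sets MY}"
    using i by (auto simp: indep_rv_def)
  interpret DX: prob_space "distr \<Omega> MX X" by (rule prob_space_distr) fact
  interpret DY: prob_space "distr \<Omega> MY Y" by (rule prob_space_distr) fact
  show ?thesis
  proof (rule pair_measure_eqI[symmetric])
    fix A B assume A: "A \<in> sets (distr \<Omega> MX X)" and B: "B \<in> sets (distr \<Omega> MY Y)"
    have "prob ((X -` A \<inter> space \<Omega>) \<inter> (Y -` B \<inter> space \<Omega>)) = prob (X -` A \<inter> space \<Omega>) * prob (Y -` B \<inter> space \<Omega>)"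
      using A B by (intro indep_setD[OF ind]) auto
    moreover have "(X -` A \<inter> space \<Omega>) \<inter> (Y -` B \<inter> space \<Omega>) = (\<lambda>\<omega>. (X \<omega>, Y \<omega>)) -` (A \<times> B) \<inter> space \<Omega>"
      by auto
    ultimately show "emeasure (distr \<Omega> MX X) A * emeasure (distr \<Omega> MY Y) B =
        emeasure (distr \<Omega> (MX \<Otimes>\<^sub>M MY) (\<lambda>\<omega>. (X \<omega>, Y \<omega>))) (A \<times> B)"
      using A B by (simp add: emeasure_distr emeasure_eq_measure ennreal_mult')
  qed (auto simp: DX.sigma_finite_measure_axioms DY.sigma_finite_measure_axioms)
qed

text \<open>Fubini's theorem: once \<open>W\<close> is frozen, \<open>g\<close> contributes a
  translation common to both events, and only \<open>h\<close> distinguishes them. As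
  \<open>h\<close> does not depend on \<open>W\<close>, the estimate is the same in every section,
  and integrating over a probability law does not enlarge \<delta>.\<close>

lemma shifted_noise_privacy:
  assumes e: "0 < \<epsilon>" and d: "0 < \<delta>" "\<delta> < 1" and \<Omega>: "prob_space \<Omega>" and w: "white_noise \<Omega> l v"
    and ind: "indep_rv \<Omega> (signal_space l) (\<lambda>\<omega> t. v t \<omega>) MW W"
    and g: "g \<in> MW \<rightarrow>\<^sub>M signal_space l"
    and h: "\<And>t. h t \<in> carrier_vec l" and c: "c \<noteq> 0"
    and hb: "\<And>T. sqrt (\<Sum>t<T. scalar_prod (h t) (h t)) * kappa \<delta> \<epsilon> \<le> \<bar>c\<bar>"
    and S: "S \<in> sets (signal_space l)"
  shows "measure \<Omega> {\<omega> \<in> space \<Omega>. (\<lambda>t. (g (W \<omega>) t + h t) + c \<cdot>\<^sub>v v t \<omega>) \<in> S}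
    \<le> exp \<epsilon> * measure \<Omega> {\<omega> \<in> space \<Omega>. (\<lambda>t. g (W \<omega>) t + c \<cdot>\<^sub>v v t \<omega>) \<in> S} + \<delta>"
proof -
  interpret \<Omega>: prob_space \<Omega> by fact
  let ?S = "signal_space l"
  define V where "V \<omega> t = v t \<omega>" for \<omega> t
  have Vm: "V \<in> \<Omega> \<rightarrow>\<^sub>M ?S" and Wm: "W \<in> \<Omega> \<rightarrow>\<^sub>M MW"
    using ind by (auto simp: indep_rv_def V_def[abs_def])
  define N where "N = distr \<Omega> ?S V"
  define D where "D = distr \<Omega> MW W"
  interpret N: prob_space N unfolding N_def by (rule \<Omega>.prob_space_distr) fact
  interpret D: prob_space D unfolding D_def by (rule \<Omega>.prob_space_distr) fact
  interpret pair_sigma_finite N D ..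
  have sN: "space N = space ?S" "sets N = sets ?S" by (simp_all add: N_def)
  define F where "F a p t = (g (snd p) t + a t) + c \<cdot>\<^sub>v fst p t"
    for a :: "nat \<Rightarrow> real vec" and p :: "(nat \<Rightarrow> real vec) \<times> 'b" and t :: nat
  have joint: "distr \<Omega> (?S \<Otimes>\<^sub>M MW) (\<lambda>\<omega>. (V \<omega>, W \<omega>)) = N \<Otimes>\<^sub>M D"
    unfolding N_def D_def using ind by (intro indep_rv_distr_pair \<Omega>) (simp add: V_def[abs_def])
  have Fm: "F a \<in> ?S \<Otimes>\<^sub>M MW \<rightarrow>\<^sub>M ?S" if "\<And>t. a t \<in> carrier_vec l" for a
    unfolding F_def using that
    by (intro measurable_signal_spaceI measurable_vec_add measurable_vec_smult measurable_const
        measurable_compose[OF measurable_compose[OF measurable_snd g] measurable_signal_nth]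
        measurable_compose[OF measurable_fst measurable_signal_nth]) simp
  have P: "measure \<Omega> {\<omega> \<in> space \<Omega>. F a (V \<omega>, W \<omega>) \<in> S} = measure (N \<Otimes>\<^sub>M D) {p \<in> space (N \<Otimes>\<^sub>M D). F a p \<in> S}"
    if a: "\<And>t. a t \<in> carrier_vec l" for a
  proof -
    have "{p \<in> space (?S \<Otimes>\<^sub>M MW). F a p \<in> S} \<in> sets (?S \<Otimes>\<^sub>M MW)"
      using measurable_sets[OF Fm S, of a] a by (simp add: vimage_def Int_def conj_commute)
    then show ?thesis
      unfolding joint[symmetric] using Vm Wm measurable_space[OF Vm] measurable_space[OF Wm]
      by (subst measure_distr) (auto simp: space_pair_measure intro!: arg_cong[where f="measure \<Omega>"])
  qed
  have Sm: "{p \<in> space (N \<Otimes>\<^sub>M D). F a p \<in> S} \<in> sets (N \<Otimes>\<^sub>M D)" if "\<And>t. a t \<in> carrier_vec l" for a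
    using measurable_sets[OF Fm S, of a] that sets_pair_measure_cong[of N ?S D MW]
    by (simp add: vimage_def Int_def conj_commute N_def D_def space_pair_measure)
  define sec where "sec a x = (\<lambda>p. (p, x)) -` {p \<in> space (N \<Otimes>\<^sub>M D). F a p \<in> S}" for a x
  have E: "emeasure (N \<Otimes>\<^sub>M D) {p \<in> space (N \<Otimes>\<^sub>M D). F a p \<in> S} = (\<integral>\<^sup>+ x. emeasure N (sec a x) \<partial>D)"
    if "\<And>t. a t \<in> carrier_vec l" for a
    unfolding sec_def by (rule emeasure_pair_measure_alt2[OF Sm[OF that]])
  let ?z = "\<lambda>t::nat. 0\<^sub>v l :: real vec"
  have key: "emeasure N (sec h x) \<le> exp \<epsilon> * emeasure N (sec ?z x) + \<delta>" if x: "x \<in> space D" for x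
  proof -
    have gx: "g x t \<in> carrier_vec l" for t
      using measurable_space[OF g, of x] x by (simp add: D_def space_signal_space)
    \<comment> \<open>The translation is moved inside the factor \<open>c\<close>: adding
      \<open>h\<close> to the scaled noise is adding \<open>h'\<close> to the unit noise.\<close>
    define h' where "h' t = (1 / c) \<cdot>\<^sub>v h t" for t
    have hc: "h' t \<in> carrier_vec l" for t using h by (simp add: h'_def)
    have hb': "sqrt (\<Sum>t<T. scalar_prod (h' t) (h' t)) * kappa \<delta> \<epsilon> \<le> 1" for T
    proof -
      have "(\<Sum>t<T. scalar_prod (h' t) (h' t)) = (\<Sum>t<T. scalar_prod (h t) (h t)) / c\<^sup>2"
        unfolding h'_def using h
        by (simp add: sum_divide_distrib power2_eq_square
            scalar_prod_smult_left scalar_prod_smult_right carrier_vecD[OF h])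
      then have "sqrt (\<Sum>t<T. scalar_prod (h' t) (h' t)) = sqrt (\<Sum>t<T. scalar_prod (h t) (h t)) / \<bar>c\<bar>"
        by (simp add: real_sqrt_divide)
      then show ?thesis using hb[of T] c by (simp add: divide_le_eq)
    qed
    define Z where "Z = sec ?z x"
    have Zm: "Z \<in> sets ?S"
      unfolding Z_def sec_def using sets_Pair2[OF Sm[of ?z], of x] by (simp add: sN)
    have "sec h x = {y \<in> space N. (\<lambda>t. y t + h' t) \<in> Z}"
    proof -
      have "F h (y, x) = F ?z (\<lambda>t. y t + h' t, x)" if y: "y \<in> space N" for y
      proof
        fix t
        have yt: "y t \<in> carrier_vec l" using y by (simp add: sN space_signal_space)
        have "c \<cdot>\<^sub>v h' t = h t" using c h by (simp add: h'_def smult_smult_assoc)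
        then have "c \<cdot>\<^sub>v (y t + h' t) = c \<cdot>\<^sub>v y t + h t"
          using yt hc by (simp add: smult_add_distrib_vec[OF yt hc])
        then show "F h (y, x) t = F ?z (\<lambda>t. y t + h' t, x) t"
          unfolding F_def using gx[of t] yt h[of t]
          by (intro eq_vecI) (auto simp: carrier_vecD)
      qed
      moreover have "(\<lambda>t. y t + h' t) \<in> space N" if "y \<in> space N" for y
        using that hc by (simp add: sN space_signal_space)
      ultimately show ?thesis
        using x by (auto simp: sec_def Z_def space_pair_measure)
    qed
    moreover have "measure N {y \<in> space N. (\<lambda>t. y t + h' t) \<in> Z} \<le> exp \<epsilon> * measure N Z + \<delta>"
      unfolding N_def V_def[abs_def]
      by (rule white_noise_shift_privacy[OF e d \<Omega> w hc hb' Zm])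
    ultimately have "measure N (sec h x) \<le> exp \<epsilon> * measure N (sec ?z x) + \<delta>" by (simp add: Z_def)
    then show ?thesis
      using d by (simp add: N.emeasure_eq_measure flip: ennreal_mult' ennreal_plus)
  qed
  interpret ND: pair_prob_space N D ..
  have "emeasure (N \<Otimes>\<^sub>M D) {p \<in> space (N \<Otimes>\<^sub>M D). F h p \<in> S} \<le> (\<integral>\<^sup>+ x. exp \<epsilon> * emeasure N (sec ?z x) + \<delta> \<partial>D)"
    unfolding E[OF h] by (intro nn_integral_mono key)
  also have "\<dots> = exp \<epsilon> * (\<integral>\<^sup>+ x. emeasure N (sec ?z x) \<partial>D) + \<delta>"
  proof -
    have "(\<lambda>x. emeasure N (sec ?z x)) \<in> borel_measurable D"
      unfolding sec_def by (rule measurable_emeasure_Pair2[OF Sm]) simp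
    then show ?thesis
      by (simp add: nn_integral_add nn_integral_cmult D.emeasure_space_1)
  qed
  also have "\<dots> = exp \<epsilon> * emeasure (N \<Otimes>\<^sub>M D) {p \<in> space (N \<Otimes>\<^sub>M D). F ?z p \<in> S} + \<delta>"
    by (simp add: E)
  finally have "measure (N \<Otimes>\<^sub>M D) {p \<in> space (N \<Otimes>\<^sub>M D). F h p \<in> S} \<le>
      exp \<epsilon> * measure (N \<Otimes>\<^sub>M D) {p \<in> space (N \<Otimes>\<^sub>M D). F ?z p \<in> S} + \<delta>"
    using d by (simp add: ND.emeasure_eq_measure flip: ennreal_mult' ennreal_plus)
  then have "measure \<Omega> {\<omega> \<in> space \<Omega>. F h (V \<omega>, W \<omega>) \<in> S} \<le>
      exp \<epsilon> * measure \<Omega> {\<omega> \<in> space \<Omega>. F ?z (V \<omega>, W \<omega>) \<in> S} + \<delta>"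
    using h by (simp add: P)
  moreover have "F ?z (V \<omega>, W \<omega>) = (\<lambda>t. g (W \<omega>) t + c \<cdot>\<^sub>v v t \<omega>)" if "\<omega> \<in> space \<Omega>" for \<omega>
    using measurable_space[OF measurable_compose[OF Wm g] that]
    by (auto simp: F_def V_def space_signal_space fun_eq_iff)
  ultimately show ?thesis
    by (simp add: F_def[of h, abs_def] V_def cong: conj_cong)
qed

subsection \<open>The largest singular value\<close>

definition cnorm :: "complex vec \<Rightarrow> real" where
  "cnorm v = L2_set (\<lambda>i. cmod (v $ i)) {..<dim_vec v}"

definition cip :: "complex vec \<Rightarrow> complex vec \<Rightarrow> complex" where
  "cip v w = (\<Sum>i<dim_vec v. v $ i * cnj (w $ i))"

lemma cnorm_nonneg [simp]: "0 \<le> cnorm v"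
  by (simp add: cnorm_def)

lemma cnorm_sq: "(cnorm v)\<^sup>2 = (\<Sum>i<dim_vec v. (cmod (v $ i))\<^sup>2)"
  by (simp add: cnorm_def L2_set_def sum_nonneg)

lemma cip_self: "cip v v = complex_of_real ((cnorm v)\<^sup>2)"
  by (simp add: cip_def cnorm_sq complex_mult_cnj cmod_power2)

lemma cnorm_sq_eq_Re_cip: "(cnorm v)\<^sup>2 = Re (cip v v)"
  by (simp add: cip_self)

lemma cnorm_eq_0_iff: "v \<in> carrier_vec d \<Longrightarrow> cnorm v = 0 \<longleftrightarrow> v = 0\<^sub>v d"
  by (auto simp: cnorm_def L2_set_eq_0_iff intro!: eq_vecI)

lemma cnorm_triangle:
  assumes "v \<in> carrier_vec d" "w \<in> carrier_vec d"
  shows "cnorm (v + w) \<le> cnorm v + cnorm w"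
proof -
  have "cnorm (v + w) \<le> L2_set (\<lambda>i. cmod (v $ i) + cmod (w $ i)) {..<d}"
    unfolding cnorm_def using assms by (auto intro!: L2_set_mono norm_triangle_ineq)
  also have "\<dots> \<le> cnorm v + cnorm w"
    unfolding cnorm_def using assms L2_set_triangle_ineq[of "\<lambda>i. cmod (v $ i)" _ "{..<d}"] by auto
  finally show ?thesis .
qed

lemma cnorm_smult: "cnorm (c \<cdot>\<^sub>v v) = cmod c * cnorm v"
proof -
  have "cnorm (c \<cdot>\<^sub>v v) = L2_set (\<lambda>i. cmod c * cmod (v $ i)) {..<dim_vec v}"
    unfolding cnorm_def by (rule L2_set_cong) (auto simp: norm_mult)
  then show ?thesis by (simp add: cnorm_def L2_set_right_distrib)
qed

lemma cmod_index_le_cnorm: "i < dim_vec v \<Longrightarrow> cmod (v $ i) \<le> cnorm v"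
  unfolding cnorm_def by (rule member_le_L2_set) auto

text \<open>A crude bound for the operator norm. It is visibly continuous in the entries, hence
  bounded over a compact range of frequencies.\<close>

definition entry_sum :: "complex mat \<Rightarrow> real" where
  "entry_sum X = (\<Sum>i<dim_row X. \<Sum>j<dim_col X. cmod (X $$ (i, j)))"

lemma entry_sum_nonneg [simp]: "0 \<le> entry_sum X"
  by (simp add: entry_sum_def sum_nonneg)

lemma cnorm_mult_mat_vec_le:
  assumes "X \<in> carrier_mat r d" "v \<in> carrier_vec d"
  shows "cnorm (X *\<^sub>v v) \<le> entry_sum X * cnorm v"
proof -
  have "cnorm (X *\<^sub>v v) \<le> (\<Sum>i<r. cmod ((X *\<^sub>v v) $ i))"
    unfolding cnorm_def using assms by (auto intro!: order_trans[OF L2_set_le_sum])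
  also have "\<dots> \<le> (\<Sum>i<r. \<Sum>j<d. cmod (X $$ (i, j)) * cnorm v)"
  proof (rule sum_mono)
    fix i assume i: "i \<in> {..<r}"
    have "cmod ((X *\<^sub>v v) $ i) = cmod (\<Sum>j<d. X $$ (i, j) * v $ j)"
      using assms i by (auto simp: scalar_prod_def atLeast0LessThan)
    also have "\<dots> \<le> (\<Sum>j<d. cmod (X $$ (i, j) * v $ j))" by (rule norm_sum)
    also have "\<dots> \<le> (\<Sum>j<d. cmod (X $$ (i, j)) * cnorm v)"
      using assms by (intro sum_mono) (auto simp: norm_mult intro!: mult_left_mono cmod_index_le_cnorm)
    finally show "cmod ((X *\<^sub>v v) $ i) \<le> (\<Sum>j<d. cmod (X $$ (i, j)) * cnorm v)" .
  qed
  also have "\<dots> = entry_sum X * cnorm v"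
    using assms by (simp add: entry_sum_def sum_distrib_right)
  finally show ?thesis .
qed

lemma mat_adjoint_carrier: "G \<in> carrier_mat r d \<Longrightarrow> mat_adjoint G \<in> carrier_mat d r"
  by (auto simp: mat_adjoint_def mat_of_rows_def)

lemma mat_adjoint_index:
  assumes "G \<in> carrier_mat r d" "i < d" "j < r"
  shows "mat_adjoint G $$ (i, j) = cnj (G $$ (j, i))"
  using assms by (auto simp: mat_adjoint_def mat_of_rows_def)

lemma cip_mat_adjoint:
  assumes G: "G \<in> carrier_mat r d" and u: "u \<in> carrier_vec r" and w: "w \<in> carrier_vec d"
  shows "cip (mat_adjoint G *\<^sub>v u) w = cip u (G *\<^sub>v w)"
proof -
  have "cip (mat_adjoint G *\<^sub>v u) w = (\<Sum>i<d. (\<Sum>j<r. cnj (G $$ (j, i)) * u $ j) * cnj (w $ i))"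
    using mat_adjoint_carrier[OF G] u
    by (auto simp: cip_def scalar_prod_def atLeast0LessThan mat_adjoint_index[OF G] intro!: sum.cong)
  also have "\<dots> = (\<Sum>j<r. \<Sum>i<d. (cnj (G $$ (j, i)) * u $ j) * cnj (w $ i))"
    unfolding sum_distrib_right by (rule sum.swap)
  also have "\<dots> = cip u (G *\<^sub>v w)"
    using G u w by (auto simp: cip_def scalar_prod_def atLeast0LessThan sum_distrib_left mult_ac intro!: sum.cong)
  finally show ?thesis .
qed

lemma cnorm_sq_add_real_smult:
  assumes v: "v \<in> carrier_vec d" and w: "w \<in> carrier_vec d"
  shows "(cnorm (v + complex_of_real s \<cdot>\<^sub>v w))\<^sup>2 = (cnorm v)\<^sup>2 + 2 * s * Re (cip v w) + s\<^sup>2 * (cnorm w)\<^sup>2"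
proof -
  have *: "(cmod (x + of_real s * y))\<^sup>2 = (cmod x)\<^sup>2 + 2 * s * Re (x * cnj y) + s\<^sup>2 * (cmod y)\<^sup>2" for x y
    unfolding cmod_power2 by (simp add: power2_eq_square algebra_simps)
  show ?thesis
    using v w by (simp add: cnorm_sq cip_def * sum.distrib flip: sum_distrib_left)
qed

lemma cip_diff_smult:
  assumes "v \<in> carrier_vec d" "w \<in> carrier_vec d" "x \<in> carrier_vec d"
  shows "cip (v + c \<cdot>\<^sub>v w) x = cip v x + c * cip w x"
  using assms by (simp add: cip_def sum.distrib sum_distrib_left algebra_simps)

text \<open>Pairing the eigenvector equation with the eigenvector itself exhibits the eigenvalue as
  a Rayleigh quotient; in particular it is real and nonnegative.\<close>

lemma gram_eigenvalueD:
  assumes G: "G \<in> carrier_mat r d" and z: "eigenvalue (mat_adjoint G * G) z"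
  shows "\<exists>v \<in> carrier_vec d. v \<noteq> 0\<^sub>v d \<and> z = of_real ((cnorm (G *\<^sub>v v))\<^sup>2 / (cnorm v)\<^sup>2)"
proof -
  note A = mat_adjoint_carrier[OF G]
  obtain v where v: "v \<in> carrier_vec d" "v \<noteq> 0\<^sub>v d" "(mat_adjoint G * G) *\<^sub>v v = z \<cdot>\<^sub>v v"
    using z A G unfolding eigenvalue_def eigenvector_def by auto
  have Gv: "G *\<^sub>v v \<in> carrier_vec r" using G v by auto
  have "cip (z \<cdot>\<^sub>v v) v = cip (mat_adjoint G *\<^sub>v (G *\<^sub>v v)) v"
    using v A G by (simp add: assoc_mult_mat_vec flip: v(3))
  also have "\<dots> = of_real ((cnorm (G *\<^sub>v v))\<^sup>2)"
    by (simp add: cip_mat_adjoint[OF G Gv v(1)] cip_self)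
  also have "cip (z \<cdot>\<^sub>v v) v = z * of_real ((cnorm v)\<^sup>2)"
    unfolding cip_self[symmetric] by (simp add: cip_def sum_distrib_left mult_ac)
  finally have "z * of_real ((cnorm v)\<^sup>2) = of_real ((cnorm (G *\<^sub>v v))\<^sup>2)" .
  moreover have "cnorm v \<noteq> 0" using v cnorm_eq_0_iff by auto
  ultimately have "z = of_real ((cnorm (G *\<^sub>v v))\<^sup>2 / (cnorm v)\<^sup>2)" by (simp add: field_simps)
  then show ?thesis using v by blast
qed

lemma smult_mat_mult_vec:
  fixes X :: "'a :: comm_semiring_0 mat"
  assumes "X \<in> carrier_mat r d" "v \<in> carrier_vec d"
  shows "(c \<cdot>\<^sub>m X) *\<^sub>v v = c \<cdot>\<^sub>v (X *\<^sub>v v)"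
  using assms by (intro eq_vecI) (auto simp: scalar_prod_def sum_distrib_left mult.assoc intro!: sum.cong)

lemma smult_pow_mat:
  fixes X :: "'a :: comm_semiring_1 mat"
  assumes "X \<in> carrier_mat d d"
  shows "(c \<cdot>\<^sub>m X) ^\<^sub>m k = c ^ k \<cdot>\<^sub>m (X ^\<^sub>m k)"
proof (induction k)
  case (Suc k)
  have "X ^\<^sub>m k \<in> carrier_mat d d" using assms by simp
  with Suc assms show ?case
    by (intro eq_matI) (auto simp: scalar_prod_def sum_distrib_left mult_ac intro!: sum.cong)
qed (use assms in \<open>auto intro!: eq_matI\<close>)

text \<open>A nonzero determinant guarantees that \<open>mat_inverse\<close> returns a value,
  without which \<open>matinv\<close> would be unspecified.\<close>

lemma left_inverse_exists:
  assumes X: "(X :: 'a :: field mat) \<in> carrier_mat d d" and det: "det X \<noteq> 0"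
  shows "\<exists>Q \<in> carrier_mat d d. mat_inverse X = Some Q \<and> Q * X = 1\<^sub>m d \<and> X * Q = 1\<^sub>m d"
proof -
  have "X \<in> Units (ring_mat TYPE('a) d ())" by (rule det_non_zero_imp_unit[OF X det])
  then obtain Q where Q: "mat_inverse X = Some Q" using mat_inverse(1)[OF X, of "()"] by (cases "mat_inverse X") auto
  then show ?thesis using mat_inverse(2)[OF X Q] by auto
qed

text \<open>If the least upper bound \<open>lm\<close> of \<open>|G v|\<^sup>2 / |v|\<^sup>2\<close> were not an eigenvalue of \<open>G\<^sup>* G\<close>, then
  \<open>lm - G\<^sup>* G\<close> would be an invertible positive semidefinite form, hence coercive, and \<open>lm\<close> could be decreased.\<close>
lemma gram_sup_eigenvalue:
  assumes G: "G \<in> carrier_mat r d" and l0: "0 \<le> lm"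
    and ub: "\<And>v. v \<in> carrier_vec d \<Longrightarrow> (cnorm (G *\<^sub>v v))\<^sup>2 \<le> lm * (cnorm v)\<^sup>2"
    and lub: "\<And>a. (\<And>v. v \<in> carrier_vec d \<Longrightarrow> (cnorm (G *\<^sub>v v))\<^sup>2 \<le> a * (cnorm v)\<^sup>2) \<Longrightarrow> lm \<le> a"
  shows "eigenvalue (mat_adjoint G * G) (of_real lm)"
proof (rule ccontr)
  assume not: "\<not> ?thesis"
  note A = mat_adjoint_carrier[OF G]
  let ?H = "mat_adjoint G * G"
  let ?X = "char_matrix ?H (of_real lm)"
  have H: "?H \<in> carrier_mat d d" using A G by auto
  then have X: "?X \<in> carrier_mat d d" by simp
  have "det ?X \<noteq> 0" using not eigenvalue_det[OF H] by simp
  from left_inverse_exists[OF X this] obtain Q where Q: "Q \<in> carrier_mat d d" "Q * ?X = 1\<^sub>m d" by blast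
  define K where "K = entry_sum Q + 1"
  \<comment> \<open>Step length for moving \<open>v\<close> along \<open>w\<close>, which is half
    the gradient of the form
    \<open>(cnorm (G *\<^sub>v v))\<^sup>2 - lm * (cnorm v)\<^sup>2\<close>. With
    \<open>s * lm \<le> 1\<close> the first-order gain \<open>2 * s * (cnorm w)\<^sup>2\<close>
    absorbs the second-order term \<open>s\<^sup>2 * lm * (cnorm w)\<^sup>2\<close> and keeps at
    least half of itself.\<close>
  define s where "s = 1 / (lm + 1)"
  have K: "0 < K" using entry_sum_nonneg[of Q] unfolding K_def by linarith
  have s: "0 < s" "s * lm \<le> 1" using l0 by (auto simp: s_def)
  have "lm \<le> lm - s / K\<^sup>2"
  proof (rule lub)
    fix v :: "complex vec" assume v: "v \<in> carrier_vec d"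
    define w where "w = ?X *\<^sub>v v"
    have w: "w \<in> carrier_vec d" using X v by (simp add: w_def)
    have Gv: "G *\<^sub>v v \<in> carrier_vec r" "G *\<^sub>v w \<in> carrier_vec r" using G v w by auto
    have weq: "w = mat_adjoint G *\<^sub>v (G *\<^sub>v v) + (- of_real lm) \<cdot>\<^sub>v v"
    proof -
      have "w = ?H *\<^sub>v v + ((- of_real lm) \<cdot>\<^sub>m 1\<^sub>m d) *\<^sub>v v"
        unfolding w_def char_matrix_def using H v by (subst add_mult_distrib_mat_vec[of _ d d]) auto
      also have "?H *\<^sub>v v = mat_adjoint G *\<^sub>v (G *\<^sub>v v)"
        using A G v by (intro assoc_mult_mat_vec)
      also have "((- of_real lm) \<cdot>\<^sub>m 1\<^sub>m d) *\<^sub>v v = (- of_real lm) \<cdot>\<^sub>v v"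
        using v by (subst smult_mat_mult_vec[of _ d d]) auto
      finally show ?thesis .
    qed
    have "v = Q *\<^sub>v w"
      using Q X v by (simp add: w_def assoc_mult_mat_vec[symmetric])
    then have "cnorm v \<le> entry_sum Q * cnorm w"
      using cnorm_mult_mat_vec_le[OF Q(1) w] by simp
    also have "\<dots> \<le> K * cnorm w" by (intro mult_right_mono) (auto simp: K_def)
    finally have "(cnorm v)\<^sup>2 \<le> K\<^sup>2 * (cnorm w)\<^sup>2"
      by (metis cnorm_nonneg power_mono power_mult_distrib)
    then have wv: "(cnorm v)\<^sup>2 / K\<^sup>2 \<le> (cnorm w)\<^sup>2" using K by (simp add: field_simps)
    have ip: "Re (cip (G *\<^sub>v v) (G *\<^sub>v w)) - lm * Re (cip v w) = (cnorm w)\<^sup>2"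
    proof -
      have "cip w w = cip (G *\<^sub>v v) (G *\<^sub>v w) + (- of_real lm) * cip v w"
        by (subst weq, subst cip_diff_smult[of _ d])
           (use A Gv v w cip_mat_adjoint[OF G Gv(1) w] in auto)
      then show ?thesis by (simp add: cnorm_sq_eq_Re_cip)
    qed
    let ?x = "v + of_real s \<cdot>\<^sub>v w"
    have x: "?x \<in> carrier_vec d" using v w by auto
    have Gx: "G *\<^sub>v ?x = G *\<^sub>v v + of_real s \<cdot>\<^sub>v (G *\<^sub>v w)"
      using G v w by (simp add: mult_add_distrib_mat_vec[of _ r d] mult_mat_vec[of _ r d])
    from ub[OF x] have "(cnorm (G *\<^sub>v v))\<^sup>2 + 2 * s * (cnorm w)\<^sup>2 + s\<^sup>2 * (cnorm (G *\<^sub>v w))\<^sup>2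
        \<le> lm * (cnorm v)\<^sup>2 + s\<^sup>2 * lm * (cnorm w)\<^sup>2"
      unfolding Gx cnorm_sq_add_real_smult[OF v w] cnorm_sq_add_real_smult[OF Gv] ip[symmetric]
      by (simp add: algebra_simps)
    moreover have "s\<^sup>2 * lm * (cnorm w)\<^sup>2 \<le> s * (cnorm w)\<^sup>2"
      using s by (intro mult_right_mono) (auto simp: power2_eq_square mult.assoc)
    moreover have "0 \<le> s\<^sup>2 * (cnorm (G *\<^sub>v w))\<^sup>2" by simp
    moreover have "s * ((cnorm v)\<^sup>2 / K\<^sup>2) \<le> s * (cnorm w)\<^sup>2" using wv s by (intro mult_left_mono) auto
    moreover have "(lm - s / K\<^sup>2) * (cnorm v)\<^sup>2 = lm * (cnorm v)\<^sup>2 - s * ((cnorm v)\<^sup>2 / K\<^sup>2)"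
      by (simp add: algebra_simps)
    ultimately show "(cnorm (G *\<^sub>v v))\<^sup>2 \<le> (lm - s / K\<^sup>2) * (cnorm v)\<^sup>2"
      by linarith
  qed
  moreover have "0 < s / K\<^sup>2" using s K by simp
  ultimately show False by linarith
qed

text \<open>The spectrum of the Gram matrix is finite and, as \<open>d\<close> is positive,
  nonempty, so \<open>sigma_max\<close> is a ratio attained at some eigenvector \<open>v0\<close>;
  sign and minimality follow. It bounds all ratios because the supremum of their squares is again an
  eigenvalue, whose root is among the values whose maximum is taken.\<close>

lemma
  assumes G: "G \<in> carrier_mat r d" and d: "1 \<le> d"
  shows sigma_max_nonneg: "0 \<le> sigma_max G"
    and cnorm_mult_le_sigma_max: "v \<in> carrier_vec d \<Longrightarrow> cnorm (G *\<^sub>v v) \<le> sigma_max G * cnorm v"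
    and sigma_max_least: "0 \<le> a \<Longrightarrow> (\<And>v. v \<in> carrier_vec d \<Longrightarrow> cnorm (G *\<^sub>v v) \<le> a * cnorm v) \<Longrightarrow> sigma_max G \<le> a"
proof -
  let ?H = "mat_adjoint G * G"
  have H: "?H \<in> carrier_mat d d" using mat_adjoint_carrier[OF G] G by auto
  have fin: "finite (singular_values G)" "singular_values G \<noteq> {}"
    using card_finite_spectrum(1)[OF H] spectrum_non_empty[OF H] d by (auto simp: singular_values_def)
  then have "sigma_max G \<in> singular_values G" unfolding sigma_max_def by (rule Max_in)
  then obtain z where z: "eigenvalue ?H z" "sigma_max G = sqrt (Re z)"
    by (auto simp: singular_values_def spectrum_def)
  obtain v0 where v0: "v0 \<in> carrier_vec d" "v0 \<noteq> 0\<^sub>v d" "z = of_real ((cnorm (G *\<^sub>v v0))\<^sup>2 / (cnorm v0)\<^sup>2)"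
    using gram_eigenvalueD[OF G z(1)] by blast
  have c0: "0 < cnorm v0" using v0 cnorm_eq_0_iff[OF v0(1)] by (simp add: order_less_le)
  have s: "sigma_max G = cnorm (G *\<^sub>v v0) / cnorm v0"
    using v0 z by (simp add: real_sqrt_divide)
  show nn: "0 \<le> sigma_max G" using s by simp
  show "sigma_max G \<le> a" if "0 \<le> a" "\<And>v. v \<in> carrier_vec d \<Longrightarrow> cnorm (G *\<^sub>v v) \<le> a * cnorm v"
    using that(2)[OF v0(1)] c0 s by (simp add: divide_le_eq)
  show "cnorm (G *\<^sub>v v) \<le> sigma_max G * cnorm v" if v: "v \<in> carrier_vec d"
  proof -
    define R where "R = (\<lambda>v. (cnorm (G *\<^sub>v v))\<^sup>2 / (cnorm v)\<^sup>2) ` (carrier_vec d - {0\<^sub>v d})"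
    define lm where "lm = Sup R"
    have pos: "0 < cnorm x" if "x \<in> carrier_vec d - {0\<^sub>v d}" for x
      using that cnorm_eq_0_iff[of x d] by (simp add: order_less_le)
    have bdd: "bdd_above R"
    proof (rule bdd_aboveI)
      fix y assume "y \<in> R"
      then obtain x where x: "x \<in> carrier_vec d - {0\<^sub>v d}" "y = (cnorm (G *\<^sub>v x))\<^sup>2 / (cnorm x)\<^sup>2"
        by (auto simp: R_def)
      have "(cnorm (G *\<^sub>v x))\<^sup>2 \<le> (entry_sum G * cnorm x)\<^sup>2"
        using cnorm_mult_mat_vec_le[OF G] x by (intro power_mono) auto
      then show "y \<le> (entry_sum G)\<^sup>2" using x pos[OF x(1)] by (simp add: divide_le_eq power_mult_distrib)
    qed
    have v0R: "(cnorm (G *\<^sub>v v0))\<^sup>2 / (cnorm v0)\<^sup>2 \<in> R" using v0 by (auto simp: R_def)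
    have l0: "0 \<le> lm" unfolding lm_def by (rule cSup_upper2[OF v0R _ bdd]) simp
    have ub: "(cnorm (G *\<^sub>v x))\<^sup>2 \<le> lm * (cnorm x)\<^sup>2" if x: "x \<in> carrier_vec d" for x
    proof (cases "x = 0\<^sub>v d")
      case True
      have "G *\<^sub>v 0\<^sub>v d = 0\<^sub>v r" using G by (auto intro!: eq_vecI)
      then show ?thesis using True cnorm_eq_0_iff[of "0\<^sub>v r" r] l0 by simp
    next
      case False
      then have "(cnorm (G *\<^sub>v x))\<^sup>2 / (cnorm x)\<^sup>2 \<le> lm"
        unfolding lm_def using x by (intro cSup_upper bdd) (auto simp: R_def)
      then show ?thesis using pos[of x] False x by (simp add: divide_le_eq)
    qed
    have "eigenvalue ?H (of_real lm)"
    proof (rule gram_sup_eigenvalue[OF G l0 ub])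
      fix a assume a: "\<And>v. v \<in> carrier_vec d \<Longrightarrow> (cnorm (G *\<^sub>v v))\<^sup>2 \<le> a * (cnorm v)\<^sup>2"
      show "lm \<le> a" unfolding lm_def
      proof (rule cSup_least)
        fix y assume "y \<in> R"
        then obtain x where x: "x \<in> carrier_vec d - {0\<^sub>v d}" "y = (cnorm (G *\<^sub>v x))\<^sup>2 / (cnorm x)\<^sup>2"
          by (auto simp: R_def)
        then show "y \<le> a" using a[of x] pos[OF x(1)] by (simp add: divide_le_eq)
      qed (use v0R in auto)
    qed
    then have "sqrt lm \<in> singular_values G"
      unfolding singular_values_def spectrum_def by (auto intro!: image_eqI[of _ _ "of_real lm"])
    then have "sqrt lm \<le> sigma_max G" unfolding sigma_max_def using fin by (intro Max_ge)
    have "cnorm (G *\<^sub>v v) = sqrt ((cnorm (G *\<^sub>v v))\<^sup>2)" by simp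
    also have "\<dots> \<le> sqrt (lm * (cnorm v)\<^sup>2)" using ub[OF v] by (rule real_sqrt_le_mono)
    also have "\<dots> = sqrt lm * cnorm v" by (simp add: real_sqrt_mult)
    also have "\<dots> \<le> sigma_max G * cnorm v" by (intro mult_right_mono) (use \<open>sqrt lm \<le> sigma_max G\<close> in auto)
    finally show ?thesis .
  qed
qed

subsection \<open>The \<open>H\<close>-infinity norm\<close>

definition continuous_mat :: "nat \<Rightarrow> nat \<Rightarrow> ('a :: topological_space \<Rightarrow> complex mat) \<Rightarrow> bool" where
  "continuous_mat r d X \<longleftrightarrow> (\<forall>\<omega>. X \<omega> \<in> carrier_mat r d) \<and>
     (\<forall>i<r. \<forall>j<d. continuous_on UNIV (\<lambda>\<omega>. X \<omega> $$ (i, j)))"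

lemma continuous_matD:
  assumes "continuous_mat r d X"
  shows "X \<omega> \<in> carrier_mat r d" "i < r \<Longrightarrow> j < d \<Longrightarrow> continuous_on UNIV (\<lambda>\<omega>. X \<omega> $$ (i, j))"
  using assms by (auto simp: continuous_mat_def)

lemma continuous_mat_const: "X \<in> carrier_mat r d \<Longrightarrow> continuous_mat r d (\<lambda>_. X)"
  by (simp add: continuous_mat_def)

lemma continuous_mat_add:
  assumes "continuous_mat r d X" "continuous_mat r d Y"
  shows "continuous_mat r d (\<lambda>\<omega>. X \<omega> + Y \<omega>)"
proof -
  have "(X \<omega> + Y \<omega>) $$ (i, j) = X \<omega> $$ (i, j) + Y \<omega> $$ (i, j)" if "i < r" "j < d" for i j \<omega>
    using that continuous_matD(1)[OF assms(2), of \<omega>] by simp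
  then show ?thesis
    unfolding continuous_mat_def using continuous_matD[OF assms(1)] continuous_matD[OF assms(2)]
    by (auto intro!: continuous_on_add)
qed

lemma continuous_mat_mult:
  assumes "continuous_mat r k X" "continuous_mat k d Y"
  shows "continuous_mat r d (\<lambda>\<omega>. X \<omega> * Y \<omega>)"
proof -
  have "(X \<omega> * Y \<omega>) $$ (i, j) = (\<Sum>h<k. X \<omega> $$ (i, h) * Y \<omega> $$ (h, j))" if "i < r" "j < d" for i j \<omega>
    using that continuous_matD(1)[OF assms(1), of \<omega>] continuous_matD(1)[OF assms(2), of \<omega>]
    by (auto simp: scalar_prod_def atLeast0LessThan)
  then show ?thesis
    unfolding continuous_mat_def
    using continuous_matD[OF assms(1)] continuous_matD[OF assms(2)]
    by (auto intro!: continuous_on_sum continuous_on_mult mult_carrier_mat[of _ r k _ d])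
qed

lemma continuous_on_det:
  assumes X: "continuous_mat d d X"
  shows "continuous_on UNIV (\<lambda>\<omega>. det (X \<omega>))"
proof -
  have "det (X \<omega>) = (\<Sum>p\<in>{p. p permutes {0..<d}}. signof p * (\<Prod>i = 0..<d. X \<omega> $$ (i, p i)))" for \<omega>
    by (rule det_def'[OF continuous_matD(1)[OF X]])
  then show ?thesis
    by (auto intro!: continuous_on_sum continuous_on_mult continuous_on_const continuous_on_prod
      continuous_matD(2)[OF X] dest: permutes_in_image)
qed

lemma continuous_mat_mat_delete:
  assumes X: "continuous_mat r d X"
  shows "continuous_mat (r - 1) (d - 1) (\<lambda>\<omega>. mat_delete (X \<omega>) a b)"
proof -
  have "mat_delete (X \<omega>) a b $$ (i, j) = X \<omega> $$ (if i < a then i else Suc i, if j < b then j else Suc j)"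
    if "i < r - 1" "j < d - 1" for i j \<omega>
    using that carrier_matD[OF continuous_matD(1)[OF X, of \<omega>]] by (simp add: mat_delete_def)
  moreover have "mat_delete (X \<omega>) a b \<in> carrier_mat (r - 1) (d - 1)" for \<omega>
    by (rule mat_delete_carrier[OF continuous_matD(1)[OF X]])
  ultimately show ?thesis
    unfolding continuous_mat_def by (auto intro!: continuous_matD(2)[OF X])
qed

text \<open>Cramer's rule: the entries of the inverse become polynomials in the entries divided by
  the determinant, which makes their continuity evident.\<close>

lemma matinv_eq_adj_mat:
  assumes X: "(X :: 'a :: field mat) \<in> carrier_mat d d" and det: "det X \<noteq> 0"
  shows "matinv X = (1 / det X) \<cdot>\<^sub>m adj_mat X"
    and "matinv X \<in> carrier_mat d d" "matinv X * X = 1\<^sub>m d" "X * matinv X = 1\<^sub>m d"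
proof -
  obtain Q where Q: "Q \<in> carrier_mat d d" "mat_inverse X = Some Q" "Q * X = 1\<^sub>m d" "X * Q = 1\<^sub>m d"
    using left_inverse_exists[OF X det] by blast
  then show "matinv X \<in> carrier_mat d d" "matinv X * X = 1\<^sub>m d" "X * matinv X = 1\<^sub>m d" by simp_all
  have a: "adj_mat X \<in> carrier_mat d d" using adj_mat(1)[OF X] .
  have "X * ((1 / det X) \<cdot>\<^sub>m adj_mat X) = (1 / det X) \<cdot>\<^sub>m (X * adj_mat X)"
    by (rule mult_smult_distrib[OF X a])
  also have "\<dots> = 1\<^sub>m d"
    unfolding adj_mat(2)[OF X] using det by (auto intro!: eq_matI)
  finally have 1: "X * ((1 / det X) \<cdot>\<^sub>m adj_mat X) = 1\<^sub>m d" .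
  have "Q = Q * (X * ((1 / det X) \<cdot>\<^sub>m adj_mat X))" using Q 1 by simp
  also have "\<dots> = Q * X * ((1 / det X) \<cdot>\<^sub>m adj_mat X)"
    by (rule assoc_mult_mat[symmetric]) (use Q X a in auto)
  also have "\<dots> = (1 / det X) \<cdot>\<^sub>m adj_mat X" using Q a by simp
  finally show "matinv X = (1 / det X) \<cdot>\<^sub>m adj_mat X" using Q by simp
qed

lemma continuous_mat_matinv:
  assumes X: "continuous_mat d d X" and det: "\<And>\<omega>. det (X \<omega>) \<noteq> 0"
  shows "continuous_mat d d (\<lambda>\<omega>. matinv (X \<omega>))"
  unfolding continuous_mat_def
proof (intro conjI allI impI)
  show "matinv (X \<omega>) \<in> carrier_mat d d" for \<omega>
    by (rule matinv_eq_adj_mat(2)[OF continuous_matD(1)[OF X] det])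
  fix i j assume ij: "i < d" "j < d"
  have "matinv (X \<omega>) $$ (i, j) = (1 / det (X \<omega>)) * ((- 1) ^ (j + i) * det (mat_delete (X \<omega>) j i))" for \<omega>
    using matinv_eq_adj_mat(1)[OF continuous_matD(1)[OF X] det, of \<omega>]
      carrier_matD[OF continuous_matD(1)[OF X, of \<omega>]] ij
    by (simp add: adj_mat_def cofactor_def)
  then show "continuous_on UNIV (\<lambda>\<omega>. matinv (X \<omega>) $$ (i, j))"
    using det by (auto intro!: continuous_on_mult continuous_on_divide continuous_on_const continuous_on_det[OF X]
      continuous_on_det[OF continuous_mat_mat_delete[OF X]])
qed

lemma continuous_on_cnorm_mult:
  assumes X: "continuous_mat r d X" and v: "v \<in> carrier_vec d"
  shows "continuous_on UNIV (\<lambda>\<omega>. cnorm (X \<omega> *\<^sub>v v))"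
proof -
  have "cnorm (X \<omega> *\<^sub>v v) = sqrt (\<Sum>i<r. (cmod (\<Sum>j<d. X \<omega> $$ (i, j) * v $ j))\<^sup>2)" for \<omega>
    using carrier_matD[OF continuous_matD(1)[OF X, of \<omega>]] carrier_vecD[OF v]
    by (auto simp: cnorm_def L2_set_def scalar_prod_def atLeast0LessThan intro!: sum.cong arg_cong[where f=sqrt])
  then show ?thesis
    by (auto intro!: continuous_on_real_sqrt continuous_on_sum continuous_on_power continuous_on_norm
        continuous_on_mult continuous_on_const continuous_matD(2)[OF X])
qed

lemma continuous_on_entry_sum:
  assumes X: "continuous_mat r d X"
  shows "continuous_on UNIV (\<lambda>\<omega>. entry_sum (X \<omega>))"
  unfolding entry_sum_def carrier_matD[OF continuous_matD(1)[OF X]]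
  by (auto intro!: continuous_on_sum continuous_on_norm continuous_matD(2)[OF X])

text \<open>A sublevel set of \<^const>\<open>sigma_max\<close> is an intersection of closed sets, one for each vector.\<close>
lemma borel_measurable_sigma_max:
  assumes X: "continuous_mat r d X" and d: "1 \<le> d"
  shows "(\<lambda>\<omega>. sigma_max (X \<omega>)) \<in> borel_measurable borel"
proof (rule borel_measurableI_le)
  fix a :: real
  have "closed {\<omega>. sigma_max (X \<omega>) \<le> a}"
  proof (cases "0 \<le> a")
    case True
    have "{\<omega>. sigma_max (X \<omega>) \<le> a} = (\<Inter>v\<in>carrier_vec d. {\<omega>. cnorm (X \<omega> *\<^sub>v v) \<le> a * cnorm v})"
    proof (intro equalityI subsetI INT_I CollectI; clarsimp)
      fix \<omega> and v :: "complex vec" assume le: "sigma_max (X \<omega>) \<le> a" and v: "v \<in> carrier_vec d"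
      show "cnorm (X \<omega> *\<^sub>v v) \<le> a * cnorm v"
        using cnorm_mult_le_sigma_max[OF continuous_matD(1)[OF X] d v] mult_right_mono[OF le cnorm_nonneg]
        by (rule order_trans)
    next
      fix \<omega> assume "\<forall>v\<in>carrier_vec d. cnorm (X \<omega> *\<^sub>v v) \<le> a * cnorm v"
      then show "sigma_max (X \<omega>) \<le> a"
        by (intro sigma_max_least[OF continuous_matD(1)[OF X] d True]) auto
    qed
    also have "closed \<dots>"
      by (intro closed_INT ballI closed_Collect_le continuous_on_cnorm_mult[OF X] continuous_on_const)
    finally show ?thesis .
  next
    case False
    then have "{\<omega>. sigma_max (X \<omega>) \<le> a} = {}"
      using sigma_max_nonneg[OF continuous_matD(1)[OF X] d] by (auto dest: order_trans)
    then show ?thesis by simp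
  qed
  then show "{\<omega> \<in> space borel. sigma_max (X \<omega>) \<le> a} \<in> sets borel" by simp
qed

text \<open>Continuity bounds \<open>sigma_max\<close> over the circle by a real \<open>K\<close>,
  so the essential supremum is finite and \<open>real_of_ereal\<close> loses nothing; at infinity it
  would return 0 and bound nothing. The supremum cannot be negative, since the frequency interval
  has positive length.\<close>

lemma
  assumes G: "continuous_mat r d (\<lambda>\<omega>. G (cis \<omega>))" and d: "1 \<le> d"
  shows hinf_norm_nonneg: "0 \<le> hinf_norm G"
    and AE_cnorm_le_hinf_norm: "AE \<omega> in lborel. \<omega> \<in> {-pi..<pi} \<longrightarrow>
      (\<forall>v \<in> carrier_vec d. cnorm (G (cis \<omega>) *\<^sub>v v) \<le> hinf_norm G * cnorm v)"
proof -
  let ?M = "restrict_space lborel {-pi..<pi} :: real measure"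
  let ?s = "\<lambda>\<omega>. sigma_max (G (cis \<omega>))"
  have meas: "(\<lambda>\<omega>. ereal (?s \<omega>)) \<in> borel_measurable ?M"
    using borel_measurable_sigma_max[OF G d] by (intro measurable_restrict_space1) simp
  have "compact ((\<lambda>\<omega>. entry_sum (G (cis \<omega>))) ` {-pi..pi})"
    by (intro compact_continuous_image continuous_on_subset[OF continuous_on_entry_sum[OF G]]) auto
  then have "bdd_above ((\<lambda>\<omega>. entry_sum (G (cis \<omega>))) ` {-pi..pi})"
    by (intro bounded_imp_bdd_above compact_imp_bounded)
  then obtain K where K: "\<And>\<omega>. \<omega> \<in> {-pi..pi} \<Longrightarrow> entry_sum (G (cis \<omega>)) \<le> K"
    unfolding bdd_above_def by (meson imageI)
  have "?s \<omega> \<le> K" if "\<omega> \<in> {-pi..pi}" for \<omega>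
  proof -
    have "?s \<omega> \<le> entry_sum (G (cis \<omega>))"
      by (intro sigma_max_least[OF continuous_matD(1)[OF G] d]
          cnorm_mult_mat_vec_le[OF continuous_matD(1)[OF G]]) auto
    with K[OF that] show ?thesis by simp
  qed
  then have top: "esssup ?M (\<lambda>\<omega>. ereal (?s \<omega>)) \<le> ereal K"
    by (intro esssup_I meas AE_I2) (auto simp: space_restrict_space)
  have "AE \<omega> in ?M. ereal (?s \<omega>) \<le> esssup ?M (\<lambda>\<omega>. ereal (?s \<omega>))" by (rule esssup_AE)
  then have AE: "AE \<omega> in ?M. ?s \<omega> \<le> hinf_norm G"
    unfolding hinf_norm_def
    using top by (auto elim!: eventually_mono) (cases "esssup ?M (\<lambda>\<omega>. ereal (?s \<omega>))"; auto)
  show "0 \<le> hinf_norm G"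
  proof (rule ccontr)
    assume "\<not> 0 \<le> hinf_norm G"
    then have "AE \<omega> in ?M. False"
      using AE sigma_max_nonneg[OF continuous_matD(1)[OF G] d] by (auto elim!: eventually_mono dest: order_trans)
    then have "emeasure ?M (space ?M) = 0" by (simp add: AE_iff_null_sets null_sets_def eventually_False trivial_limit_def[symmetric] ae_filter_eq_bot_iff)
    moreover have "emeasure ?M (space ?M) = ennreal (2 * pi)"
      by (simp add: emeasure_restrict_space space_restrict_space)
    ultimately show False by simp
  qed
  have "AE \<omega> in lborel. \<omega> \<in> {-pi..<pi} \<longrightarrow> ?s \<omega> \<le> hinf_norm G"
    using AE by (simp add: AE_restrict_space_iff)
  then show "AE \<omega> in lborel. \<omega> \<in> {-pi..<pi} \<longrightarrow>
      (\<forall>v \<in> carrier_vec d. cnorm (G (cis \<omega>) *\<^sub>v v) \<le> hinf_norm G * cnorm v)"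
  proof (rule AE_mp, intro AE_I2 impI ballI)
    fix \<omega> and v :: "complex vec"
    assume *: "\<omega> \<in> {-pi..<pi} \<longrightarrow> ?s \<omega> \<le> hinf_norm G" "\<omega> \<in> {-pi..<pi}" and v: "v \<in> carrier_vec d"
    then show "cnorm (G (cis \<omega>) *\<^sub>v v) \<le> hinf_norm G * cnorm v"
      by (intro order_trans[OF cnorm_mult_le_sigma_max[OF continuous_matD(1)[OF G] d v]] mult_right_mono) auto
  qed
qed

text \<open>Rescaling \<open>X\<close> by a number strictly between its spectral radius and 1 gives power-bounded iterates.\<close>
lemma stable_power_tendsto_0:
  assumes X: "X \<in> carrier_mat m m" and m: "1 \<le> m" and st: "\<And>z. eigenvalue X z \<Longrightarrow> cmod z < 1"
    and v: "v \<in> carrier_vec m"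
  shows "(\<lambda>k. cnorm (X ^\<^sub>m k *\<^sub>v v)) \<longlonglongrightarrow> 0"
proof -
  have fin: "finite (spectrum X)" using card_finite_spectrum(1)[OF X] .
  have ne: "spectrum X \<noteq> {}" using spectrum_non_empty[OF X] m by simp
  define b where "b = Max (cmod ` spectrum X)"
  have "b < 1" unfolding b_def using fin ne st by (subst Max_less_iff) (auto simp: spectrum_def)
  have b: "cmod z \<le> b" if "eigenvalue X z" for z
    unfolding b_def using fin that by (intro Max_ge) (auto simp: spectrum_def)
  obtain z0 where "eigenvalue X z0" using ne by (auto simp: spectrum_def)
  then have "0 \<le> b" using b[of z0] norm_ge_zero[of z0] by linarith
  \<comment> \<open>The midpoint of \<open>b\<close> and 1 is positive even for a nilpotent matrix,
    where \<open>b\<close> is 0, so that \<open>X\<close> may be divided by it.\<close>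
  define a where "a = (b + 1) / 2"
  have a: "0 < a" "b < a" "a < 1" using \<open>b < 1\<close> \<open>0 \<le> b\<close> by (auto simp: a_def)
  let ?Y = "complex_of_real (1 / a) \<cdot>\<^sub>m X"
  have Y: "?Y \<in> carrier_mat m m" using X by simp
  have "spectral_radius ?Y < 1"
  proof -
    have "spectral_radius ?Y \<in> norm ` spectrum ?Y" using spectral_radius_mem_max(1)[OF Y] m by simp
    then obtain e where e: "eigenvalue ?Y e" "spectral_radius ?Y = cmod e" by (auto simp: spectrum_def)
    obtain x where x: "x \<in> carrier_vec m" "x \<noteq> 0\<^sub>v m" "?Y *\<^sub>v x = e \<cdot>\<^sub>v x"
      using e(1) X unfolding eigenvalue_def eigenvector_def by auto
    have "?Y *\<^sub>v x = complex_of_real (1 / a) \<cdot>\<^sub>v (X *\<^sub>v x)"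
      using X x by (intro smult_mat_mult_vec)
    then have "complex_of_real a \<cdot>\<^sub>v (complex_of_real (1 / a) \<cdot>\<^sub>v (X *\<^sub>v x)) = complex_of_real a \<cdot>\<^sub>v (e \<cdot>\<^sub>v x)"
      using x(3) by simp
    then have "X *\<^sub>v x = (of_real a * e) \<cdot>\<^sub>v x"
      using a by (simp add: smult_smult_assoc of_real_mult[symmetric] del: of_real_mult)
    then have "eigenvalue X (of_real a * e)"
      using x X unfolding eigenvalue_def eigenvector_def by auto
    from b[OF this] a have "a * cmod e \<le> b" by (simp add: norm_mult)
    with a have "a * cmod e < a * 1" by linarith
    then have "cmod e < 1" using a(1) by (simp only: mult_less_cancel_left_pos)
    then show ?thesis using e(2) by simp
  qed
  from spectral_radius_jnf_norm_bound_less_1_upper_triangular[OF Y this]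
  obtain c where c: "\<And>k. norm_bound (?Y ^\<^sub>m k) c" by blast
  have pw: "?Y ^\<^sub>m k = complex_of_real (1 / a) ^ k \<cdot>\<^sub>m (X ^\<^sub>m k)" for k
    using X by (rule smult_pow_mat)
  \<comment> \<open>Undoing the rescaling turns the uniform bound on the powers of \<open>?Y\<close>
    into geometric decay with ratio \<open>a\<close>.\<close>
  have entry: "cmod ((X ^\<^sub>m k) $$ (i, j)) \<le> c * a ^ k" if "i < m" "j < m" for i j k
  proof -
    have Xk: "X ^\<^sub>m k \<in> carrier_mat m m" using X by simp
    have "cmod ((?Y ^\<^sub>m k) $$ (i, j)) \<le> c"
      using c[of k, unfolded norm_bound_def carrier_matD[OF pow_carrier_mat[OF Y, of k]], rule_format, OF that] .
    moreover have "(?Y ^\<^sub>m k) $$ (i, j) = complex_of_real (1 / a) ^ k * (X ^\<^sub>m k) $$ (i, j)"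
      unfolding pw by (rule index_smult_mat(1)) (use carrier_matD[OF Xk] that in auto)
    moreover have "cmod (complex_of_real (1 / a) ^ k) = 1 / a ^ k"
      using a(1) unfolding norm_power norm_of_real by (simp add: power_divide)
    ultimately have "cmod ((X ^\<^sub>m k) $$ (i, j)) / a ^ k \<le> c"
      by (simp only: norm_mult) simp
    then show ?thesis using a by (simp add: divide_le_eq)
  qed
  have "cnorm (X ^\<^sub>m k *\<^sub>v v) \<le> real m * real m * c * cnorm v * a ^ k" for k
  proof -
    have Xk: "X ^\<^sub>m k \<in> carrier_mat m m" using X by simp
    have "entry_sum (X ^\<^sub>m k) \<le> (\<Sum>i<m. \<Sum>j<m. c * a ^ k)"
      unfolding entry_sum_def carrier_matD[OF Xk] by (intro sum_mono entry) auto
    also have "\<dots> = real m * real m * c * a ^ k" by simp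
    finally have "entry_sum (X ^\<^sub>m k) * cnorm v \<le> (real m * real m * c * a ^ k) * cnorm v"
      by (intro mult_right_mono) auto
    with cnorm_mult_mat_vec_le[OF Xk v] show ?thesis by (simp add: mult_ac)
  qed
  note bound = this
  have lim: "(\<lambda>k. real m * real m * c * cnorm v * a ^ k) \<longlonglongrightarrow> 0"
    by (rule tendsto_mult_right_zero[OF LIMSEQ_realpow_zero]) (use a in auto)
  show ?thesis
    by (rule tendsto_sandwich[OF _ _ tendsto_const lim]; intro always_eventually allI bound cnorm_nonneg)
qed

subsection \<open>The energy gain of a stable system\<close>

lemma has_integral_cis_int:
  "((\<lambda>\<omega>. cis (of_int k * \<omega>)) has_integral (if k = 0 then of_real (2 * pi) else 0)) {-pi..pi}"
proof (cases "k = 0")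
  case True
  have "((\<lambda>\<omega>. 1 :: complex) has_integral (2 * pi) *\<^sub>R 1) {-pi..pi}"
    using has_integral_const_real[of "1 :: complex" "-pi" pi] by simp
  then show ?thesis using True by (simp add: scaleR_conv_of_real)
next
  case False
  let ?F = "\<lambda>\<omega>. cis (of_int k * \<omega>) / (\<i> * of_int k)"
  have "((\<lambda>\<omega>. cis (of_int k * \<omega>)) has_integral ?F pi - ?F (- pi)) {-pi..pi}"
  proof (rule fundamental_theorem_of_calculus)
    fix x
    have "((\<lambda>x. exp (\<i> * of_real (of_int k * x))) has_vector_derivative (\<i> * of_int k) * exp (\<i> * of_real (of_int k * x))) (at x within {-pi..pi})"
      by (auto intro!: derivative_eq_intros has_vector_derivative_real_field simp: mult_ac)
    from has_vector_derivative_divide[OF this, of "\<i> * of_int k"]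
    show "(?F has_vector_derivative cis (of_int k * x)) (at x within {-pi..pi})"
      using False by (simp add: cis_conv_exp)
  qed simp
  moreover have "cis (of_int k * pi) = cis (of_int k * - pi)"
    by (simp add: complex_eq_iff)
      (metis add.inverse_inverse equation_minus_iff sin_int_times_real mult.commute sin_npi_int)
  ultimately show ?thesis using False by simp
qed

text \<open>Expanding the square gives a double sum of exponentials with integer frequencies, and
  integration keeps the diagonal only. The expansion lives in the complex numbers, so the real part
  is taken at the end.\<close>

lemma parseval_trig_poly:
  "((\<lambda>\<omega>. (cmod (\<Sum>t<n. c t * cis (- (real t * \<omega>))))\<^sup>2) has_integral 2 * pi * (\<Sum>t<n. (cmod (c t))\<^sup>2)) {-pi..pi}"
proof -
  let ?f = "\<lambda>\<omega>. (cmod (\<Sum>t<n. c t * cis (- (real t * \<omega>))))\<^sup>2"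
  have eq: "complex_of_real (?f \<omega>) = (\<Sum>s<n. \<Sum>t<n. (c s * cnj (c t)) * cis (of_int (int t - int s) * \<omega>))" for \<omega>
  proof -
    have "complex_of_real (?f \<omega>) = (\<Sum>s<n. c s * cis (- (real s * \<omega>))) * (\<Sum>t<n. cnj (c t) * cis (real t * \<omega>))"
      unfolding complex_norm_square by (simp add: cis_cnj)
    also have "\<dots> = (\<Sum>s<n. \<Sum>t<n. (c s * cis (- (real s * \<omega>))) * (cnj (c t) * cis (real t * \<omega>)))"
      by (rule sum_product)
    also have "\<dots> = (\<Sum>s<n. \<Sum>t<n. (c s * cnj (c t)) * cis (of_int (int t - int s) * \<omega>))"
    proof (intro sum.cong refl)
      fix s t
      have "cis (- (real s * \<omega>)) * cis (real t * \<omega>) = cis (of_int (int t - int s) * \<omega>)"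
        by (simp add: cis_mult algebra_simps)
      then show "(c s * cis (- (real s * \<omega>))) * (cnj (c t) * cis (real t * \<omega>)) =
          (c s * cnj (c t)) * cis (of_int (int t - int s) * \<omega>)"
        by (metis mult.assoc mult.left_commute)
    qed
    finally show ?thesis .
  qed
  have "((\<lambda>\<omega>. complex_of_real (?f \<omega>)) has_integral
      (\<Sum>s<n. \<Sum>t<n. (c s * cnj (c t)) * (if int t - int s = 0 then of_real (2 * pi) else 0))) {-pi..pi}"
    unfolding eq by (intro has_integral_sum has_integral_mult_right has_integral_cis_int) auto
  also have "(\<Sum>s<n. \<Sum>t<n. (c s * cnj (c t)) * (if int t - int s = 0 then of_real (2 * pi) else 0)) =
      (\<Sum>s<n. \<Sum>t<n. if s = t then (c s * cnj (c t)) * of_real (2 * pi) else 0)"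
    by (intro sum.cong) auto
  also have "\<dots> = complex_of_real (2 * pi * (\<Sum>t<n. (cmod (c t))\<^sup>2))"
    by (simp add: sum.delta' sum_distrib_left mult.commute complex_norm_square[symmetric] del: of_real_power)
  finally have "((\<lambda>\<omega>. complex_of_real (?f \<omega>)) has_integral complex_of_real (2 * pi * (\<Sum>t<n. (cmod (c t))\<^sup>2))) {-pi..pi}" .
  from has_integral_linear[OF this bounded_linear_Re] show ?thesis by (simp only: o_def Re_complex_of_real)
qed

section \<open>Transforms of truncated signals\<close>

abbreviation cvec :: "real vec \<Rightarrow> complex vec" where
  "cvec v \<equiv> map_vec complex_of_real v"

lemma cnorm_cvec_sq: "(cnorm (cvec v))\<^sup>2 = scalar_prod v v"
  unfolding cnorm_sq scalar_prod_def atLeast0LessThan by (simp add: power2_eq_square)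

lemma cmat_mult_cvec:
  assumes "X \<in> carrier_mat r d" "v \<in> carrier_vec d"
  shows "cmat X *\<^sub>v cvec v = cvec (X *\<^sub>v v)"
  using assms by (intro eq_vecI) (auto simp: scalar_prod_def)

text \<open>The exponent is negative as in the z-transform at \<open>z = cis \<omega>\<close>, so
  that advancing a signal by one step multiplies by \<open>z\<close> and a state recursion leads to
  the resolvent of its matrix at \<open>z\<close>.\<close>

definition dtft :: "nat \<Rightarrow> nat \<Rightarrow> (nat \<Rightarrow> real vec) \<Rightarrow> real \<Rightarrow> complex vec" where
  "dtft d n u \<omega> = vec d (\<lambda>i. \<Sum>t<n. of_real (u t $ i) * cis (- (real t * \<omega>)))"

lemma dtft_carrier [simp]: "dtft d n u \<omega> \<in> carrier_vec d"
  by (simp add: dtft_def)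

lemma dim_dtft [simp]: "dim_vec (dtft d n u \<omega>) = d"
  by (simp add: dtft_def)

lemma dtft_mult:
  assumes X: "X \<in> carrier_mat r d" and u: "\<And>t. u t \<in> carrier_vec d"
  shows "cmat X *\<^sub>v dtft d n u \<omega> = dtft r n (\<lambda>t. X *\<^sub>v u t) \<omega>"
proof (rule eq_vecI)
  fix i assume "i < dim_vec (dtft r n (\<lambda>t. X *\<^sub>v u t) \<omega>)"
  then have i: "i < r" by (simp add: dtft_def)
  have "(cmat X *\<^sub>v dtft d n u \<omega>) $ i = (\<Sum>j<d. \<Sum>t<n. of_real (X $$ (i, j)) * (of_real (u t $ j) * cis (- (real t * \<omega>))))"
    using X i by (auto simp: scalar_prod_def dtft_def atLeast0LessThan sum_distrib_left)
  also have "\<dots> = (\<Sum>t<n. \<Sum>j<d. of_real (X $$ (i, j)) * (of_real (u t $ j) * cis (- (real t * \<omega>))))"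
    by (rule sum.swap)
  also have "\<dots> = dtft r n (\<lambda>t. X *\<^sub>v u t) \<omega> $ i"
    using X i carrier_vecD[OF u]
    by (auto simp: scalar_prod_def dtft_def atLeast0LessThan sum_distrib_right mult.assoc intro!: sum.cong)
  finally show "(cmat X *\<^sub>v dtft d n u \<omega>) $ i = dtft r n (\<lambda>t. X *\<^sub>v u t) \<omega> $ i" .
qed (use X in \<open>auto simp: dtft_def\<close>)

lemma dtft_add:
  assumes "\<And>t. u t \<in> carrier_vec d" "\<And>t. v t \<in> carrier_vec d"
  shows "dtft d n (\<lambda>t. u t + v t) \<omega> = dtft d n u \<omega> + dtft d n v \<omega>"
  using carrier_vecD[OF assms(1)] carrier_vecD[OF assms(2)]
  by (intro eq_vecI) (auto simp: dtft_def sum.distrib distrib_right)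

text \<open>Reindexing the sum costs a factor \<open>cis \<omega>\<close>; the summand lost at time
  0 vanishes with \<open>x 0\<close>, and the summand gained at time \<open>n\<close> is the
  boundary term.\<close>

lemma dtft_shift:
  assumes x: "\<And>t. x t \<in> carrier_vec d" and x0: "x 0 = 0\<^sub>v d"
  shows "dtft d n (\<lambda>t. x (Suc t)) \<omega> = cis \<omega> \<cdot>\<^sub>v dtft d n x \<omega> + (cis \<omega> * cis (- (real n * \<omega>))) \<cdot>\<^sub>v cvec (x n)"
proof (rule eq_vecI)
  fix i assume "i < dim_vec (cis \<omega> \<cdot>\<^sub>v dtft d n x \<omega> + (cis \<omega> * cis (- (real n * \<omega>))) \<cdot>\<^sub>v cvec (x n))"
  then have i: "i < d" using x[of n] by simp
  have step: "cis (- (real t * \<omega>)) = cis \<omega> * cis (- (real (Suc t) * \<omega>))" for t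
    by (simp add: cis_mult algebra_simps)
  let ?g = "\<lambda>t. of_real (x t $ i) * cis (- (real t * \<omega>))"
  have "(\<Sum>t<n. of_real (x (Suc t) $ i) * cis (- (real t * \<omega>))) = cis \<omega> * (\<Sum>t<n. ?g (Suc t))"
    unfolding sum_distrib_left
  proof (rule sum.cong[OF refl])
    show "of_real (x (Suc t) $ i) * cis (- (real t * \<omega>)) = cis \<omega> * ?g (Suc t)" for t
      by (subst step[of t]) (simp only: mult_ac)
  qed
  also have "(\<Sum>t<n. ?g (Suc t)) = (\<Sum>t<n. ?g t) + ?g n"
    using sum.lessThan_Suc_shift[of ?g n] x0 i by simp
  finally show "dtft d n (\<lambda>t. x (Suc t)) \<omega> $ i =
      (cis \<omega> \<cdot>\<^sub>v dtft d n x \<omega> + (cis \<omega> * cis (- (real n * \<omega>))) \<cdot>\<^sub>v cvec (x n)) $ i"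
    using i carrier_vecD[OF x, of n] by (simp add: dtft_def algebra_simps)
qed (use carrier_vecD[OF x] in \<open>simp add: dtft_def\<close>)

lemma continuous_on_dtft_sq: "continuous_on UNIV (\<lambda>\<omega>. (cnorm (dtft d n u \<omega>))\<^sup>2)"
  by (simp add: cnorm_sq dtft_def) (intro continuous_intros)

lemma parseval_dtft:
  assumes u: "\<And>t. u t \<in> carrier_vec d"
  shows "(LINT \<omega>:{-pi..pi}|lborel. (cnorm (dtft d n u \<omega>))\<^sup>2) = 2 * pi * (\<Sum>t<n. scalar_prod (u t) (u t))"
proof -
  have "((\<lambda>\<omega>. (cnorm (dtft d n u \<omega>))\<^sup>2) has_integral
      (\<Sum>i<d. 2 * pi * (\<Sum>t<n. (cmod (of_real (u t $ i)))\<^sup>2))) {-pi..pi}"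
  proof -
    have "(cnorm (dtft d n u \<omega>))\<^sup>2 = (\<Sum>i<d. (cmod (\<Sum>t<n. of_real (u t $ i) * cis (- (real t * \<omega>))))\<^sup>2)" for \<omega>
      by (simp add: cnorm_sq dtft_def)
    then show ?thesis by (simp only:) (intro has_integral_sum parseval_trig_poly finite_lessThan)
  qed
  also have "(\<Sum>i<d. 2 * pi * (\<Sum>t<n. (cmod (of_real (u t $ i)))\<^sup>2)) = 2 * pi * (\<Sum>i<d. \<Sum>t<n. u t $ i * u t $ i)"
    by (simp add: sum_distrib_left power2_eq_square)
  also have "(\<Sum>i<d. \<Sum>t<n. u t $ i * u t $ i) = (\<Sum>t<n. \<Sum>i<d. u t $ i * u t $ i)" by (rule sum.swap)
  also have "\<dots> = (\<Sum>t<n. scalar_prod (u t) (u t))"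
    using carrier_vecD[OF u] by (simp add: scalar_prod_def atLeast0LessThan)
  finally have "((\<lambda>\<omega>. (cnorm (dtft d n u \<omega>))\<^sup>2) has_integral 2 * pi * (\<Sum>t<n. scalar_prod (u t) (u t))) {-pi..pi}" .
  moreover have "set_integrable lborel {-pi..pi} (\<lambda>\<omega>. (cnorm (dtft d n u \<omega>))\<^sup>2)"
    by (intro borel_integrable_atLeastAtMost' continuous_on_subset[OF continuous_on_dtft_sq]) auto
  ultimately show ?thesis
    by (simp add: set_borel_integral_eq_integral(2) integral_unique)
qed

text \<open>The right-hand side is independent of \<omega>, so it may replace the transform in a
  cross term before integrating.\<close>

lemma cnorm_dtft_le: "cnorm (dtft d n u \<omega>) \<le> (\<Sum>i<d. \<Sum>t<n. \<bar>u t $ i\<bar>)"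
proof -
  have "cnorm (dtft d n u \<omega>) \<le> (\<Sum>i<d. cmod (dtft d n u \<omega> $ i))"
    unfolding cnorm_def by (auto simp: dtft_def intro!: order_trans[OF L2_set_le_sum])
  also have "\<dots> \<le> (\<Sum>i<d. \<Sum>t<n. \<bar>u t $ i\<bar>)"
    by (intro sum_mono) (auto simp: dtft_def norm_mult intro!: order_trans[OF norm_sum])
  finally show ?thesis .
qed

lemma vec_eq_add_swap:
  fixes a b c :: "'a :: ab_semigroup_add vec"
  assumes "a \<in> carrier_vec n" "b \<in> carrier_vec n" "c \<in> carrier_vec n"
  shows "a + b + c = (a + c) + b"
  using assms by (intro eq_vecI) (auto simp: ac_simps)

lemma pow_mat_Suc_left:
  fixes X :: "'a :: semiring_1 mat"
  assumes X: "X \<in> carrier_mat n n"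
  shows "X ^\<^sub>m Suc k = X * X ^\<^sub>m k"
proof (induction k)
  case (Suc k)
  have "X ^\<^sub>m Suc (Suc k) = X * X ^\<^sub>m k * X" using Suc by simp
  also have "\<dots> = X * (X ^\<^sub>m k * X)" by (rule assoc_mult_mat[OF X pow_carrier_mat[OF X] X])
  finally show ?case by simp
qed (use X in simp)

section \<open>Stable systems in state-space form, started at rest\<close>

primrec ss_state :: "real mat \<Rightarrow> real mat \<Rightarrow> (nat \<Rightarrow> real vec) \<Rightarrow> nat \<Rightarrow> real vec" where
  "ss_state F B u 0 = 0\<^sub>v (dim_row F)"
| "ss_state F B u (Suc t) = F *\<^sub>v ss_state F B u t + B *\<^sub>v u t"

definition ss_output :: "real mat \<Rightarrow> real mat \<Rightarrow> real mat \<Rightarrow> real mat \<Rightarrow> (nat \<Rightarrow> real vec) \<Rightarrow> nat \<Rightarrow> real vec" where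
  "ss_output F B H E u t = H *\<^sub>v ss_state F B u t + E *\<^sub>v u t"

definition ss_tf :: "real mat \<Rightarrow> real mat \<Rightarrow> real mat \<Rightarrow> real mat \<Rightarrow> complex \<Rightarrow> complex mat" where
  "ss_tf F B H E z = cmat H * matinv (z \<cdot>\<^sub>m 1\<^sub>m (dim_row F) - cmat F) * cmat B + cmat E"

locale stable_system =
  fixes m d l :: nat and F B H E :: "real mat"
  assumes m: "1 \<le> m" and d: "1 \<le> d"
    and F: "F \<in> carrier_mat m m" and B: "B \<in> carrier_mat m d"
    and H: "H \<in> carrier_mat l m" and E: "E \<in> carrier_mat l d"
    and stable: "schur_stable F"
begin

lemma ss_state_carrier:
  assumes "\<And>t. u t \<in> carrier_vec d"
  shows "ss_state F B u t \<in> carrier_vec m"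
  by (induction t) (use assms F B in auto)

lemma ss_state_cong: "(\<And>s. s < t \<Longrightarrow> u s = v s) \<Longrightarrow> ss_state F B u t = ss_state F B v t"
  by (induction t) auto

abbreviation "pencil z \<equiv> z \<cdot>\<^sub>m 1\<^sub>m m - cmat F"

lemma pencil_carrier [simp]: "pencil z \<in> carrier_mat m m"
  using F by auto

text \<open>A vector in the kernel of the pencil is an eigenvector of \<open>F\<close> for
  \<open>z\<close>, and stability leaves no eigenvalue on the circle.\<close>

lemma det_pencil: "cmod z = 1 \<Longrightarrow> det (pencil z) \<noteq> 0"
proof
  assume z: "cmod z = 1" and "det (pencil z) = 0"
  then obtain v where v: "v \<in> carrier_vec m" "v \<noteq> 0\<^sub>v m" "pencil z *\<^sub>v v = 0\<^sub>v m"
    using det_0_iff_vec_prod_zero[OF pencil_carrier[of z]] by auto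
  have cF: "cmat F \<in> carrier_mat m m" using F by simp
  have "pencil z *\<^sub>v v = (z \<cdot>\<^sub>m 1\<^sub>m m) *\<^sub>v v - cmat F *\<^sub>v v"
    using v cF by (intro minus_mult_distrib_mat_vec) auto
  also have "(z \<cdot>\<^sub>m 1\<^sub>m m) *\<^sub>v v = z \<cdot>\<^sub>v v"
    using v by (subst smult_mat_mult_vec[of _ m m]) auto
  finally have eq: "z \<cdot>\<^sub>v v - cmat F *\<^sub>v v = 0\<^sub>v m" using v by simp
  have "cmat F *\<^sub>v v = z \<cdot>\<^sub>v v"
  proof (rule eq_vecI)
    fix i assume "i < dim_vec (z \<cdot>\<^sub>v v)"
    then have i: "i < m" using v by simp
    have "(z \<cdot>\<^sub>v v - cmat F *\<^sub>v v) $ i = 0" using eq i by simp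
    then show "(cmat F *\<^sub>v v) $ i = (z \<cdot>\<^sub>v v) $ i" using i v F by simp
  qed (use v F in simp)
  then have "eigenvalue (cmat F) z" using v F unfolding eigenvalue_def eigenvector_def by auto
  then show False using stable z by (auto simp: schur_stable_def)
qed

lemma resolvent_carrier: "cmod z = 1 \<Longrightarrow> matinv (pencil z) \<in> carrier_mat m m"
  by (rule matinv_eq_adj_mat(2)[OF pencil_carrier det_pencil])

lemma continuous_resolvent: "continuous_mat m m (\<lambda>\<omega>. matinv (pencil (cis \<omega>)))"
proof (rule continuous_mat_matinv)
  have "pencil (cis \<omega>) $$ (i, j) = cis \<omega> * (if i = j then 1 else 0) - of_real (F $$ (i, j))"
    if "i < m" "j < m" for i j \<omega>
    using that F by simp
  then show "continuous_mat m m (\<lambda>\<omega>. pencil (cis \<omega>))"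
    unfolding continuous_mat_def by (auto intro!: continuous_intros)
qed (simp add: det_pencil)

lemma continuous_ss_tf: "continuous_mat l d (\<lambda>\<omega>. ss_tf F B H E (cis \<omega>))"
  unfolding ss_tf_def carrier_matD(1)[OF F] using B H E
  by (intro continuous_mat_add continuous_mat_mult[of l m] continuous_mat_mult[of l m _ m]
      continuous_resolvent continuous_mat_const) auto

text \<open>The transformed recursion is solved for the transformed state by the resolvent. The
  state at time \<open>n\<close> survives as an error term whose scalar factor \<open>c\<close>
  varies with \<omega> but has modulus 1, which is all that norm estimates see.\<close>

lemma dtft_ss_output:
  assumes u: "\<And>t. u t \<in> carrier_vec d"
  shows "\<exists>c. cmod c = 1 \<and> dtft l n (ss_output F B H E u) \<omega> = ss_tf F B H E (cis \<omega>) *\<^sub>v dtft d n u \<omega>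
    + c \<cdot>\<^sub>v ((cmat H * matinv (pencil (cis \<omega>))) *\<^sub>v cvec (ss_state F B u n))"
proof -
  let ?x = "ss_state F B u" and ?R = "matinv (pencil (cis \<omega>))"
  let ?X = "dtft m n ?x \<omega>" and ?U = "dtft d n u \<omega>"
  let ?c = "cis \<omega> * cis (- (real n * \<omega>))"
  have x: "?x t \<in> carrier_vec m" for t by (rule ss_state_carrier[OF u])
  have cF: "cmat F \<in> carrier_mat m m" and cB: "cmat B \<in> carrier_mat m d"
    and cH: "cmat H \<in> carrier_mat l m" and cE: "cmat E \<in> carrier_mat l d" using F B H E by auto
  have R: "?R \<in> carrier_mat m m" by (simp add: resolvent_carrier)
  have xn: "cvec (?x n) \<in> carrier_vec m" using x[of n] by simp
  have BU: "cmat B *\<^sub>v ?U \<in> carrier_vec m" using cB by (rule mult_mat_vec_carrier) simp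
  have FX: "cmat F *\<^sub>v ?X \<in> carrier_vec m" using cF by (rule mult_mat_vec_carrier) simp
  have "cis \<omega> \<cdot>\<^sub>v ?X + ?c \<cdot>\<^sub>v cvec (?x n) = dtft m n (\<lambda>t. ?x (Suc t)) \<omega>"
    using F by (intro dtft_shift[symmetric] x) simp
  also have "\<dots> = cmat F *\<^sub>v ?X + cmat B *\<^sub>v ?U"
    using F B x u by (simp add: dtft_add[of _ m] dtft_mult[of _ m m] dtft_mult[of _ m d])
  finally have rec: "cis \<omega> \<cdot>\<^sub>v ?X + ?c \<cdot>\<^sub>v cvec (?x n) = cmat F *\<^sub>v ?X + cmat B *\<^sub>v ?U" .
  have "pencil (cis \<omega>) *\<^sub>v ?X = (cis \<omega> \<cdot>\<^sub>m 1\<^sub>m m) *\<^sub>v ?X - cmat F *\<^sub>v ?X"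
    using cF by (intro minus_mult_distrib_mat_vec) auto
  also have "(cis \<omega> \<cdot>\<^sub>m 1\<^sub>m m) *\<^sub>v ?X = cis \<omega> \<cdot>\<^sub>v ?X"
    by (subst smult_mat_mult_vec[of _ m m]) auto
  also have "cis \<omega> \<cdot>\<^sub>v ?X - cmat F *\<^sub>v ?X = cmat B *\<^sub>v ?U + (- ?c) \<cdot>\<^sub>v cvec (?x n)"
  proof (rule eq_vecI)
    fix i assume "i < dim_vec (cmat B *\<^sub>v ?U + (- ?c) \<cdot>\<^sub>v cvec (?x n))"
    then have i: "i < m" using xn by simp
    have "(cis \<omega> \<cdot>\<^sub>v ?X + ?c \<cdot>\<^sub>v cvec (?x n)) $ i = (cmat F *\<^sub>v ?X + cmat B *\<^sub>v ?U) $ i"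
      using rec by simp
    then have "cis \<omega> * ?X $ i + ?c * cvec (?x n) $ i = (cmat F *\<^sub>v ?X) $ i + (cmat B *\<^sub>v ?U) $ i"
      using i carrier_vecD[OF xn] carrier_vecD[OF BU] carrier_vecD[OF FX] carrier_vecD[OF dtft_carrier[of m n ?x \<omega>]]
      by (simp del: index_map_vec index_mult_mat_vec)
    then show "(cis \<omega> \<cdot>\<^sub>v ?X - cmat F *\<^sub>v ?X) $ i = (cmat B *\<^sub>v ?U + (- ?c) \<cdot>\<^sub>v cvec (?x n)) $ i"
      using i carrier_vecD[OF xn] carrier_vecD[OF BU] carrier_vecD[OF FX] carrier_vecD[OF dtft_carrier[of m n ?x \<omega>]]
      by (simp del: index_map_vec index_mult_mat_vec add: algebra_simps)
  qed (use carrier_vecD[OF xn] carrier_vecD[OF BU] carrier_vecD[OF FX] in simp)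
  finally have pX: "pencil (cis \<omega>) *\<^sub>v ?X = cmat B *\<^sub>v ?U + (- ?c) \<cdot>\<^sub>v cvec (?x n)" .
  define c where "c = - ?c"
  define b where "b = cmat B *\<^sub>v ?U"
  define y where "y = cvec (?x n)"
  define Q where "Q = ?R"
  have Q: "Q \<in> carrier_mat m m" and b: "b \<in> carrier_vec m" and y: "y \<in> carrier_vec m"
    using R BU xn by (simp_all add: Q_def b_def y_def)
  have cy: "c \<cdot>\<^sub>v y \<in> carrier_vec m" and Qb: "Q *\<^sub>v b \<in> carrier_vec m" and Qy: "Q *\<^sub>v y \<in> carrier_vec m"
    using Q b y by auto
  have cQy: "c \<cdot>\<^sub>v (Q *\<^sub>v y) \<in> carrier_vec m" using Qy by simp
  have "?X = (Q * pencil (cis \<omega>)) *\<^sub>v ?X"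
    unfolding Q_def by (subst matinv_eq_adj_mat(3)[OF pencil_carrier det_pencil]) simp_all
  also have "\<dots> = Q *\<^sub>v (pencil (cis \<omega>) *\<^sub>v ?X)"
    by (rule assoc_mult_mat_vec[OF Q pencil_carrier dtft_carrier])
  also have "\<dots> = Q *\<^sub>v (b + c \<cdot>\<^sub>v y)"
    unfolding pX b_def c_def y_def ..
  also have "\<dots> = Q *\<^sub>v b + c \<cdot>\<^sub>v (Q *\<^sub>v y)"
    unfolding mult_add_distrib_mat_vec[OF Q b cy] mult_mat_vec[OF Q y] ..
  finally have "cmat H *\<^sub>v ?X = cmat H *\<^sub>v (Q *\<^sub>v b) + c \<cdot>\<^sub>v (cmat H *\<^sub>v (Q *\<^sub>v y))"
    by (simp only: mult_add_distrib_mat_vec[OF cH Qb cQy] mult_mat_vec[OF cH Qy])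
  also have "cmat H *\<^sub>v (Q *\<^sub>v b) = (cmat H * Q * cmat B) *\<^sub>v ?U"
    unfolding b_def assoc_mult_mat_vec[OF mult_carrier_mat[OF cH Q] cB dtft_carrier]
    using assoc_mult_mat_vec[OF cH Q BU] by simp
  also have "cmat H *\<^sub>v (Q *\<^sub>v y) = (cmat H * Q) *\<^sub>v y"
    by (rule assoc_mult_mat_vec[OF cH Q y, symmetric])
  finally have HX: "cmat H *\<^sub>v ?X = (cmat H * Q * cmat B) *\<^sub>v ?U + c \<cdot>\<^sub>v ((cmat H * Q) *\<^sub>v y)" .
  have HQB: "cmat H * Q * cmat B \<in> carrier_mat l d"
    by (rule mult_carrier_mat[OF mult_carrier_mat[OF cH Q] cB])
  have v1: "(cmat H * Q * cmat B) *\<^sub>v ?U \<in> carrier_vec l" and v2: "c \<cdot>\<^sub>v ((cmat H * Q) *\<^sub>v y) \<in> carrier_vec l"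
    and v3: "cmat E *\<^sub>v ?U \<in> carrier_vec l"
    using mult_mat_vec_carrier[OF HQB dtft_carrier] mult_mat_vec_carrier[OF mult_carrier_mat[OF cH Q] y]
      mult_mat_vec_carrier[OF cE dtft_carrier] by simp_all
  have "dtft l n (ss_output F B H E u) \<omega> = cmat H *\<^sub>v ?X + cmat E *\<^sub>v ?U"
    unfolding ss_output_def[abs_def] dtft_mult[OF H x] dtft_mult[OF E u]
    using H E x u by (intro dtft_add) (auto intro: mult_mat_vec_carrier)
  also have "\<dots> = ((cmat H * Q * cmat B) *\<^sub>v ?U + cmat E *\<^sub>v ?U) + c \<cdot>\<^sub>v ((cmat H * Q) *\<^sub>v y)"
    unfolding HX by (rule vec_eq_add_swap[OF v1 v2 v3])
  also have "(cmat H * Q * cmat B) *\<^sub>v ?U + cmat E *\<^sub>v ?U = ss_tf F B H E (cis \<omega>) *\<^sub>v ?U"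
    unfolding ss_tf_def carrier_matD(1)[OF F] Q_def[symmetric]
    by (rule add_mult_distrib_mat_vec[OF HQB cE dtft_carrier, symmetric])
  finally show ?thesis unfolding Q_def y_def by (intro exI[of _ c]) (simp add: c_def norm_mult)
qed

text \<open>By causality the input may be cut off at time \<open>T\<close>; then the final state tends to 0, and the
  pointwise bound on the circle integrates to the bound on the energies.\<close>
theorem ss_output_energy:
  assumes u: "\<And>t. u t \<in> carrier_vec d"
  defines "\<gamma> \<equiv> hinf_norm (ss_tf F B H E)"
  shows "(\<Sum>t<T. scalar_prod (ss_output F B H E u t) (ss_output F B H E u t)) \<le> \<gamma>\<^sup>2 * (\<Sum>t<T. scalar_prod (u t) (u t))"
proof -
  define v where "v t = (if t < T then u t else 0\<^sub>v d)" for t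
  have v: "v t \<in> carrier_vec d" for t by (simp add: v_def u)
  let ?G = "\<lambda>\<omega>. ss_tf F B H E (cis \<omega>)" and ?x = "ss_state F B v" and ?y = "ss_output F B H E v"
  have x: "?x t \<in> carrier_vec m" for t by (rule ss_state_carrier[OF v])
  have y: "?y t \<in> carrier_vec l" for t
    unfolding ss_output_def using mult_mat_vec_carrier[OF H x] mult_mat_vec_carrier[OF E v] by simp
  have g0: "0 \<le> \<gamma>" unfolding \<gamma>_def by (rule hinf_norm_nonneg[OF continuous_ss_tf d])
  have gAE: "AE \<omega> in lborel. \<omega> \<in> {-pi..<pi} \<longrightarrow> (\<forall>w \<in> carrier_vec d. cnorm (?G \<omega> *\<^sub>v w) \<le> \<gamma> * cnorm w)"
    unfolding \<gamma>_def by (rule AE_cnorm_le_hinf_norm[OF continuous_ss_tf d])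
  define J where "J \<omega> = cmat H * matinv (pencil (cis \<omega>))" for \<omega>
  have J: "continuous_mat l m J"
    unfolding J_def using H by (intro continuous_mat_mult[of l m] continuous_resolvent continuous_mat_const) auto
  have "compact ((\<lambda>\<omega>. entry_sum (J \<omega>)) ` {-pi..pi})"
    by (intro compact_continuous_image continuous_on_subset[OF continuous_on_entry_sum[OF J]]) auto
  then have "bdd_above ((\<lambda>\<omega>. entry_sum (J \<omega>)) ` {-pi..pi})"
    by (intro bounded_imp_bdd_above compact_imp_bounded)
  then obtain K where K: "\<And>\<omega>. \<omega> \<in> {-pi..pi} \<Longrightarrow> entry_sum (J \<omega>) \<le> K"
    unfolding bdd_above_def by (meson imageI)
  \<comment> \<open>\<open>U\<close> bounds the transform of the input and \<open>\<tau> n\<close>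
    the boundary term, both uniformly in the frequency; after squaring, every error term carries a
    factor \<open>\<tau> n\<close>.\<close>
  define U where "U = (\<Sum>i<d. \<Sum>t<T. \<bar>v t $ i\<bar>)"
  define \<tau> where "\<tau> n = K * cnorm (cvec (?x n))" for n
  have bound: "2 * pi * (\<Sum>t<n. scalar_prod (?y t) (?y t)) \<le>
      \<gamma>\<^sup>2 * (2 * pi * (\<Sum>t<T. scalar_prod (v t) (v t))) + 2 * pi * (\<tau> n * (2 * \<gamma> * U + \<tau> n))" if n: "T \<le> n" for n
  proof -
    have vn: "dtft d n v \<omega> = dtft d T v \<omega>" for \<omega>
    proof (rule eq_vecI)
      fix i assume i: "i < dim_vec (dtft d T v \<omega>)"
      have "(\<Sum>t<n. of_real (v t $ i) * cis (- (real t * \<omega>))) = (\<Sum>t<T. of_real (v t $ i) * cis (- (real t * \<omega>)))"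
        using n i by (intro sum.mono_neutral_right) (auto simp: v_def)
      then show "dtft d n v \<omega> $ i = dtft d T v \<omega> $ i"
        using i by (simp add: dtft_def)
    qed simp
    have pt: "(cnorm (dtft l n ?y \<omega>))\<^sup>2 \<le> \<gamma>\<^sup>2 * (cnorm (dtft d T v \<omega>))\<^sup>2 + \<tau> n * (2 * \<gamma> * U + \<tau> n)"
      if w: "\<omega> \<in> {-pi..pi}" and gw: "\<forall>w \<in> carrier_vec d. cnorm (?G \<omega> *\<^sub>v w) \<le> \<gamma> * cnorm w" for \<omega>
    proof -
      obtain c where c: "cmod c = 1" "dtft l n ?y \<omega> = ?G \<omega> *\<^sub>v dtft d T v \<omega> + c \<cdot>\<^sub>v (J \<omega> *\<^sub>v cvec (?x n))"
        using dtft_ss_output[of v n \<omega>, OF v] by (auto simp: J_def vn)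
      have xn: "cvec (?x n) \<in> carrier_vec m" using x[of n] by simp
      have G: "?G \<omega> *\<^sub>v dtft d T v \<omega> \<in> carrier_vec l"
        by (rule mult_mat_vec_carrier[OF continuous_matD(1)[OF continuous_ss_tf] dtft_carrier])
      have Jx: "J \<omega> *\<^sub>v cvec (?x n) \<in> carrier_vec l"
        by (rule mult_mat_vec_carrier[OF continuous_matD(1)[OF J] xn])
      have "cnorm (dtft l n ?y \<omega>) \<le> cnorm (?G \<omega> *\<^sub>v dtft d T v \<omega>) + cnorm (c \<cdot>\<^sub>v (J \<omega> *\<^sub>v cvec (?x n)))"
        unfolding c(2) using G Jx by (intro cnorm_triangle) auto
      also have "cnorm (c \<cdot>\<^sub>v (J \<omega> *\<^sub>v cvec (?x n))) = cnorm (J \<omega> *\<^sub>v cvec (?x n))"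
        by (simp add: cnorm_smult c)
      also have "\<dots> \<le> entry_sum (J \<omega>) * cnorm (cvec (?x n))"
        by (rule cnorm_mult_mat_vec_le[OF continuous_matD(1)[OF J] xn])
      also have "\<dots> \<le> \<tau> n" unfolding \<tau>_def by (intro mult_right_mono K w) simp
      also have "cnorm (?G \<omega> *\<^sub>v dtft d T v \<omega>) \<le> \<gamma> * cnorm (dtft d T v \<omega>)" using gw by simp
      finally have le: "cnorm (dtft l n ?y \<omega>) \<le> \<gamma> * cnorm (dtft d T v \<omega>) + \<tau> n" by simp
      have t0: "0 \<le> \<tau> n"
        using order_trans[OF entry_sum_nonneg K[OF w]] by (simp add: \<tau>_def)
      have "(cnorm (dtft l n ?y \<omega>))\<^sup>2 \<le> (\<gamma> * cnorm (dtft d T v \<omega>) + \<tau> n)\<^sup>2"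
        using le by (intro power_mono) auto
      also have "\<dots> = \<gamma>\<^sup>2 * (cnorm (dtft d T v \<omega>))\<^sup>2 + \<tau> n * (2 * \<gamma> * cnorm (dtft d T v \<omega>) + \<tau> n)"
        by (simp add: power2_eq_square algebra_simps)
      also have "\<dots> \<le> \<gamma>\<^sup>2 * (cnorm (dtft d T v \<omega>))\<^sup>2 + \<tau> n * (2 * \<gamma> * U + \<tau> n)"
        using cnorm_dtft_le[of d T v \<omega>] g0 t0 unfolding U_def
        by (intro add_mono mult_left_mono order_refl) auto
      finally show ?thesis .
    qed
    have si: "set_integrable lborel {-pi..pi} f" if "continuous_on UNIV f" for f :: "real \<Rightarrow> real"
      by (intro borel_integrable_atLeastAtMost' continuous_on_subset[OF that]) auto
    have i1: "set_integrable lborel {-pi..pi} (\<lambda>\<omega>. (cnorm (dtft l n ?y \<omega>))\<^sup>2)"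
      and i2: "set_integrable lborel {-pi..pi} (\<lambda>\<omega>. \<gamma>\<^sup>2 * (cnorm (dtft d T v \<omega>))\<^sup>2)"
      and i3: "set_integrable lborel {-pi..pi} (\<lambda>\<omega>. \<tau> n * (2 * \<gamma> * U + \<tau> n))"
      by (intro si continuous_on_dtft_sq continuous_on_mult continuous_on_const)+
    have "(LINT \<omega>:{-pi..pi}|lborel. (cnorm (dtft l n ?y \<omega>))\<^sup>2) \<le>
        (LINT \<omega>:{-pi..pi}|lborel. \<gamma>\<^sup>2 * (cnorm (dtft d T v \<omega>))\<^sup>2 + \<tau> n * (2 * \<gamma> * U + \<tau> n))"
    proof (rule set_integral_mono_AE[OF i1 set_integral_add(1)[OF i2 i3]])
      \<comment> \<open>The norm is taken over the half-open interval but Parseval's identity over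
        the closed one; the extra point pi is a null set.\<close>
      show "AE \<omega>\<in>{-pi..pi} in lborel. (cnorm (dtft l n ?y \<omega>))\<^sup>2 \<le>
          \<gamma>\<^sup>2 * (cnorm (dtft d T v \<omega>))\<^sup>2 + \<tau> n * (2 * \<gamma> * U + \<tau> n)"
        using gAE AE_lborel_singleton[of pi]
      proof eventually_elim
        case (elim \<omega>)
        then show ?case using pt[of \<omega>] by auto
      qed
    qed
    also have "\<dots> = \<gamma>\<^sup>2 * (LINT \<omega>:{-pi..pi}|lborel. (cnorm (dtft d T v \<omega>))\<^sup>2) + 2 * pi * (\<tau> n * (2 * \<gamma> * U + \<tau> n))"
      unfolding set_integral_add(2)[OF i2 i3] by (simp add: set_integral_const)
    finally show ?thesis
      by (simp only: parseval_dtft[OF y] parseval_dtft[OF v])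
  qed
  \<comment> \<open>After time \<open>T\<close> the input vanishes and the state evolves freely
    under powers of \<open>F\<close>, which tend to 0 on every vector.\<close>
  have tail: "?x (T + k) = (F ^\<^sub>m k) *\<^sub>v ?x T" for k
  proof (induction k)
    case 0
    show ?case using x[of T] F by simp
  next
    case (Suc k)
    have "B *\<^sub>v v (T + k) = 0\<^sub>v m"
      using B by (auto simp: v_def intro!: eq_vecI)
    moreover have "F *\<^sub>v (F ^\<^sub>m k *\<^sub>v ?x T) = (F ^\<^sub>m Suc k) *\<^sub>v ?x T"
      unfolding assoc_mult_mat_vec[OF F pow_carrier_mat[OF F] x, symmetric]
      by (simp only: pow_mat_Suc_left[OF F])
    moreover have "F *\<^sub>v (F ^\<^sub>m k *\<^sub>v ?x T) \<in> carrier_vec m"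
      by (rule mult_mat_vec_carrier[OF F mult_mat_vec_carrier[OF pow_carrier_mat[OF F] x]])
    ultimately show ?case using Suc by simp
  qed
  have cF: "cmat F \<in> carrier_mat m m" using F by simp
  have "(\<lambda>k. cnorm (cmat F ^\<^sub>m k *\<^sub>v cvec (?x T))) \<longlonglongrightarrow> 0"
    using stable x[of T] by (intro stable_power_tendsto_0[OF cF m]) (auto simp: schur_stable_def)
  moreover have "cmat F ^\<^sub>m k *\<^sub>v cvec (?x T) = cvec (?x (T + k))" for k
    unfolding tail of_real_hom.mat_hom_pow[OF F, symmetric]
    by (rule cmat_mult_cvec[OF pow_carrier_mat[OF F] x])
  ultimately have "(\<lambda>k. cnorm (cvec (?x (T + k)))) \<longlonglongrightarrow> 0" by simp
  then have "(\<lambda>k. \<tau> (T + k)) \<longlonglongrightarrow> 0"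
    unfolding \<tau>_def by (rule tendsto_mult_right_zero)
  then have lim: "(\<lambda>k. \<gamma>\<^sup>2 * (2 * pi * (\<Sum>t<T. scalar_prod (v t) (v t))) + 2 * pi * (\<tau> (T + k) * (2 * \<gamma> * U + \<tau> (T + k))))
      \<longlonglongrightarrow> \<gamma>\<^sup>2 * (2 * pi * (\<Sum>t<T. scalar_prod (v t) (v t))) + 2 * pi * (0 * (2 * \<gamma> * U + 0))"
    by (intro tendsto_intros)
  have "2 * pi * (\<Sum>t<T. scalar_prod (?y t) (?y t)) \<le>
      \<gamma>\<^sup>2 * (2 * pi * (\<Sum>t<T. scalar_prod (v t) (v t))) + 2 * pi * (\<tau> (T + k) * (2 * \<gamma> * U + \<tau> (T + k)))" for k
  proof -
    \<comment> \<open>Extending the horizon to \<open>T + k\<close> cannot decrease the output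
      energy, while the input energy stays fixed and the error tends to 0.\<close>
    have "(\<Sum>t<T. scalar_prod (?y t) (?y t)) \<le> (\<Sum>t<T + k. scalar_prod (?y t) (?y t))"
      by (intro sum_mono2) (auto simp: scalar_prod_def intro!: sum_nonneg)
    then have "2 * pi * (\<Sum>t<T. scalar_prod (?y t) (?y t)) \<le> 2 * pi * (\<Sum>t<T + k. scalar_prod (?y t) (?y t))"
      by (intro mult_left_mono) auto
    with bound[of "T + k"] show ?thesis by linarith
  qed
  then have "2 * pi * (\<Sum>t<T. scalar_prod (?y t) (?y t)) \<le> \<gamma>\<^sup>2 * (2 * pi * (\<Sum>t<T. scalar_prod (v t) (v t)))"
    using LIMSEQ_le_const[OF lim] by auto
  then have "2 * pi * (\<Sum>t<T. scalar_prod (?y t) (?y t)) \<le> 2 * pi * (\<gamma>\<^sup>2 * (\<Sum>t<T. scalar_prod (v t) (v t)))"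
    by (simp add: mult_ac)
  then have "(\<Sum>t<T. scalar_prod (?y t) (?y t)) \<le> \<gamma>\<^sup>2 * (\<Sum>t<T. scalar_prod (v t) (v t))"
    by (rule mult_left_le_imp_le) simp
  moreover have "?y t = ss_output F B H E u t" if "t < T" for t
    using ss_state_cong[of t v u] that by (simp add: ss_output_def v_def)
  moreover have "v t = u t" if "t < T" for t using that by (simp add: v_def)
  ultimately show ?thesis by simp
qed

end

subsection \<open>The Kalman filter\<close>

text \<open>Full row rank makes a maximal independent set of columns a basis. The hypothesis says
  that \<open>v\<close> is orthogonal to every column, hence to their span, hence to itself.\<close>

lemma transpose_mult_eq_0_full_row_rank:
  assumes D: "D \<in> carrier_mat p q" and rk: "full_row_rank D"
    and v: "v \<in> carrier_vec p" and z: "transpose_mat D *\<^sub>v v = 0\<^sub>v q"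
  shows "v = 0\<^sub>v p"
proof -
  interpret vec_space "TYPE(real)" p .
  let ?C = "set (cols D)"
  have C: "?C \<subseteq> carrier_vec p" using cols_dim[of D] D by simp
  have "\<exists>S. finite S \<and> maximal S (\<lambda>T. T \<subseteq> ?C \<and> lin_indpt T) \<and> {} \<subseteq> S"
    by (rule maximal_exists_superset[of ?C]) (auto simp: lin_dep_def)
  then obtain S where S: "finite S" "maximal S (\<lambda>T. T \<subseteq> ?C \<and> lin_indpt T)" by blast
  then have SC: "S \<subseteq> ?C" "lin_indpt S" by (auto simp: maximal_def)
  have "card S = p"
    using rank_card_indpt[OF D S(2)] rk D by (simp add: full_row_rank_def)
  then have "basis S"
    using SC C S(1) by (intro dim_li_is_basis) (auto simp: dim_is_n)
  then have "v \<in> span S" using v by (simp add: basis_def)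
  then obtain a A where a: "v = lincomb a A" "finite A" "A \<subseteq> S" using in_spanE by blast
  have Ap: "A \<subseteq> carrier_vec p" using a SC C by blast
  have orth: "(\<Sum>i<p. x $ i * v $ i) = 0" if x: "x \<in> A" for x
  proof -
    from x a SC have "x \<in> ?C" by blast
    then obtain j where j: "j < q" "x = col D j" using D by (auto simp: cols_def)
    have "(transpose_mat D *\<^sub>v v) $ j = 0" using z j by simp
    then show ?thesis using j D v by (auto simp: scalar_prod_def atLeast0LessThan)
  qed
  have "scalar_prod v v = (\<Sum>i<p. (\<Sum>x\<in>A. a x * x $ i) * v $ i)"
    using v lincomb_index[OF _ Ap, of _ a] a(1) by (simp add: scalar_prod_def atLeast0LessThan)
  also have "\<dots> = (\<Sum>x\<in>A. \<Sum>i<p. a x * (x $ i * v $ i))"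
    unfolding sum_distrib_right mult.assoc by (rule sum.swap)
  also have "\<dots> = 0" by (simp add: orth flip: sum_distrib_left)
  finally have "(\<Sum>i<p. v $ i * v $ i) = 0" using v by (simp add: scalar_prod_def atLeast0LessThan)
  then have "\<forall>i<p. v $ i = 0" by (subst (asm) sum_nonneg_eq_0_iff) auto
  then show ?thesis using v by (intro eq_vecI) auto
qed

lemma scalar_prod_transpose_mult:
  fixes X :: "'a :: comm_semiring_0 mat"
  assumes "X \<in> carrier_mat r d" "v \<in> carrier_vec r" "w \<in> carrier_vec d"
  shows "scalar_prod v (X *\<^sub>v w) = scalar_prod (transpose_mat X *\<^sub>v v) w"
proof -
  have "scalar_prod v (X *\<^sub>v w) = (\<Sum>i<r. \<Sum>j<d. v $ i * (X $$ (i, j) * w $ j))"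
    using assms by (auto simp: scalar_prod_def atLeast0LessThan sum_distrib_left)
  also have "\<dots> = (\<Sum>j<d. \<Sum>i<r. v $ i * (X $$ (i, j) * w $ j))" by (rule sum.swap)
  also have "\<dots> = scalar_prod (transpose_mat X *\<^sub>v v) w"
    using assms by (auto simp: scalar_prod_def atLeast0LessThan sum_distrib_left sum_distrib_right mult_ac intro!: sum.cong)
  finally show ?thesis .
qed

text \<open>The gain contains \<open>matinv\<close>, so even its dimensions rest on the
  invertibility of the innovation covariance. On a kernel vector both nonnegative forms, that of
  \<open>C * P * transpose_mat C\<close> and that of \<open>D * transpose_mat D\<close>, would
  vanish, but the latter is definite by full row rank.\<close>

lemma kalman_gain_carrier:
  assumes C: "C \<in> carrier_mat p m" and D: "D \<in> carrier_mat p q" and rk: "full_row_rank D" and P: "pos_semidef m P"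
  shows "kalman_gain C D P \<in> carrier_mat m p"
proof -
  let ?W = "C * P * transpose_mat C + D * transpose_mat D"
  have Pc: "P \<in> carrier_mat m m" using P by (simp add: pos_semidef_def)
  have Ct: "transpose_mat C \<in> carrier_mat m p" and Dt: "transpose_mat D \<in> carrier_mat q p" using C D by simp_all
  have CP: "C * P \<in> carrier_mat p m" using C Pc by simp
  have CPC: "C * P * transpose_mat C \<in> carrier_mat p p" and DD: "D * transpose_mat D \<in> carrier_mat p p"
    using mult_carrier_mat[OF CP Ct] mult_carrier_mat[OF D Dt] by simp_all
  have W: "?W \<in> carrier_mat p p" using CPC DD by simp
  have "det ?W \<noteq> 0"
  proof
    assume "det ?W = 0"
    then obtain v where v: "v \<in> carrier_vec p" "v \<noteq> 0\<^sub>v p" "?W *\<^sub>v v = 0\<^sub>v p"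
      using det_0_iff_vec_prod_zero[OF W] by auto
    let ?a = "transpose_mat C *\<^sub>v v" and ?b = "transpose_mat D *\<^sub>v v"
    have a: "?a \<in> carrier_vec m" and b: "?b \<in> carrier_vec q"
      using mult_mat_vec_carrier[OF Ct v(1)] mult_mat_vec_carrier[OF Dt v(1)] by simp_all
    have "?W *\<^sub>v v = C *\<^sub>v (P *\<^sub>v ?a) + D *\<^sub>v ?b"
      unfolding add_mult_distrib_mat_vec[OF CPC DD v(1)] assoc_mult_mat_vec[OF CP Ct v(1)]
        assoc_mult_mat_vec[OF D Dt v(1)] assoc_mult_mat_vec[OF C Pc a] ..
    then have "C *\<^sub>v (P *\<^sub>v ?a) + D *\<^sub>v ?b = 0\<^sub>v p" by (simp only: v(3))
    then have "0 = scalar_prod v (C *\<^sub>v (P *\<^sub>v ?a) + D *\<^sub>v ?b)" by (simp only:) (simp add: v(1))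
    also have "\<dots> = scalar_prod v (C *\<^sub>v (P *\<^sub>v ?a)) + scalar_prod v (D *\<^sub>v ?b)"
      using v(1) mult_mat_vec_carrier[OF C mult_mat_vec_carrier[OF Pc a]] mult_mat_vec_carrier[OF D b]
      by (rule scalar_prod_add_distrib)
    also have "\<dots> = scalar_prod ?a (P *\<^sub>v ?a) + scalar_prod ?b ?b"
      unfolding scalar_prod_transpose_mult[OF C v(1) mult_mat_vec_carrier[OF Pc a]]
        scalar_prod_transpose_mult[OF D v(1) b] ..
    finally have "scalar_prod ?a (P *\<^sub>v ?a) + scalar_prod ?b ?b = 0" by simp
    moreover have "0 \<le> scalar_prod ?a (P *\<^sub>v ?a)" using P a by (simp add: pos_semidef_def)
    ultimately have "scalar_prod ?b ?b \<le> 0" by simp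
    then have "(cnorm (cvec ?b))\<^sup>2 \<le> 0" by (simp only: cnorm_cvec_sq)
    then have "cnorm (cvec ?b) = 0" by simp
    then have "cvec ?b = 0\<^sub>v q" using cnorm_eq_0_iff[of "cvec ?b" q] b by simp
    then have "?b = 0\<^sub>v q" using of_real_hom.vec_hom_zero_iff by blast
    from transpose_mult_eq_0_full_row_rank[OF D rk v(1) this] v(2) show False by simp
  qed
  from matinv_eq_adj_mat(2)[OF W this] show ?thesis
    unfolding kalman_gain_def by (rule mult_carrier_mat[OF mult_carrier_mat[OF Pc Ct]])
qed

lemma hinf_norm_cong: "(\<And>\<omega>. G (cis \<omega>) = G' (cis \<omega>)) \<Longrightarrow> hinf_norm G = hinf_norm G'"
  by (simp add: hinf_norm_def)

section \<open>Differences of adjacent trajectories\<close>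

lemma selection_mat_index:
  assumes "v \<in> carrier_vec m" "k < m"
  shows "(selection_mat m S *\<^sub>v v) $ k = (if k \<in> S then v $ k else 0)"
  using assms by (auto simp: selection_mat_def scalar_prod_def if_distrib[of "\<lambda>x. x * _"] sum.delta'
      cong: if_cong)

lemma selection_mat_carrier [simp]: "selection_mat m S \<in> carrier_mat m m"
  by (simp add: selection_mat_def)

text \<open>Outside the selected coordinates the trajectories agree, so the selected difference is
  the whole difference and \<open>selection_mat m S\<close> fixes it. This lets the matrix appear in
  the transfer function although the measurements see the full state.\<close>

lemma selected_difference:
  assumes x: "x \<in> carrier_vec m" and x': "x' \<in> carrier_vec m"
    and eq: "(1\<^sub>m m - selection_mat m S) *\<^sub>v x = (1\<^sub>m m - selection_mat m S) *\<^sub>v x'"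
  defines "u \<equiv> selection_mat m S *\<^sub>v x - selection_mat m S *\<^sub>v x'"
  shows "u \<in> carrier_vec m" "x = x' + u" "selection_mat m S *\<^sub>v u = u"
proof -
  let ?T = "selection_mat m S"
  note T = selection_mat_carrier[of m S]
  have Tx: "?T *\<^sub>v v \<in> carrier_vec m" if "v \<in> carrier_vec m" for v
    by (rule mult_mat_vec_carrier[OF T that])
  show u: "u \<in> carrier_vec m" unfolding u_def using Tx x x' by (intro minus_carrier_vec)
  have uk: "u $ k = (if k \<in> S then x $ k - x' $ k else 0)" if "k < m" for k
    unfolding u_def using that carrier_vecD[OF Tx[OF x']]
    by (simp add: selection_mat_index[OF x] selection_mat_index[OF x'] del: index_mult_mat_vec)
  have off: "((1\<^sub>m m - ?T) *\<^sub>v v) $ k = (if k \<in> S then 0 else v $ k)" if "v \<in> carrier_vec m" "k < m" for v k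
    unfolding minus_mult_distrib_mat_vec[OF one_carrier_mat T that(1)]
    using that carrier_vecD[OF Tx[OF that(1)]] by (simp add: selection_mat_index[OF that(1)] del: index_mult_mat_vec)
  show "x = x' + u"
  proof (rule eq_vecI)
    fix k assume "k < dim_vec (x' + u)"
    then have k: "k < m" using u by simp
    show "x $ k = (x' + u) $ k"
      using off[OF x k] off[OF x' k] eq uk[OF k] k u by (auto split: if_splits)
  qed (use u x in simp)
  show "?T *\<^sub>v u = u"
    by (rule eq_vecI) (use u carrier_vecD[OF Tx[OF u]] in \<open>auto simp: selection_mat_index[OF u] uk simp del: index_mult_mat_vec\<close>)
qed

section \<open>The response of the filter to a change of the state\<close>

locale kalman_filter =
  fixes m p l :: nat and A C M L :: "real mat" and S :: "nat set" and xbar :: "real vec"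
  assumes m: "1 \<le> m" and A: "A \<in> carrier_mat m m" and C: "C \<in> carrier_mat p m"
    and M: "M \<in> carrier_mat m p" and L: "L \<in> carrier_mat l m" and xbar: "xbar \<in> carrier_vec m"
    and stable: "schur_stable (A - A * M * C)"
begin

abbreviation "T \<equiv> selection_mat m S"
abbreviation "N \<equiv> 1\<^sub>m m - M * C"

text \<open>State-space form of the response: if the state changes by \<open>T u\<close>, the
  prediction changes by some \<open>e\<close> whose next value is \<open>A (N e + M C T u)\<close>,
  and the weighted estimate changes by \<open>L (N e + M C T u)\<close>.\<close>

definition "ssF = A * N"
definition "ssB = A * M * C * T"
definition "ssH = L * N"
definition "ssE = L * M * C * T"

lemma T_carrier: "T \<in> carrier_mat m m" by simp

lemma N_carrier: "N \<in> carrier_mat m m"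
  using mult_carrier_mat[OF M C] by (rule minus_carrier_mat)

lemma AM_carrier: "A * M \<in> carrier_mat m p"
  by (rule mult_carrier_mat[OF A M])

lemma ss_carrier: "ssF \<in> carrier_mat m m" "ssB \<in> carrier_mat m m" "ssH \<in> carrier_mat l m" "ssE \<in> carrier_mat l m"
  unfolding ssF_def ssB_def ssH_def ssE_def
  by (rule mult_carrier_mat[OF A N_carrier] mult_carrier_mat[OF mult_carrier_mat[OF AM_carrier C] T_carrier] mult_carrier_mat[OF L N_carrier]
      mult_carrier_mat[OF mult_carrier_mat[OF mult_carrier_mat[OF L M] C] T_carrier])+

text \<open>Identifies the transition matrix of the response with the closed-loop matrix of the
  predictor, the one whose stability is part of \<open>stabilizing_riccati_solution\<close>.\<close>

lemma ssF_eq: "ssF = A - A * M * C"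
proof -
  have "A * N = A * 1\<^sub>m m - A * (M * C)"
    by (rule mult_minus_distrib_mat[OF A one_carrier_mat mult_carrier_mat[OF M C]])
  then show ?thesis unfolding ssF_def assoc_mult_mat[OF A M C] using A by simp
qed

sublocale stable_system m m l ssF ssB ssH ssE
  by unfold_locales (use m ss_carrier stable in \<open>simp_all add: ssF_eq\<close>)

text \<open>Restricted to the unit circle, where stability guarantees the resolvent; the H-infinity
  norm looks at no other points.\<close>

lemma ss_tf_eq:
  assumes z: "cmod z = 1"
  shows "ss_tf ssF ssB ssH ssE z = cmat L * kalman_tf A C M z * cmat C * cmat T"
proof -
  let ?R = "matinv (z \<cdot>\<^sub>m 1\<^sub>m m - cmat ssF)"
  note hom = of_real_hom.mat_hom_mult
  have cc: "cmat A \<in> carrier_mat m m" "cmat C \<in> carrier_mat p m" "cmat M \<in> carrier_mat m p"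
    "cmat L \<in> carrier_mat l m" "cmat T \<in> carrier_mat m m" "cmat N \<in> carrier_mat m m" "cmat (A * M) \<in> carrier_mat m p"
    using A C M L T_carrier N_carrier AM_carrier by (simp_all only: map_carrier_mat)
  have R: "?R \<in> carrier_mat m m" by (rule resolvent_carrier[OF z])
  have NR: "cmat N * ?R \<in> carrier_mat m m" by (rule mult_carrier_mat[OF cc(6) R])
  have NRK: "cmat N * ?R * cmat (A * M) \<in> carrier_mat m p" by (rule mult_carrier_mat[OF NR cc(7)])
  have LN: "cmat L * cmat N \<in> carrier_mat l m" by (rule mult_carrier_mat[OF cc(4,6)])
  have LNR: "cmat L * cmat N * ?R \<in> carrier_mat l m" by (rule mult_carrier_mat[OF LN R])
  have KC: "cmat (A * M) * cmat C \<in> carrier_mat m m" by (rule mult_carrier_mat[OF cc(7,2)])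
  have LM: "cmat L * cmat M \<in> carrier_mat l p" by (rule mult_carrier_mat[OF cc(4,3)])
  have LMC: "cmat L * cmat M * cmat C \<in> carrier_mat l m" by (rule mult_carrier_mat[OF LM cc(2)])
  have LNRK: "cmat L * cmat N * ?R * cmat (A * M) \<in> carrier_mat l p" by (rule mult_carrier_mat[OF LNR cc(7)])
  have LNRKC: "cmat L * cmat N * ?R * cmat (A * M) * cmat C \<in> carrier_mat l m"
    by (rule mult_carrier_mat[OF LNRK cc(2)])
  have "cmat L * kalman_tf A C M z * cmat C * cmat T =
      cmat L * (cmat N * ?R * cmat (A * M) + cmat M) * cmat C * cmat T"
    unfolding kalman_tf_def ssF_def using A by simp
  also have "cmat L * (cmat N * ?R * cmat (A * M) + cmat M) = cmat L * cmat N * ?R * cmat (A * M) + cmat L * cmat M"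
    unfolding mult_add_distrib_mat[OF cc(4) NRK cc(3)]
    unfolding assoc_mult_mat[OF cc(4) NR cc(7), symmetric] assoc_mult_mat[OF cc(4,6) R] ..
  also have "\<dots> * cmat C * cmat T = cmat L * cmat N * ?R * cmat (A * M) * cmat C * cmat T + cmat L * cmat M * cmat C * cmat T"
    unfolding add_mult_distrib_mat[OF LNRK LM cc(2)] add_mult_distrib_mat[OF LNRKC LMC cc(5)] ..
  also have "cmat L * cmat N * ?R * cmat (A * M) * cmat C * cmat T = cmat L * cmat N * ?R * (cmat (A * M) * cmat C * cmat T)"
    unfolding assoc_mult_mat[OF LNR cc(7) cc(2)] assoc_mult_mat[OF LNR KC cc(5)] ..
  also have "cmat (A * M) * cmat C * cmat T = cmat ssB"
    unfolding ssB_def hom[OF mult_carrier_mat[OF AM_carrier C] T_carrier] hom[OF AM_carrier C] ..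
  also have "cmat L * cmat N = cmat ssH"
    unfolding ssH_def hom[OF L N_carrier] ..
  also have "cmat L * cmat M * cmat C * cmat T = cmat ssE"
    unfolding ssE_def hom[OF mult_carrier_mat[OF mult_carrier_mat[OF L M] C] T_carrier] hom[OF mult_carrier_mat[OF L M] C] hom[OF L M] ..
  finally show ?thesis unfolding ss_tf_def carrier_matD(1)[OF ss_carrier(1)] by simp
qed

lemma kf_update_carrier:
  assumes "x \<in> carrier_vec m" "y \<in> carrier_vec p"
  shows "kf_update C M x y \<in> carrier_vec m"
  unfolding kf_update_def using assms
  by (intro add_carrier_vec mult_mat_vec_carrier[OF M] minus_carrier_vec mult_mat_vec_carrier[OF C])

lemma kf_update_add:
  assumes x: "x \<in> carrier_vec m" and e: "e \<in> carrier_vec m" and y: "y \<in> carrier_vec p" and g: "g \<in> carrier_vec p"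
  shows "kf_update C M (x + e) (y + g) = kf_update C M x y + (N *\<^sub>v e + M *\<^sub>v g)"
proof -
  have Cx: "C *\<^sub>v x \<in> carrier_vec p" and Ce: "C *\<^sub>v e \<in> carrier_vec p"
    using mult_mat_vec_carrier[OF C] x e by simp_all
  have "y + g - C *\<^sub>v (x + e) = (y - C *\<^sub>v x) + (g - C *\<^sub>v e)"
    unfolding mult_add_distrib_mat_vec[OF C x e] using C y g
    by (intro eq_vecI) (auto simp del: index_mult_mat_vec(1))
  moreover have "M *\<^sub>v ((y - C *\<^sub>v x) + (g - C *\<^sub>v e)) = M *\<^sub>v (y - C *\<^sub>v x) + (M *\<^sub>v g - M *\<^sub>v (C *\<^sub>v e))"
    using Cx Ce y g by (subst mult_add_distrib_mat_vec[OF M]) (auto simp: mult_minus_distrib_mat_vec[OF M g Ce])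
  moreover have "N *\<^sub>v e = e - M *\<^sub>v (C *\<^sub>v e)"
    unfolding minus_mult_distrib_mat_vec[OF one_carrier_mat mult_carrier_mat[OF M C] e] assoc_mult_mat_vec[OF M C e]
    using e by simp
  moreover have "M *\<^sub>v (y - C *\<^sub>v x) \<in> carrier_vec m" "M *\<^sub>v g \<in> carrier_vec m" "M *\<^sub>v (C *\<^sub>v e) \<in> carrier_vec m"
    using mult_mat_vec_carrier[OF M] Cx Ce y g by auto
  ultimately show ?thesis
    unfolding kf_update_def using x e carrier_matD(1)[OF M]
    by (intro eq_vecI) (auto simp del: index_mult_mat_vec(1))
qed

lemma kf_pred_carrier:
  assumes "\<And>t. y t \<in> carrier_vec p"
  shows "kf_pred A C M xbar y t \<in> carrier_vec m"
  by (induction t) (simp_all add: xbar mult_mat_vec_carrier[OF A] kf_update_carrier assms)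

lemma kf_est_carrier:
  assumes "\<And>t. y t \<in> carrier_vec p"
  shows "kf_est A C M xbar y t \<in> carrier_vec m"
  unfolding kf_est_def by (intro kf_update_carrier kf_pred_carrier assms)

context
  fixes y y' u :: "nat \<Rightarrow> real vec"
  assumes y: "\<And>t. y t \<in> carrier_vec p" and u: "\<And>t. u t \<in> carrier_vec m"
    and y': "\<And>t. y' t = y t + C *\<^sub>v (T *\<^sub>v u t)"
begin

lemma CTu: "C *\<^sub>v (T *\<^sub>v u t) \<in> carrier_vec p"
  by (rule mult_mat_vec_carrier[OF C mult_mat_vec_carrier[OF T_carrier u]])

text \<open>Both filters start from the same public prediction, so their difference starts at 0; the
  update being linear, the difference then follows the recursion of \<open>ss_state\<close> whatever
  \<open>y\<close> is.\<close>

lemma kf_pred_add: "kf_pred A C M xbar y' t = kf_pred A C M xbar y t + ss_state ssF ssB u t"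
proof (induction t)
  case 0
  show ?case using xbar carrier_matD(1)[OF ss_carrier(1)] by simp
next
  case (Suc t)
  let ?x = "kf_pred A C M xbar y t" and ?e = "ss_state ssF ssB u t" and ?g = "C *\<^sub>v (T *\<^sub>v u t)"
  have x: "?x \<in> carrier_vec m" by (rule kf_pred_carrier[OF y])
  have e: "?e \<in> carrier_vec m" by (rule ss_state_carrier[OF u])
  have Ne: "N *\<^sub>v ?e \<in> carrier_vec m" and Mg: "M *\<^sub>v ?g \<in> carrier_vec m"
    by (rule mult_mat_vec_carrier[OF N_carrier e] mult_mat_vec_carrier[OF M CTu])+
  have "kf_pred A C M xbar y' (Suc t) = A *\<^sub>v (kf_update C M ?x (y t) + (N *\<^sub>v ?e + M *\<^sub>v ?g))"
    by (simp only: kf_pred.simps Suc y' kf_update_add[OF x e y CTu])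
  also have "\<dots> = A *\<^sub>v kf_update C M ?x (y t) + (A *\<^sub>v (N *\<^sub>v ?e) + A *\<^sub>v (M *\<^sub>v ?g))"
    unfolding mult_add_distrib_mat_vec[OF A kf_update_carrier[OF x y] add_carrier_vec[OF Ne Mg]]
      mult_add_distrib_mat_vec[OF A Ne Mg] ..
  also have "A *\<^sub>v (N *\<^sub>v ?e) = ssF *\<^sub>v ?e"
    using assoc_mult_mat_vec[OF A N_carrier e] by (simp only: ssF_def)
  also have "A *\<^sub>v (M *\<^sub>v ?g) = ssB *\<^sub>v u t"
    unfolding ssB_def assoc_mult_mat_vec[OF mult_carrier_mat[OF AM_carrier C] T_carrier u]
      assoc_mult_mat_vec[OF AM_carrier C mult_mat_vec_carrier[OF T_carrier u]] assoc_mult_mat_vec[OF A M CTu] ..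
  finally show ?case by simp
qed

lemma L_kf_est_add:
  "L *\<^sub>v kf_est A C M xbar y' t = L *\<^sub>v kf_est A C M xbar y t + ss_output ssF ssB ssH ssE u t"
proof -
  let ?x = "kf_pred A C M xbar y t" and ?e = "ss_state ssF ssB u t" and ?g = "C *\<^sub>v (T *\<^sub>v u t)"
  have x: "?x \<in> carrier_vec m" by (rule kf_pred_carrier[OF y])
  have e: "?e \<in> carrier_vec m" by (rule ss_state_carrier[OF u])
  have Ne: "N *\<^sub>v ?e \<in> carrier_vec m" and Mg: "M *\<^sub>v ?g \<in> carrier_vec m"
    by (rule mult_mat_vec_carrier[OF N_carrier e] mult_mat_vec_carrier[OF M CTu])+
  have "L *\<^sub>v kf_est A C M xbar y' t = L *\<^sub>v (kf_update C M ?x (y t) + (N *\<^sub>v ?e + M *\<^sub>v ?g))"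
    by (simp only: kf_est_def kf_pred_add y' kf_update_add[OF x e y CTu])
  also have "\<dots> = L *\<^sub>v kf_update C M ?x (y t) + (L *\<^sub>v (N *\<^sub>v ?e) + L *\<^sub>v (M *\<^sub>v ?g))"
    unfolding mult_add_distrib_mat_vec[OF L kf_update_carrier[OF x y] add_carrier_vec[OF Ne Mg]]
      mult_add_distrib_mat_vec[OF L Ne Mg] ..
  also have "L *\<^sub>v (N *\<^sub>v ?e) = ssH *\<^sub>v ?e"
    unfolding ssH_def by (rule assoc_mult_mat_vec[OF L N_carrier e, symmetric])
  also have "L *\<^sub>v (M *\<^sub>v ?g) = ssE *\<^sub>v u t"
    unfolding ssE_def assoc_mult_mat_vec[OF mult_carrier_mat[OF mult_carrier_mat[OF L M] C] T_carrier u]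
      assoc_mult_mat_vec[OF mult_carrier_mat[OF L M] C mult_mat_vec_carrier[OF T_carrier u]] assoc_mult_mat_vec[OF L M CTu] ..
  finally show ?thesis by (simp add: ss_output_def kf_est_def)
qed

end

text \<open>The response \<open>h\<close> is quantified before the noise \<open>v\<close>: it
  depends on the two trajectories only. This is what makes it a deterministic translation once the
  noise is frozen.\<close>

lemma output_difference:
  fixes x x' :: "nat \<Rightarrow> real vec"
  defines "u \<equiv> (\<lambda>t. T *\<^sub>v x t - T *\<^sub>v x' t)"
    and "\<gamma> \<equiv> hinf_norm (\<lambda>z. cmat L * kalman_tf A C M z * cmat C * cmat T)"
  assumes x: "\<And>t. x t \<in> carrier_vec m" and x': "\<And>t. x' t \<in> carrier_vec m"
    and eq: "\<And>t. (1\<^sub>m m - T) *\<^sub>v x t = (1\<^sub>m m - T) *\<^sub>v x' t"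
    and l2: "l2_signal u" "l2_norm u \<le> \<rho>"
  shows "0 \<le> \<gamma>"
    and "\<exists>h. (\<forall>t. h t \<in> carrier_vec l) \<and>
      (\<forall>v t. (\<forall>t. v t \<in> carrier_vec p) \<longrightarrow>
        L *\<^sub>v kf_est A C M xbar (\<lambda>t. C *\<^sub>v x t + v t) t = L *\<^sub>v kf_est A C M xbar (\<lambda>t. C *\<^sub>v x' t + v t) t + h t) \<and>
      (\<forall>n. (\<Sum>t<n. scalar_prod (h t) (h t)) \<le> (\<gamma> * \<rho>)\<^sup>2)"
proof -
  have g: "\<gamma> = hinf_norm (ss_tf ssF ssB ssH ssE)"
    unfolding \<gamma>_def by (rule hinf_norm_cong) (simp add: ss_tf_eq)
  show "0 \<le> \<gamma>" unfolding g by (rule hinf_norm_nonneg[OF continuous_ss_tf m])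
  note sd = selected_difference[OF x x' eq, folded u_def]
  have u: "u t \<in> carrier_vec m" and xu: "x t = x' t + u t" and Tu: "T *\<^sub>v u t = u t" for t
    using sd[of t] by (simp_all add: u_def)
  define h where "h = ss_output ssF ssB ssH ssE u"
  have h: "h t \<in> carrier_vec l" for t
    unfolding h_def ss_output_def
    by (intro add_carrier_vec mult_mat_vec_carrier[OF ss_carrier(3)] mult_mat_vec_carrier[OF ss_carrier(4)] ss_state_carrier u)
  have "L *\<^sub>v kf_est A C M xbar (\<lambda>t. C *\<^sub>v x t + v t) t = L *\<^sub>v kf_est A C M xbar (\<lambda>t. C *\<^sub>v x' t + v t) t + h t"
    if v: "\<forall>t. v t \<in> carrier_vec p" for v t
    unfolding h_def
  proof (rule L_kf_est_add)
    fix t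
    have Cx': "C *\<^sub>v x' t \<in> carrier_vec p" and Cu: "C *\<^sub>v u t \<in> carrier_vec p"
      by (rule mult_mat_vec_carrier[OF C x'] mult_mat_vec_carrier[OF C u])+
    show "C *\<^sub>v x' t + v t \<in> carrier_vec p" using Cx' v by (intro add_carrier_vec) auto
    show "C *\<^sub>v x t + v t = C *\<^sub>v x' t + v t + C *\<^sub>v (T *\<^sub>v u t)"
      unfolding xu Tu mult_add_distrib_mat_vec[OF C x' u]
      by (rule vec_eq_add_swap[OF Cx' Cu]) (simp add: v)
  qed (rule u)
  moreover have "(\<Sum>t<n. scalar_prod (h t) (h t)) \<le> (\<gamma> * \<rho>)\<^sup>2" for n
  proof -
    have nn: "0 \<le> scalar_prod (u t) (u t)" for t by (simp add: scalar_prod_def sum_nonneg)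
    have "(\<Sum>t<n. scalar_prod (u t) (u t)) \<le> (\<Sum>t. scalar_prod (u t) (u t))"
      using l2(1) nn by (intro sum_le_suminf) (auto simp: l2_signal_def)
    also have "\<dots> = (l2_norm u)\<^sup>2"
      using suminf_nonneg[OF l2(1)[unfolded l2_signal_def] nn] by (simp add: l2_norm_def)
    also have "\<dots> \<le> \<rho>\<^sup>2"
      using l2(2) suminf_nonneg[OF l2(1)[unfolded l2_signal_def] nn]
      by (intro power_mono) (auto simp: l2_norm_def)
    finally have "(\<Sum>t<n. scalar_prod (u t) (u t)) \<le> \<rho>\<^sup>2" .
    then have "\<gamma>\<^sup>2 * (\<Sum>t<n. scalar_prod (u t) (u t)) \<le> (\<gamma> * \<rho>)\<^sup>2"
      unfolding power_mult_distrib by (rule mult_left_mono) simp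
    then show ?thesis
      unfolding h_def g by (rule order_trans[OF ss_output_energy[OF u]])
  qed
  ultimately show "\<exists>h. (\<forall>t. h t \<in> carrier_vec l) \<and>
      (\<forall>v t. (\<forall>t. v t \<in> carrier_vec p) \<longrightarrow>
        L *\<^sub>v kf_est A C M xbar (\<lambda>t. C *\<^sub>v x t + v t) t = L *\<^sub>v kf_est A C M xbar (\<lambda>t. C *\<^sub>v x' t + v t) t + h t) \<and>
      (\<forall>n. (\<Sum>t<n. scalar_prod (h t) (h t)) \<le> (\<gamma> * \<rho>)\<^sup>2)"
    using h by (intro exI[of _ h]) blast
qed

section \<open>Measurability of the filter\<close>

lemma measurable_kf_update:
  assumes x: "x \<in> \<Omega> \<rightarrow>\<^sub>M vec_borel m" and y: "y \<in> \<Omega> \<rightarrow>\<^sub>M vec_borel p"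
  shows "(\<lambda>\<omega>. kf_update C M (x \<omega>) (y \<omega>)) \<in> \<Omega> \<rightarrow>\<^sub>M vec_borel m"
  unfolding kf_update_def
  by (intro measurable_vec_add x measurable_mult_mat_vec[OF M] measurable_vec_diff y measurable_mult_mat_vec[OF C])

lemma measurable_kf_pred:
  assumes y: "\<And>t. (\<lambda>\<omega>. y \<omega> t) \<in> \<Omega> \<rightarrow>\<^sub>M vec_borel p"
  shows "(\<lambda>\<omega>. kf_pred A C M xbar (y \<omega>) t) \<in> \<Omega> \<rightarrow>\<^sub>M vec_borel m"
proof (induction t)
  case 0
  show ?case using xbar by simp
next
  case (Suc t)
  show ?case unfolding kf_pred.simps
    by (rule measurable_mult_mat_vec[OF A measurable_kf_update[OF Suc y]])
qed

lemma measurable_L_kf_est: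
  assumes y: "\<And>t. (\<lambda>\<omega>. y \<omega> t) \<in> \<Omega> \<rightarrow>\<^sub>M vec_borel p"
  shows "(\<lambda>\<omega>. L *\<^sub>v kf_est A C M xbar (y \<omega>) t) \<in> \<Omega> \<rightarrow>\<^sub>M vec_borel l"
  unfolding kf_est_def
  by (rule measurable_mult_mat_vec[OF L measurable_kf_update[OF measurable_kf_pred[OF y] y]])

end

section \<open>Sums over the participants and the released signal\<close>

lemma finsum_vec_cong:
  assumes "finite I" "\<And>i. i \<in> I \<Longrightarrow> f i = g i" "\<And>i. i \<in> I \<Longrightarrow> g i \<in> carrier_vec d"
  shows "finsum_vec TYPE(real) d f I = finsum_vec TYPE(real) d g I"
proof -
  have f: "f i \<in> carrier_vec d" if "i \<in> I" for i using assms that by auto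
  have F: "finsum_vec TYPE(real) d f I \<in> carrier_vec d" "finsum_vec TYPE(real) d g I \<in> carrier_vec d"
    using f assms(3) by (auto intro!: finsum_vec_closed)
  show ?thesis
  proof (rule eq_vecI)
    fix k assume "k < dim_vec (finsum_vec TYPE(real) d g I)"
    then have "k < d" using F by simp
    then show "finsum_vec TYPE(real) d f I $ k = finsum_vec TYPE(real) d g I $ k"
      using f assms by (simp add: index_finsum_vec Pi_iff)
  qed (use F in simp)
qed

lemma finsum_vec_add_single:
  assumes I: "finite I" "i0 \<in> I" and f: "\<And>i. i \<in> I \<Longrightarrow> f i \<in> carrier_vec d" and h: "h \<in> carrier_vec d"
    and g: "\<And>i. i \<in> I \<Longrightarrow> g i = (if i = i0 then f i + h else f i)"
  shows "finsum_vec TYPE(real) d g I = finsum_vec TYPE(real) d f I + h"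
proof (rule eq_vecI)
  have gc: "g i \<in> carrier_vec d" if "i \<in> I" for i using g[OF that] f[OF that] h by auto
  have F: "finsum_vec TYPE(real) d f I \<in> carrier_vec d" "finsum_vec TYPE(real) d g I \<in> carrier_vec d"
    using f gc by (auto intro!: finsum_vec_closed)
  show "dim_vec (finsum_vec TYPE(real) d g I) = dim_vec (finsum_vec TYPE(real) d f I + h)"
    using F h by simp
  fix k assume "k < dim_vec (finsum_vec TYPE(real) d f I + h)"
  then have k: "k < d" using h by simp
  have "finsum_vec TYPE(real) d g I $ k = (\<Sum>i\<in>I. g i $ k)"
    using I k gc by (intro index_finsum_vec) auto
  also have "\<dots> = (\<Sum>i\<in>I. f i $ k + (if i = i0 then h $ k else 0))"
    using g k h f by (intro sum.cong) (auto simp: carrier_vecD)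
  also have "\<dots> = finsum_vec TYPE(real) d f I $ k + h $ k"
    using I k f by (subst index_finsum_vec) (auto simp: sum.distrib)
  finally show "finsum_vec TYPE(real) d g I $ k = (finsum_vec TYPE(real) d f I + h) $ k"
    using k h F by simp
qed

theorem theorem4:
  fixes \<epsilon> \<delta> :: real
    and n l :: nat
    and m p q :: "nat \<Rightarrow> nat"
    and A B C D L P M :: "nat \<Rightarrow> real mat"
    and xbar :: "nat \<Rightarrow> real vec"
    and S :: "nat \<Rightarrow> nat set"
    and \<rho> \<gamma>i :: "nat \<Rightarrow> real" and \<gamma> :: real
    and \<Omega> :: "'o measure"
    and w :: "nat \<Rightarrow> nat \<Rightarrow> 'o \<Rightarrow> real vec"
    and X0 :: "nat \<Rightarrow> 'o \<Rightarrow> real vec"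
    and nu :: "nat \<Rightarrow> 'o \<Rightarrow> real vec"
  assumes "0 < \<epsilon>" and "0 < \<delta>" and "\<delta> < 1" and "1 \<le> n"
    and "\<And>i. i \<in> {1..n} \<Longrightarrow> 1 \<le> m i"
    and "\<And>i. i \<in> {1..n} \<Longrightarrow> A i \<in> carrier_mat (m i) (m i)"
    and "\<And>i. i \<in> {1..n} \<Longrightarrow> B i \<in> carrier_mat (m i) (q i)"
    and "\<And>i. i \<in> {1..n} \<Longrightarrow> C i \<in> carrier_mat (p i) (m i)"
    and "\<And>i. i \<in> {1..n} \<Longrightarrow> D i \<in> carrier_mat (p i) (q i)"
    and "\<And>i. i \<in> {1..n} \<Longrightarrow> L i \<in> carrier_mat l (m i)"
    and "\<And>i. i \<in> {1..n} \<Longrightarrow> xbar i \<in> carrier_vec (m i)"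
    and "\<And>i. i \<in> {1..n} \<Longrightarrow> full_row_rank (D i)"
    and "\<And>i. i \<in> {1..n} \<Longrightarrow> B i * transpose_mat (D i) = 0\<^sub>m (m i) (p i)"
    and "\<And>i. i \<in> {1..n} \<Longrightarrow> detectable (A i) (C i)"
    and "\<And>i. i \<in> {1..n} \<Longrightarrow> stabilizable (A i) (B i)"
    and "\<And>i. i \<in> {1..n} \<Longrightarrow> stabilizing_riccati_solution (A i) (B i) (C i) (D i) (P i)"
    and "\<And>i. i \<in> {1..n} \<Longrightarrow> M i = kalman_gain (C i) (D i) (P i)"
    and "\<And>i. i \<in> {1..n} \<Longrightarrow> S i \<subseteq> {..<m i}"
    and "\<And>i. i \<in> {1..n} \<Longrightarrow> 0 \<le> \<rho> i"
    and "\<And>i. i \<in> {1..n} \<Longrightarrow> \<gamma>i i = hinf_norm (\<lambda>z.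
           cmat (L i) * kalman_tf (A i) (C i) (M i) z * cmat (C i) * cmat (selection_mat (m i) (S i)))"
    and "\<gamma> = Max ((\<lambda>i. \<gamma>i i * \<rho> i) ` {1..n})"
    and "prob_space \<Omega>"
    and "\<And>i. i \<in> {1..n} \<Longrightarrow> white_noise \<Omega> (q i) (w i)"
    and "prob_space.indep_vars \<Omega> (\<lambda>i. signal_space (q i)) (\<lambda>i \<omega> t. w i t \<omega>) {1..n}"
    and "\<And>i. i \<in> {1..n} \<Longrightarrow> gaussian_vec \<Omega> (m i) (X0 i) (xbar i)"
    and "\<And>i. i \<in> {1..n} \<Longrightarrow> indep_rv \<Omega>
           (vec_borel (m i)) (X0 i) (signal_space (q i)) (\<lambda>\<omega> t. w i t \<omega>)"
    and "white_noise \<Omega> l nu"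
    and "indep_rv \<Omega>
           (signal_space l) (\<lambda>\<omega> t. nu t \<omega>)
           (\<Pi>\<^sub>M i \<in> {1..n}. signal_space (q i) \<Otimes>\<^sub>M vec_borel (m i))
           (\<lambda>\<omega>. \<lambda>i \<in> {1..n}. (\<lambda>t. w i t \<omega>, X0 i \<omega>))"
  shows "differentially_private \<Omega> (signal_space l) (trajectories n m) (adj n m S \<rho>) \<epsilon> \<delta>
           (kalman_mechanism n l A C D L M xbar w (\<gamma> * kappa \<delta> \<epsilon>) nu)"
proof -
  note eps = assms(1) and del = assms(2,3) and n = assms(4) and ms = assms(5)
    and A = assms(6) and C = assms(8) and D = assms(9) and L = assms(10) and xb = assms(11)
    and rk = assms(12) and ric = assms(16) and gain = assms(17) and rho = assms(19)
    and gi = assms(20) and gam = assms(21) and \<Omega> = assms(22) and wn = assms(27) and ind = assms(28)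
  interpret \<Omega>: prob_space \<Omega> by (rule \<Omega>)
  have M: "M i \<in> carrier_mat (m i) (p i)" if i: "i \<in> {1..n}" for i
    using kalman_gain_carrier[OF C[OF i] D[OF i] rk[OF i], of "P i"] ric[OF i] carrier_matD(1)[OF A[OF i]]
    by (simp add: gain[OF i] stabilizing_riccati_solution_def)
  have K: "kalman_filter (m i) (p i) l (A i) (C i) (M i) (L i) (xbar i)" if i: "i \<in> {1..n}" for i
    using ms[OF i] A[OF i] C[OF i] M[OF i] L[OF i] xb[OF i] ric[OF i]
    by unfold_locales (simp_all add: gain[OF i] stabilizing_riccati_solution_def)
  define MW where "MW = (\<Pi>\<^sub>M i \<in> {1..n}. signal_space (q i) \<Otimes>\<^sub>M vec_borel (m i))"
  define W where "W \<omega> = (\<lambda>i \<in> {1..n}. (\<lambda>t. w i t \<omega>, X0 i \<omega>))" for \<omega>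
  let ?c = "\<gamma> * kappa \<delta> \<epsilon>"
  let ?mech = "kalman_mechanism n l A C D L M xbar w ?c nu"
  have ind': "indep_rv \<Omega> (signal_space l) (\<lambda>\<omega> t. nu t \<omega>) MW W"
    using ind unfolding MW_def W_def[abs_def] .
  then have Wm: "W \<in> \<Omega> \<rightarrow>\<^sub>M MW" and num: "(\<lambda>\<omega> t. nu t \<omega>) \<in> \<Omega> \<rightarrow>\<^sub>M signal_space l"
    by (simp_all add: indep_rv_def)
  \<comment> \<open>Measurements and filtered sum are written as functions of a point
    \<open>W\<close> of \<open>MW\<close>, so that freezing \<open>W\<close> freezes everything but
    the added noise.\<close>
  define Y where "Y x W i t = C i *\<^sub>v x i t + D i *\<^sub>v fst (W i) t"
    for x :: "nat \<Rightarrow> nat \<Rightarrow> real vec" and W :: "nat \<Rightarrow> (nat \<Rightarrow> real vec) \<times> real vec" and i t :: nat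
  define g where "g x W t = finsum_vec TYPE(real) l
      (\<lambda>i. L i *\<^sub>v kf_est (A i) (C i) (M i) (xbar i) (Y x W i) t) {1..n}" for x W t
  have Ym: "(\<lambda>W. Y x W i t) \<in> MW \<rightarrow>\<^sub>M vec_borel (p i)"
    if x: "x \<in> trajectories n m" and i: "i \<in> {1..n}" for x i t
  proof -
    have "(\<lambda>W. fst (W i)) \<in> MW \<rightarrow>\<^sub>M signal_space (q i)"
      unfolding MW_def by (rule measurable_compose[OF measurable_component_singleton[OF i] measurable_fst])
    then have "(\<lambda>W. fst (W i) t) \<in> MW \<rightarrow>\<^sub>M vec_borel (q i)"
      by (rule measurable_compose[OF _ measurable_signal_nth])
    moreover have "x i t \<in> carrier_vec (m i)" using x i by (simp add: trajectories_def)
    ultimately show ?thesis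
      unfolding Y_def by (intro measurable_vec_add measurable_mult_mat_vec[OF D[OF i]] measurable_const)
        (simp add: mult_mat_vec_carrier[OF C[OF i]])
  qed
  have gm: "g x \<in> MW \<rightarrow>\<^sub>M signal_space l" if x: "x \<in> trajectories n m" for x
    unfolding g_def[abs_def]
    by (intro measurable_signal_spaceI measurable_finsum_vec finite_atLeastAtMost
        kalman_filter.measurable_L_kf_est[OF K] Ym[OF x])
  have Yc: "Y x (W \<omega>) i t \<in> carrier_vec (p i)"
    if "\<omega> \<in> space \<Omega>" "x \<in> trajectories n m" "i \<in> {1..n}" for x \<omega> i t
    using measurable_space[OF measurable_compose[OF Wm Ym[OF that(2,3)]] that(1)] by simp
  have estc: "L i *\<^sub>v kf_est (A i) (C i) (M i) (xbar i) (Y x (W \<omega>) i) t \<in> carrier_vec l"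
    if "\<omega> \<in> space \<Omega>" "x \<in> trajectories n m" "i \<in> {1..n}" for x \<omega> i t
    by (rule mult_mat_vec_carrier[OF L[OF that(3)] kalman_filter.kf_est_carrier[OF K[OF that(3)] Yc[OF that]]])
  have mech: "?mech x \<omega> = (\<lambda>t. g x (W \<omega>) t + ?c \<cdot>\<^sub>v nu t \<omega>)"
    if \<omega>: "\<omega> \<in> space \<Omega>" and x: "x \<in> trajectories n m" for x \<omega>
  proof
    fix t
    have "finsum_vec TYPE(real) l (\<lambda>i. L i *\<^sub>v kf_est (A i) (C i) (M i) (xbar i)
        (\<lambda>t. C i *\<^sub>v x i t + D i *\<^sub>v w i t \<omega>) t) {1..n} = g x (W \<omega>) t"
      unfolding g_def
    proof (rule finsum_vec_cong)
      fix i assume i: "i \<in> {1..n}"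
      have "(\<lambda>t. C i *\<^sub>v x i t + D i *\<^sub>v w i t \<omega>) = Y x (W \<omega>) i"
        using i by (auto simp: Y_def W_def)
      then show "L i *\<^sub>v kf_est (A i) (C i) (M i) (xbar i) (\<lambda>t. C i *\<^sub>v x i t + D i *\<^sub>v w i t \<omega>) t =
          L i *\<^sub>v kf_est (A i) (C i) (M i) (xbar i) (Y x (W \<omega>) i) t"
        by simp
    qed (use estc[OF \<omega> x] in auto)
    then show "?mech x \<omega> t = g x (W \<omega>) t + ?c \<cdot>\<^sub>v nu t \<omega>"
      by (simp add: kalman_mechanism_def Let_def)
  qed
  have mechm: "?mech x \<in> \<Omega> \<rightarrow>\<^sub>M signal_space l" if x: "x \<in> trajectories n m" for x
  proof -
    have "(\<lambda>\<omega> t. g x (W \<omega>) t + ?c \<cdot>\<^sub>v nu t \<omega>) \<in> \<Omega> \<rightarrow>\<^sub>M signal_space l"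
      by (intro measurable_signal_spaceI measurable_vec_add measurable_vec_smult
          measurable_compose[OF measurable_compose[OF Wm gm[OF x]] measurable_signal_nth]
          measurable_compose[OF num measurable_signal_nth])
    then show ?thesis by (rule subst[OF measurable_cong, rotated]) (simp add: mech x)
  qed
  have privacy: "measure \<Omega> {\<omega> \<in> space \<Omega>. ?mech x \<omega> \<in> E} \<le> exp \<epsilon> * measure \<Omega> {\<omega> \<in> space \<Omega>. ?mech x' \<omega> \<in> E} + \<delta>"
    if x: "x \<in> trajectories n m" and x': "x' \<in> trajectories n m" and ad: "adj n m S \<rho> x x'"
      and E: "E \<in> sets (signal_space l)" for x x' E
  proof -
    obtain i0 where i0: "i0 \<in> {1..n}"
      and l2: "l2_signal (\<lambda>t. selection_mat (m i0) (S i0) *\<^sub>v x i0 t - selection_mat (m i0) (S i0) *\<^sub>v x' i0 t)"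
        "l2_norm (\<lambda>t. selection_mat (m i0) (S i0) *\<^sub>v x i0 t - selection_mat (m i0) (S i0) *\<^sub>v x' i0 t) \<le> \<rho> i0"
      and off: "\<And>t. (1\<^sub>m (m i0) - selection_mat (m i0) (S i0)) *\<^sub>v x i0 t = (1\<^sub>m (m i0) - selection_mat (m i0) (S i0)) *\<^sub>v x' i0 t"
      and rest: "\<And>j t. j \<in> {1..n} - {i0} \<Longrightarrow> x j t = x' j t"
      using ad unfolding adj_def Let_def by blast
    have xc: "x i0 t \<in> carrier_vec (m i0)" "x' i0 t \<in> carrier_vec (m i0)" for t
      using x x' i0 by (auto simp: trajectories_def)
    note od = kalman_filter.output_difference[OF K[OF i0] xc off l2, folded gi[OF i0]]
    obtain h where h: "\<And>t. h t \<in> carrier_vec l"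
      and hd: "\<And>v t. (\<And>t. v t \<in> carrier_vec (p i0)) \<Longrightarrow>
        L i0 *\<^sub>v kf_est (A i0) (C i0) (M i0) (xbar i0) (\<lambda>t. C i0 *\<^sub>v x i0 t + v t) t =
        L i0 *\<^sub>v kf_est (A i0) (C i0) (M i0) (xbar i0) (\<lambda>t. C i0 *\<^sub>v x' i0 t + v t) t + h t"
      and hb: "\<And>N. (\<Sum>t<N. scalar_prod (h t) (h t)) \<le> (\<gamma>i i0 * \<rho> i0)\<^sup>2"
      using od(2) by blast
    have g0: "0 \<le> \<gamma>i i0 * \<rho> i0" using od(1) rho[OF i0] by simp
    have gle: "\<gamma>i i0 * \<rho> i0 \<le> \<gamma>" unfolding gam using i0 by (intro Max_ge) auto
    \<comment> \<open>Only the summand of \<open>i0\<close> changes, and by the same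
      \<open>h\<close> for every outcome.\<close>
    have gx: "g x (W \<omega>) t = g x' (W \<omega>) t + h t" if \<omega>: "\<omega> \<in> space \<Omega>" for \<omega> t
      unfolding g_def
    proof (rule finsum_vec_add_single[OF _ i0 _ h])
      fix i assume i: "i \<in> {1..n}"
      have v: "D i0 *\<^sub>v fst (W \<omega> i0) t \<in> carrier_vec (p i0)" for t
        using D[OF i0] by (intro carrier_vecI) simp
      show "L i *\<^sub>v kf_est (A i) (C i) (M i) (xbar i) (Y x (W \<omega>) i) t =
          (if i = i0 then L i *\<^sub>v kf_est (A i) (C i) (M i) (xbar i) (Y x' (W \<omega>) i) t + h t
           else L i *\<^sub>v kf_est (A i) (C i) (M i) (xbar i) (Y x' (W \<omega>) i) t)"
      proof (cases "i = i0")
        case True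
        then show ?thesis using hd[OF v] by (simp add: Y_def[abs_def])
      next
        case False
        then have "Y x (W \<omega>) i = Y x' (W \<omega>) i" using rest i by (auto simp: Y_def)
        with False show ?thesis by simp
      qed
    qed (use estc[OF \<omega> x'] in auto)
    show ?thesis
    proof (cases "\<gamma> = 0")
      \<comment> \<open>No noise is added and the scale cannot be divided by; but the energy bound
        is 0 here, so \<open>h\<close> vanishes and the two outputs coincide.\<close>
      case True
      have "h t = 0\<^sub>v l" for t
      proof -
        have "\<gamma>i i0 * \<rho> i0 = 0" using g0 gle True by simp
        then have "(\<Sum>s<Suc t. scalar_prod (h s) (h s)) \<le> 0\<^sup>2" using hb[of "Suc t"] by (simp only:)
        moreover have "0 \<le> (\<Sum>s<t. scalar_prod (h s) (h s))"
          by (intro sum_nonneg) (simp add: scalar_prod_def sum_nonneg)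
        ultimately have "(cnorm (cvec (h t)))\<^sup>2 \<le> 0" unfolding cnorm_cvec_sq by simp
        then have "cnorm (cvec (h t)) = 0" by simp
        then have "cvec (h t) = 0\<^sub>v l" using cnorm_eq_0_iff[of "cvec (h t)" l] h[of t] by simp
        then show ?thesis using of_real_hom.vec_hom_zero_iff by blast
      qed
      moreover have "g x' (W \<omega>) t \<in> carrier_vec l" if "\<omega> \<in> space \<Omega>" for \<omega> t
        using measurable_space[OF measurable_compose[OF Wm gm[OF x']] that] by (simp add: space_signal_space)
      ultimately have "?mech x \<omega> = ?mech x' \<omega>" if "\<omega> \<in> space \<Omega>" for \<omega>
        using that by (simp add: mech x x' gx)
      then have "{\<omega> \<in> space \<Omega>. ?mech x \<omega> \<in> E} = {\<omega> \<in> space \<Omega>. ?mech x' \<omega> \<in> E}" by auto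
      moreover have "1 * measure \<Omega> {\<omega> \<in> space \<Omega>. ?mech x' \<omega> \<in> E} \<le> exp \<epsilon> * measure \<Omega> {\<omega> \<in> space \<Omega>. ?mech x' \<omega> \<in> E}"
        using eps by (intro mult_right_mono) auto
      ultimately show ?thesis using del by simp
    next
      case False
      have g: "0 < \<gamma>" using g0 gle False by linarith
      have kp: "0 < kappa \<delta> \<epsilon>" by (rule kappa_pos[OF eps])
      have "sqrt (\<Sum>t<N. scalar_prod (h t) (h t)) * kappa \<delta> \<epsilon> \<le> \<bar>?c\<bar>" for N
      proof -
        have "sqrt (\<Sum>t<N. scalar_prod (h t) (h t)) \<le> sqrt ((\<gamma>i i0 * \<rho> i0)\<^sup>2)"
          by (rule real_sqrt_le_mono[OF hb])
        also have "\<dots> \<le> \<gamma>" using g0 gle by simp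
        finally have "sqrt (\<Sum>t<N. scalar_prod (h t) (h t)) * kappa \<delta> \<epsilon> \<le> \<gamma> * kappa \<delta> \<epsilon>"
          using kp by (intro mult_right_mono) auto
        then show ?thesis using g kp by simp
      qed
      moreover have "?c \<noteq> 0" using g kp by simp
      ultimately have "measure \<Omega> {\<omega> \<in> space \<Omega>. (\<lambda>t. (g x' (W \<omega>) t + h t) + ?c \<cdot>\<^sub>v nu t \<omega>) \<in> E}
          \<le> exp \<epsilon> * measure \<Omega> {\<omega> \<in> space \<Omega>. (\<lambda>t. g x' (W \<omega>) t + ?c \<cdot>\<^sub>v nu t \<omega>) \<in> E} + \<delta>"
        by (intro shifted_noise_privacy[OF eps del \<Omega> wn ind' gm[OF x'] h _ _ E])
      then show ?thesis by (simp add: mech x x' gx cong: conj_cong)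
    qed
  qed
  show ?thesis
    unfolding differentially_private_def
  proof (intro conjI ballI impI)
    show "?mech x \<in> \<Omega> \<rightarrow>\<^sub>M signal_space l" if "x \<in> trajectories n m" for x
      by (rule mechm[OF that])
    fix x x' assume x: "x \<in> trajectories n m" and x': "x' \<in> trajectories n m" and ad: "adj n m S \<rho> x x'"
    \<comment> \<open>The bounding measure has to live on the output space, so probabilities of
      events in \<Omega> are rewritten through the law of the released signal.\<close>
    have dist: "measure (distr \<Omega> (signal_space l) (?mech z)) E = measure \<Omega> {\<omega> \<in> space \<Omega>. ?mech z \<omega> \<in> E}"
      if "z \<in> trajectories n m" "E \<in> sets (signal_space l)" for z E
      using mechm[OF that(1)] that(2) by (subst measure_distr) (auto intro!: arg_cong[where f="measure \<Omega>"])
    have "\<exists>mu. delta_bounded (signal_space l) \<delta> mu \<and> (\<forall>E\<in>sets (signal_space l).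
        measure (distr \<Omega> (signal_space l) (?mech x)) E \<le>
        exp \<epsilon> * measure (distr \<Omega> (signal_space l) (?mech x')) E + measure mu E)"
      using del privacy[OF x x' ad]
      by (intro delta_bounded_excess \<Omega>.prob_space_distr mechm x x') (simp_all add: dist x x')
    then show "\<exists>mu. delta_bounded (signal_space l) \<delta> mu \<and> (\<forall>E\<in>sets (signal_space l).
        measure \<Omega> {\<omega> \<in> space \<Omega>. ?mech x \<omega> \<in> E} \<le>
        exp \<epsilon> * measure \<Omega> {\<omega> \<in> space \<Omega>. ?mech x' \<omega> \<in> E} + measure mu E)"
      by (simp add: dist x x' cong: conj_cong)
  qed
qed

end
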